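(* Let $(s_n)_{n\ge 0}$ be an indeterminate Hamburger moment sequence with $s_0=1$, with orthonormal polynomials $(p_n)_{n\ge0}$, polynomials of the second kind $(q_n)_{n\ge 0}$, vectors $\mathfrak{p}_z=(p_n(z))_{n\ge0}$, $\mathfrak{q}_z=(q_n(z))_{n\ge0}$ in $\ell^2$ for $z\in\mathbb{C}$, and two-variable Nevanlinna functions $A,B,C,D$. Let $v_0\in\mathbb{R}$. (1) If $u_1\neq u_2$ satisfy $D(u_1,v_0)=D(u_2,v_0)=0$, then $\mathfrak{p}_{u_1},\mathfrak{p}_{u_2}$ are orthogonal in $\ell^2$, because $$\langle \mathfrak{p}_{u_1},\mathfrak{p}_{u_2}\rangle=\frac{D(u_1,u_2)}{u_1-u_2}\quad\text{and}\quad D(u_1,u_2)=D(u_1,v_0)C(v_0,u_2)-B(u_1,v_0)D(v_0,u_2)=0.$$ (2) In particular, if $u_1\neq v_0$ satisfies $D(u_1,v_0)=0$, then $$\langle \mathfrak{p}_{u_1},\mathfrak{p}_u+B(u,v_0)\mathfrak{p}_{v_0}\rangle=0\quad\text{whenever } D(u,v_0)=0,\ u\neq u_1,$$ so $\mathfrak{p}_{u_1}$ is orthogonal to $$\operatorname{span}\{\mathfrak{p}_u+B(u,v_0)\mathfrak{p}_{v_0}\mid D(u,v_0)=0,\ u\neq u_1\},$$ and the latter cannot be dense in $\ell^2$. In other words, the family $$\{\mathfrak{p}_u+B(u,v_0)\mathfrak{p}_{v_0}\mid u\in\mathbb{R},\ D(u,v_0)=0,\ u\neq v_0\}$$ is optimal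 for density in $\ell^2$. (3) Similarly, the family $$\{\mathfrak{q}_u-C(u,v_0)\mathfrak{q}_{v_0}\mid u\in\mathbb{R},\ A(u,v_0)=0,\ u\neq v_0\}$$ is optimal for density in $\ell^2$.
   Context: $\ell^2$ is the Hilbert space of square summable complex sequences $(c_n)_{n\ge0}$, with inner product $\langle\cdot,\cdot\rangle$. A Hamburger moment sequence is a sequence $s_n=\int x^n\,d\mu(x)$, $n\ge 0$, where $\mu$ is a positive measure on $\mathbb{R}$ with infinite support and moments of every order; it is normalized by $s_0=1$. Let $V$ be the set of all positive measures on $\mathbb{R}$ with these moments. The sequence is indeterminate if $V$ has more than one element. $(p_n)_{n\ge0}$ are the orthonormal polynomials: $p_n$ is a real polynomial of degree $n$ with positive leading coefficient and $\int p_np_m\,d\mu=\delta_{n,m}$ for $\mu\in V$. The polynomials of the second kind are $$q_n(z)=\int\frac{p_n(z)-p_n(x)}{z-x}\,d\mu(x),\quad z\in\mathbb{C},$$ where $\mu\in V$ is arbitrary. In the indeterminate case the sequences $\mathfrak{p}_z=(p_n(z))_{n\ge0}$ and $\mathfrak{q}_z=(q_n(z))_{n\ge0}$ belong to $\ell^2$ for every $z\in\mathbb{C}$. The Nevanlinna functions are the entire functions of $(u,v)\in\mathbb{C}^2$ $$A(u,v)=(u-v)\sum_{k=0}^\infty q_k(u)q_k(v),\qquad B(u,v)=-1+(u-v)\sum_{k=0}^\infty p_k(u)q_k(v),$$ $$C(u,v)=1+(u-v)\sum_{k=0}^\infty q_k(u)p_k(v),\qquad D(u,v)=(u-v)\sum_{k=0}^\infty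 p_k(u)p_k(v).$$ For fixed $v_0\in\mathbb{R}$, the zero set in $\mathbb{C}$ of each of the functions $u\mapsto A(u,v_0)$, $B(u,v_0)$, $C(u,v_0)$, $D(u,v_0)$ is a countably infinite set of real numbers. $\operatorname{span}$ denotes the set of finite complex linear combinations. A family of vectors is called optimal for density in $\ell^2$ in the sense that if one vector is removed from it, then the span is no longer dense in $\ell^2$.
   Formalization: In (3), since q_0 = 0 the q-family lies in the closed hyperplane {c in ℓ² : c_0 = 0} and cannot be dense in ℓ²; the formal statement asserts optimality for density in that hyperplane, together with non-density in ℓ² after removing any vector. *)

theory Defs
  imports "HOL-Analysis.Analysis" "HOL-Computational_Algebra.Polynomial"
begin

section \<open>The sequence space of square summable complex sequences\<close>

text \<open>
  The inner product is linear in the first argument. The value of \<open>suminf\<close> is only meaningful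
  for square summable arguments, so orthogonality, density and optimality below all carry
  membership in \<open>ell2\<close>.
\<close>

definition ell2 :: "(nat \<Rightarrow> complex) set" where
  "ell2 = {c. summable (\<lambda>n. (norm (c n))\<^sup>2)}"

definition ell2_inner :: "(nat \<Rightarrow> complex) \<Rightarrow> (nat \<Rightarrow> complex) \<Rightarrow> complex" where
  "ell2_inner c d = (\<Sum>n. c n * cnj (d n))"

definition ell2_norm :: "(nat \<Rightarrow> complex) \<Rightarrow> real" where
  "ell2_norm c = sqrt (\<Sum>n. (norm (c n))\<^sup>2)"

definition ell2_orthogonal :: "(nat \<Rightarrow> complex) \<Rightarrow> (nat \<Rightarrow> complex) \<Rightarrow> bool" where
  "ell2_orthogonal c d \<longleftrightarrow> c \<in> ell2 \<and> d \<in> ell2 \<and> ell2_inner c d = 0"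

definition cspan :: "(nat \<Rightarrow> complex) set \<Rightarrow> (nat \<Rightarrow> complex) set" where
  "cspan S = {c. \<exists>T a. finite T \<and> T \<subseteq> S \<and> c = (\<lambda>n. \<Sum>f\<in>T. a f * f n)}"

definition dense_in :: "(nat \<Rightarrow> complex) set \<Rightarrow> (nat \<Rightarrow> complex) set \<Rightarrow> bool" where
  "dense_in H S \<longleftrightarrow>
     (\<forall>c\<in>H. \<forall>\<epsilon>>0. \<exists>d\<in>S \<inter> H. ell2_norm (\<lambda>n. c n - d n) < \<epsilon>)"

text \<open>
  \<open>H\<close> is \<open>ell2\<close> or a closed subspace of it. An indexed family of vectors is optimal for density
  in \<open>H\<close> if its span is dense in \<open>H\<close> and is no longer dense once any single member is removed.
\<close>

definition optimal_for_density_in ::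
    "(nat \<Rightarrow> complex) set \<Rightarrow> 'i set \<Rightarrow> ('i \<Rightarrow> nat \<Rightarrow> complex) \<Rightarrow> bool" where
  "optimal_for_density_in H I f \<longleftrightarrow>
     (\<forall>i\<in>I. f i \<in> H) \<and>
     dense_in H (cspan (f ` I)) \<and>
     (\<forall>i\<in>I. \<not> dense_in H (cspan (f ` (I - {i}))))"

text \<open>
  The polynomial \<open>q\<^sub>0\<close> of the second kind vanishes identically, so vectors built from the
  sequences \<open>(q\<^sub>n(z))\<close> lie in this closed hyperplane and can span a dense subspace of it only,
  never of \<open>ell2\<close>.
\<close>

definition ell2_zero :: "(nat \<Rightarrow> complex) set" where
  "ell2_zero = {c \<in> ell2. c 0 = 0}"

section \<open>The Hamburger moment problem\<close>

definition measure_support :: "real measure \<Rightarrow> real set" where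
  "measure_support M = {x. \<forall>U. open U \<longrightarrow> x \<in> U \<longrightarrow> emeasure M U \<noteq> 0}"

definition moment_solutions :: "(nat \<Rightarrow> real) \<Rightarrow> real measure set" where
  "moment_solutions s =
     {M. sets M = sets borel \<and>
         (\<forall>n. integrable M (\<lambda>x. x ^ n) \<and> (LINT x|M. x ^ n) = s n)}"

definition hamburger_moment_sequence :: "(nat \<Rightarrow> real) \<Rightarrow> bool" where
  "hamburger_moment_sequence s \<longleftrightarrow> (\<exists>M\<in>moment_solutions s. infinite (measure_support M))"

definition indeterminate :: "(nat \<Rightarrow> real) \<Rightarrow> bool" where
  "indeterminate s \<longleftrightarrow> (\<exists>M\<in>moment_solutions s. \<exists>N\<in>moment_solutions s. M \<noteq> N)"

definition orthonormal_polynomials :: "(nat \<Rightarrow> real) \<Rightarrow> (nat \<Rightarrow> real poly) \<Rightarrow> bool" where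
  "orthonormal_polynomials s p \<longleftrightarrow>
     (\<forall>n. degree (p n) = n \<and> lead_coeff (p n) > 0) \<and>
     (\<forall>M\<in>moment_solutions s. \<forall>n m.
        (LINT x|M. poly (p n) x * poly (p m) x) = (if n = m then 1 else 0))"

definition pvec :: "(nat \<Rightarrow> real poly) \<Rightarrow> complex \<Rightarrow> nat \<Rightarrow> complex" where
  "pvec p z n = poly (map_poly of_real (p n)) z"

text \<open>
  The difference quotient in the integrand is a polynomial in \<open>x\<close> and \<open>z\<close>; on the diagonal it
  equals the derivative. This must be said explicitly because \<open>M\<close> may have an atom at a real \<open>z\<close>.
\<close>

definition qvec :: "real measure \<Rightarrow> (nat \<Rightarrow> real poly) \<Rightarrow> complex \<Rightarrow> nat \<Rightarrow> complex" where
  "qvec M p z n =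
     (LINT x|M. (if z = of_real x then poly (pderiv (map_poly of_real (p n))) z
                else (pvec p z n - pvec p (of_real x) n) / (z - of_real x)))"

section \<open>The two-variable Nevanlinna functions\<close>

definition nevA :: "real measure \<Rightarrow> (nat \<Rightarrow> real poly) \<Rightarrow> complex \<Rightarrow> complex \<Rightarrow> complex" where
  "nevA M p u v = (u - v) * (\<Sum>k. qvec M p u k * qvec M p v k)"

definition nevB :: "real measure \<Rightarrow> (nat \<Rightarrow> real poly) \<Rightarrow> complex \<Rightarrow> complex \<Rightarrow> complex" where
  "nevB M p u v = - 1 + (u - v) * (\<Sum>k. pvec p u k * qvec M p v k)"

definition nevC :: "real measure \<Rightarrow> (nat \<Rightarrow> real poly) \<Rightarrow> complex \<Rightarrow> complex \<Rightarrow> complex" where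
  "nevC M p u v = 1 + (u - v) * (\<Sum>k. qvec M p u k * pvec p v k)"

definition nevD :: "(nat \<Rightarrow> real poly) \<Rightarrow> complex \<Rightarrow> complex \<Rightarrow> complex" where
  "nevD p u v = (u - v) * (\<Sum>k. pvec p u k * pvec p v k)"

end

theory Submission
  imports Defs "HOL-Probability.Levy" "HOL-Computational_Algebra.Fundamental_Theorem_Algebra"
begin

text \<open>
  The orthonormal polynomials solve the second order recurrence of a Jacobi matrix, and the polynomials
  of the second kind are a second solution. Partial sums of the Nevanlinna functions are Casoratians of solutions, that is
  \<open>2 \<times> 2\<close> minors, and the identity \<open>D(u\<^sub>1,u\<^sub>2) = D(u\<^sub>1,v) C(v,u\<^sub>2) - B(u\<^sub>1,v) D(v,u\<^sub>2)\<close> is the limit of a Pluecker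
  relation (\<open>fD_pluecker\<close>). It yields that the zeros of \<open>D(\<cdot>,v)\<close> are real and that the vectors \<open>p\<^sub>u\<close> at the
  zeros are pairwise orthogonal. Since \<open>p\<^bsub>u\<^sub>1\<^esub>\<close> is also orthogonal to \<open>p\<^sub>v\<close>, no member of the family can be
  dropped.

  Density has two ingredients. First, the vectors \<open>p\<^sub>u\<close> at the zeros of \<open>D(\<cdot>,v)\<close> are complete. This is
  obtained from Gauss quadrature at the zeros of the \<open>n\<close>-th kernel: the quadrature formula is exact for \<open>x\<^sup>2 p\<^sub>m\<^sup>2\<close>, \<open>m < n\<close>,
  so its mass outside of \<open>[-\<rho>,\<rho>]\<close> is \<open>O(1 / \<rho>\<^sup>2)\<close> uniformly in \<open>n\<close>, and inside the nodes converge along a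
  subsequence (\<open>parseval_lower_bound\<close>). Secondly, \<open>p\<^sub>v\<close> itself is a limit of combinations of the
  vectors \<open>p\<^sub>u + B(u,v) p\<^sub>v\<close>, \<open>u \<noteq> v\<close>. This holds because the sum of \<open>B(u,v)\<^sup>2 / \<parallel>p\<^sub>u\<parallel>\<^sup>2\<close> over the zeros diverges
  (\<open>weighted_sum_unbounded\<close>): otherwise \<open>B(\<cdot>,v)\<close> would be a nonzero square integrable function orthogonal to all
  polynomials.

  The family built from the second kind is the same family for the Jacobi matrix with its first row and
  column deleted (\<open>second_kind_optimal\<close>).

  Finally, indeterminacy is used through the Stieltjes transform: two solutions have different
  transforms at some point \<open>z\<close>, and Bessel's inequality for \<open>1 / (x - z)\<close> shows that \<open>p\<^sub>z\<close> and \<open>q\<^sub>z\<close> are square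
  summable (\<open>indeterminate_limit_circle\<close>). Variation of constants extends this to all points, with locally
  uniform bounds (\<open>solution_bound\<close>).
\<close>

section \<open>Square summable sequences\<close>

lemma ell2_summable_mult:
  fixes c d :: "nat \<Rightarrow> 'a::real_normed_algebra"
  assumes "summable (\<lambda>n. (norm (c n))\<^sup>2)" "summable (\<lambda>n. (norm (d n))\<^sup>2)"
  shows "summable (\<lambda>n. norm (c n * d n))"
proof (rule summable_comparison_test')
  show "summable (\<lambda>n. (norm (c n))\<^sup>2 + (norm (d n))\<^sup>2)"
    by (intro summable_add assms)
  show "norm (norm (c n * d n)) \<le> (norm (c n))\<^sup>2 + (norm (d n))\<^sup>2" for n
  proof -
    have "norm (c n * d n) \<le> norm (c n) * norm (d n)" by (rule norm_mult_ineq)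
    moreover have "2 * (norm (c n) * norm (d n)) \<le> (norm (c n))\<^sup>2 + (norm (d n))\<^sup>2"
      using sum_squares_bound[of "norm (c n)" "norm (d n)"] by (simp add: mult.assoc)
    moreover have "0 \<le> norm (c n) * norm (d n)" by simp
    ultimately show ?thesis by (simp only: real_norm_def abs_norm_cancel)
  qed
qed

lemma ell2_norm_nonneg: "c \<in> ell2 \<Longrightarrow> 0 \<le> ell2_norm c"
  by (simp add: ell2_norm_def ell2_def suminf_nonneg)

lemma ell2_norm_sq: "c \<in> ell2 \<Longrightarrow> (ell2_norm c)\<^sup>2 = (\<Sum>n. (norm (c n))\<^sup>2)"
  by (simp add: ell2_norm_def ell2_def suminf_nonneg)

lemma L2_set_tendsto_ell2_norm:
  assumes "c \<in> ell2"
  shows "(\<lambda>N. L2_set (\<lambda>n. norm (c n)) {..<N}) \<longlonglongrightarrow> ell2_norm c"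
  unfolding L2_set_def ell2_norm_def
  using assms by (intro tendsto_real_sqrt summable_LIMSEQ) (simp add: ell2_def)

lemma L2_set_le_ell2_norm: "c \<in> ell2 \<Longrightarrow> L2_set (\<lambda>n. norm (c n)) {..<N} \<le> ell2_norm c"
  unfolding L2_set_def ell2_norm_def by (auto simp: ell2_def intro!: sum_le_suminf)

lemma norm_le_ell2_norm:
  assumes "c \<in> ell2" shows "norm (c n) \<le> ell2_norm c"
proof -
  have "norm (c n) \<le> L2_set (\<lambda>n. norm (c n)) {..<Suc n}"
    by (rule member_le_L2_set) auto
  also have "\<dots> \<le> ell2_norm c" by (rule L2_set_le_ell2_norm[OF assms])
  finally show ?thesis .
qed

text \<open>
  Bounds on all finite sections give membership and a norm bound at once; the triangle
  inequality is transferred in this way from \<open>L2_set\<close>.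
\<close>

lemma ell2_I_bound:
  assumes "\<And>N. L2_set (\<lambda>n. norm (c n)) {..<N} \<le> K"
  shows "c \<in> ell2" "ell2_norm c \<le> K"
proof -
  have "(\<Sum>n<N. (norm (c n))\<^sup>2) \<le> K\<^sup>2" for N
    using assms[of N] unfolding L2_set_def by (rule sqrt_le_D)
  then have "summable (\<lambda>n. (norm (c n))\<^sup>2)"
    by (intro bounded_imp_summable[of _ "K\<^sup>2"]) (simp_all only: zero_le_power2 lessThan_Suc_atMost[symmetric])
  then show c: "c \<in> ell2" by (simp add: ell2_def)
  show "ell2_norm c \<le> K"
    by (rule LIMSEQ_le_const2[OF L2_set_tendsto_ell2_norm[OF c]]) (use assms in auto)
qed

lemma
  assumes "c \<in> ell2" "d \<in> ell2"
  shows ell2_add: "(\<lambda>n. c n + d n) \<in> ell2"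
    and ell2_norm_triangle: "ell2_norm (\<lambda>n. c n + d n) \<le> ell2_norm c + ell2_norm d"
proof -
  have "L2_set (\<lambda>n. norm (c n + d n)) {..<N} \<le> ell2_norm c + ell2_norm d" for N
  proof -
    have "L2_set (\<lambda>n. norm (c n + d n)) {..<N} \<le> L2_set (\<lambda>n. norm (c n) + norm (d n)) {..<N}"
      by (intro L2_set_mono norm_triangle_ineq) auto
    also have "\<dots> \<le> L2_set (\<lambda>n. norm (c n)) {..<N} + L2_set (\<lambda>n. norm (d n)) {..<N}"
      by (rule L2_set_triangle_ineq)
    also have "\<dots> \<le> ell2_norm c + ell2_norm d"
      by (intro add_mono L2_set_le_ell2_norm assms)
    finally show ?thesis .
  qed
  from ell2_I_bound[OF this]
  show "(\<lambda>n. c n + d n) \<in> ell2" "ell2_norm (\<lambda>n. c n + d n) \<le> ell2_norm c + ell2_norm d" .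
qed

lemma ell2_scale: "c \<in> ell2 \<Longrightarrow> (\<lambda>n. t * c n) \<in> ell2"
  by (simp add: ell2_def norm_mult power_mult_distrib summable_mult)

lemma ell2_norm_scale: "c \<in> ell2 \<Longrightarrow> ell2_norm (\<lambda>n. t * c n) = norm t * ell2_norm c"
  by (simp add: ell2_def ell2_norm_def norm_mult power_mult_distrib suminf_mult real_sqrt_mult)

lemma ell2_diff: "c \<in> ell2 \<Longrightarrow> d \<in> ell2 \<Longrightarrow> (\<lambda>n. c n - d n) \<in> ell2"
  using ell2_add[of c "\<lambda>n. (-1) * d n"] ell2_scale[of d "-1"] by simp

lemma ell2_zero_vector: "(\<lambda>n. 0) \<in> ell2" by (simp add: ell2_def)

lemma ell2_sum:
  assumes "\<And>i. i \<in> F \<Longrightarrow> g i \<in> ell2"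
  shows "(\<lambda>n. \<Sum>i\<in>F. g i n) \<in> ell2"
  using assms by (induction F rule: infinite_finite_induct) (auto simp: ell2_zero_vector ell2_add)

lemma ell2_cauchy_schwarz:
  assumes "c \<in> ell2" "d \<in> ell2"
  shows "norm (\<Sum>n. c n * d n) \<le> ell2_norm c * ell2_norm d"
proof -
  have s: "summable (\<lambda>n. norm (c n * d n))"
    using assms by (intro ell2_summable_mult) (auto simp: ell2_def)
  have "norm (\<Sum>n. c n * d n) \<le> (\<Sum>n. norm (c n * d n))" by (rule summable_norm[OF s])
  also have "\<dots> \<le> ell2_norm c * ell2_norm d"
  proof (rule suminf_le_const[OF s])
    fix N
    have "(\<Sum>n<N. norm (c n * d n)) = (\<Sum>n<N. \<bar>norm (c n)\<bar> * \<bar>norm (d n)\<bar>)" by (simp add: norm_mult)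
    also have "\<dots> \<le> L2_set (\<lambda>n. norm (c n)) {..<N} * L2_set (\<lambda>n. norm (d n)) {..<N}"
      by (rule L2_set_mult_ineq)
    also have "\<dots> \<le> ell2_norm c * ell2_norm d"
      by (intro mult_mono L2_set_le_ell2_norm assms ell2_norm_nonneg) auto
    finally show "(\<Sum>n<N. norm (c n * d n)) \<le> ell2_norm c * ell2_norm d" .
  qed
  finally show ?thesis .
qed

subsection \<open>Linear spans and their closures\<close>

text \<open>
  Linear combinations over the index set instead of over the set of values. Since \<open>f\<close> may fail to
  be injective, the coefficients of equal values are added up.
\<close>

lemma cspan_image:
  "cspan (f ` I) = {c. \<exists>F t. finite F \<and> F \<subseteq> I \<and> c = (\<lambda>n. \<Sum>i\<in>F. t i * f i n)}"
proof (intro set_eqI iffI)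
  fix c assume "c \<in> cspan (f ` I)"
  then obtain T a where T: "finite T" "T \<subseteq> f ` I" "c = (\<lambda>n. \<Sum>g\<in>T. a g * g n)"
    unfolding cspan_def by blast
  then obtain F where F: "F \<subseteq> I" "inj_on f F" "T = f ` F"
    using T(2) unfolding subset_image_inj by blast
  have finF: "finite F" using T(1) F(2) unfolding F(3) by (rule finite_imageD)
  have "c = (\<lambda>n. \<Sum>i\<in>F. a (f i) * f i n)"
  proof
    fix n
    have "c n = (\<Sum>g\<in>T. a g * g n)" by (subst T(3)) (rule refl)
    also have "\<dots> = (\<Sum>i\<in>F. a (f i) * f i n)"
      by (rule sum.reindex_cong[OF F(2,3)]) (rule refl)
    finally show "c n = (\<Sum>i\<in>F. a (f i) * f i n)" .
  qed
  then show "c \<in> {c. \<exists>F t. finite F \<and> F \<subseteq> I \<and> c = (\<lambda>n. \<Sum>i\<in>F. t i * f i n)}"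
    using finF F(1) by (intro CollectI exI[of _ F] exI[of _ "\<lambda>i. a (f i)"] conjI)
next
  fix c assume "c \<in> {c. \<exists>F t. finite F \<and> F \<subseteq> I \<and> c = (\<lambda>n. \<Sum>i\<in>F. t i * f i n)}"
  then obtain F t where F: "finite F" "F \<subseteq> I" "c = (\<lambda>n. \<Sum>i\<in>F. t i * f i n)"
    by (elim CollectE exE conjE)
  have "c n = (\<Sum>g\<in>f ` F. (\<Sum>i\<in>{i\<in>F. f i = g}. t i) * g n)" for n
  proof -
    have "c n = (\<Sum>g\<in>f ` F. \<Sum>i\<in>{i\<in>F. f i = g}. t i * f i n)"
      by (simp add: F(3) sum.image_gen[OF F(1), of _ f])
    also have "\<dots> = (\<Sum>g\<in>f ` F. (\<Sum>i\<in>{i\<in>F. f i = g}. t i) * g n)"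
      by (simp add: sum_distrib_right)
    finally show ?thesis .
  qed
  then show "c \<in> cspan (f ` I)"
    using F(1,2) unfolding cspan_def
    by (intro CollectI exI[of _ "f ` F"] exI[of _ "\<lambda>g. \<Sum>i\<in>{i\<in>F. f i = g}. t i"] conjI ext)
       (auto simp del: sum_distrib_right)
qed

lemma cspan_add:
  assumes "c \<in> cspan S" "d \<in> cspan S" shows "(\<lambda>n. c n + d n) \<in> cspan S"
proof -
  obtain T a where T: "finite T" "T \<subseteq> S" "c = (\<lambda>n. \<Sum>g\<in>T. a g * g n)"
    using assms unfolding cspan_def by (elim CollectE exE conjE)
  obtain U b where U: "finite U" "U \<subseteq> S" "d = (\<lambda>n. \<Sum>g\<in>U. b g * g n)"
    using assms unfolding cspan_def by (elim CollectE exE conjE)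
  have "c n + d n = (\<Sum>g\<in>T \<union> U. ((if g \<in> T then a g else 0) + (if g \<in> U then b g else 0)) * g n)" for n
  proof -
    have "c n = (\<Sum>g\<in>T \<union> U. (if g \<in> T then a g else 0) * g n)"
      unfolding T(3) using T U by (intro sum.mono_neutral_cong_left) auto
    moreover have "d n = (\<Sum>g\<in>T \<union> U. (if g \<in> U then b g else 0) * g n)"
      unfolding U(3) using T U by (intro sum.mono_neutral_cong_left) auto
    ultimately show ?thesis by (simp add: sum.distrib[symmetric] distrib_right)
  qed
  then show ?thesis unfolding cspan_def using T(1,2) U(1,2)
    by (intro CollectI exI[of _ "T \<union> U"] conjI ext
      exI[of _ "\<lambda>g. (if g \<in> T then a g else 0) + (if g \<in> U then b g else 0)"]) auto
qed

lemma cspan_scale: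
  assumes "c \<in> cspan S" shows "(\<lambda>n. t * c n) \<in> cspan S"
proof -
  obtain T a where T: "finite T" "T \<subseteq> S" "c = (\<lambda>n. \<Sum>g\<in>T. a g * g n)"
    using assms unfolding cspan_def by (elim CollectE exE conjE)
  then show ?thesis unfolding cspan_def
    by (intro CollectI exI[of _ T] exI[of _ "\<lambda>g. t * a g"] conjI)
       (simp_all add: sum_distrib_left mult.assoc)
qed

lemma cspan_superset: "c \<in> S \<Longrightarrow> c \<in> cspan S"
  unfolding cspan_def by (auto intro!: exI[of _ "{c}"] exI[of _ "\<lambda>_. 1"])

lemma cspan_zero: "(\<lambda>n. 0) \<in> cspan S"
  unfolding cspan_def by (auto intro!: exI[of _ "{}"])

definition ell2_closure :: "(nat \<Rightarrow> complex) set \<Rightarrow> (nat \<Rightarrow> complex) set" where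
  "ell2_closure S = {c \<in> ell2. \<forall>\<epsilon>>0. \<exists>d\<in>S \<inter> ell2. ell2_norm (\<lambda>n. c n - d n) < \<epsilon>}"

lemma dense_in_ell2_iff: "dense_in ell2 S \<longleftrightarrow> ell2 \<subseteq> ell2_closure S"
  by (auto simp: dense_in_def ell2_closure_def)

lemma ell2_closure_superset: "c \<in> S \<Longrightarrow> c \<in> ell2 \<Longrightarrow> c \<in> ell2_closure S"
  by (auto simp: ell2_closure_def ell2_norm_def intro!: bexI[of _ c])

lemma ell2_closure_add:
  assumes "c \<in> ell2_closure (cspan S)" "d \<in> ell2_closure (cspan S)"
  shows "(\<lambda>n. c n + d n) \<in> ell2_closure (cspan S)"
proof -
  have cd: "c \<in> ell2" "d \<in> ell2" using assms by (auto simp: ell2_closure_def)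
  have "\<exists>x\<in>cspan S \<inter> ell2. ell2_norm (\<lambda>n. c n + d n - x n) < \<epsilon>" if e: "\<epsilon> > 0" for \<epsilon>
  proof -
    obtain x where x: "x \<in> cspan S" "x \<in> ell2" "ell2_norm (\<lambda>n. c n - x n) < \<epsilon> / 2"
      using assms(1) e by (auto simp: ell2_closure_def dest!: spec[of _ "\<epsilon> / 2"])
    obtain y where y: "y \<in> cspan S" "y \<in> ell2" "ell2_norm (\<lambda>n. d n - y n) < \<epsilon> / 2"
      using assms(2) e by (auto simp: ell2_closure_def dest!: spec[of _ "\<epsilon> / 2"])
    have "ell2_norm (\<lambda>n. (c n - x n) + (d n - y n)) \<le>
        ell2_norm (\<lambda>n. c n - x n) + ell2_norm (\<lambda>n. d n - y n)"
      by (intro ell2_norm_triangle ell2_diff x y cd)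
    also have "\<dots> < \<epsilon>" using x y by simp
    finally have "ell2_norm (\<lambda>n. c n + d n - (x n + y n)) < \<epsilon>" by (simp add: algebra_simps)
    then show ?thesis using x y
      by (intro bexI[of _ "\<lambda>n. x n + y n"]) (auto simp: cspan_add ell2_add)
  qed
  then show ?thesis using cd by (auto simp: ell2_closure_def ell2_add)
qed

lemma ell2_closure_scale:
  assumes "c \<in> ell2_closure (cspan S)"
  shows "(\<lambda>n. t * c n) \<in> ell2_closure (cspan S)"
proof -
  have c: "c \<in> ell2" using assms by (auto simp: ell2_closure_def)
  have "\<exists>x\<in>cspan S \<inter> ell2. ell2_norm (\<lambda>n. t * c n - x n) < \<epsilon>" if e: "\<epsilon> > 0" for \<epsilon>
  proof -
    have e': "\<epsilon> / (norm t + 1) > 0" using e by (simp add: add_nonneg_pos)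
    obtain x where x: "x \<in> cspan S" "x \<in> ell2" "ell2_norm (\<lambda>n. c n - x n) < \<epsilon> / (norm t + 1)"
      using assms e' by (auto simp: ell2_closure_def)
    have "ell2_norm (\<lambda>n. t * c n - t * x n) = norm t * ell2_norm (\<lambda>n. c n - x n)"
      using ell2_norm_scale[OF ell2_diff[OF c x(2)], of t] by (simp add: algebra_simps)
    also have "\<dots> \<le> (norm t + 1) * ell2_norm (\<lambda>n. c n - x n)"
      by (intro mult_right_mono ell2_norm_nonneg ell2_diff c x) auto
    also have "\<dots> < \<epsilon>" using x(3) by (simp add: pos_less_divide_eq add_nonneg_pos mult.commute)
    finally show ?thesis using x
      by (intro bexI[of _ "\<lambda>n. t * x n"]) (auto simp: cspan_scale ell2_scale)
  qed
  then show ?thesis using c by (auto simp: ell2_closure_def ell2_scale)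
qed

lemma ell2_closure_sum:
  assumes "\<And>i. i \<in> F \<Longrightarrow> g i \<in> ell2_closure (cspan S)"
  shows "(\<lambda>n. \<Sum>i\<in>F. t i * g i n) \<in> ell2_closure (cspan S)"
  using assms
proof (induction F rule: infinite_finite_induct)
  case (insert x F)
  then show ?case by (auto intro!: ell2_closure_add ell2_closure_scale)
qed (simp_all add: ell2_closure_superset cspan_zero ell2_zero_vector)

lemma ell2_closure_closed:
  assumes "c \<in> ell2" "\<And>\<epsilon>. \<epsilon> > 0 \<Longrightarrow> \<exists>d\<in>ell2_closure S. ell2_norm (\<lambda>n. c n - d n) < \<epsilon>"
  shows "c \<in> ell2_closure S"
proof -
  have "\<exists>x\<in>S \<inter> ell2. ell2_norm (\<lambda>n. c n - x n) < \<epsilon>" if e: "\<epsilon> > 0" for \<epsilon>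
  proof -
    obtain d where d: "d \<in> ell2_closure S" "ell2_norm (\<lambda>n. c n - d n) < \<epsilon> / 2"
      using assms(2)[of "\<epsilon> / 2"] e by auto
    then have d2: "d \<in> ell2" by (simp add: ell2_closure_def)
    obtain x where x: "x \<in> S" "x \<in> ell2" "ell2_norm (\<lambda>n. d n - x n) < \<epsilon> / 2"
      using d e by (auto simp: ell2_closure_def dest!: spec[of _ "\<epsilon> / 2"])
    have "ell2_norm (\<lambda>n. (c n - d n) + (d n - x n)) \<le>
        ell2_norm (\<lambda>n. c n - d n) + ell2_norm (\<lambda>n. d n - x n)"
      by (intro ell2_norm_triangle ell2_diff x d2 assms(1))
    also have "\<dots> < \<epsilon>" using x d by simp
    finally have "ell2_norm (\<lambda>n. c n - x n) < \<epsilon>" by simp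
    then show ?thesis using x by auto
  qed
  then show ?thesis using assms(1) by (auto simp: ell2_closure_def)
qed

definition basis_vector :: "nat \<Rightarrow> nat \<Rightarrow> 'a::zero_neq_one" where
  "basis_vector m n = (if n = m then 1 else 0)"

lemma basis_vector_ell2: "basis_vector m \<in> ell2"
proof -
  have "summable (\<lambda>n. (norm (basis_vector m n :: complex))\<^sup>2)"
    by (rule summable_finite[of "{m}"]) (auto simp: basis_vector_def)
  then show ?thesis by (simp add: ell2_def)
qed

text \<open>
  Density is shown by approximating each unit vector explicitly instead of by computing an orthogonal
  complement; this is enough since every square summable sequence is a limit of its truncations.
\<close>

lemma dense_if_basis_in_closure:
  assumes "\<And>m. basis_vector m \<in> ell2_closure (cspan S)"
  shows "dense_in ell2 (cspan S)"
  unfolding dense_in_ell2_iff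
proof
  fix c assume c: "c \<in> ell2"
  then have sc: "summable (\<lambda>n. (norm (c n))\<^sup>2)" by (simp add: ell2_def)
  show "c \<in> ell2_closure (cspan S)"
  proof (rule ell2_closure_closed[OF c])
    fix \<epsilon> :: real assume e: "\<epsilon> > 0"
    have "eventually (\<lambda>N. norm (\<Sum>n. (norm (c (n + N)))\<^sup>2) < \<epsilon>\<^sup>2) sequentially"
      using suminf_exist_split[of "\<epsilon>\<^sup>2", OF _ sc] e unfolding eventually_sequentially by auto
    then obtain N where N: "norm (\<Sum>n. (norm (c (n + N)))\<^sup>2) < \<epsilon>\<^sup>2"
      by (auto simp: eventually_sequentially)
    define d where "d = (\<lambda>n. \<Sum>m<N. c m * basis_vector m n)"
    have dn: "d n = (if n < N then c n else 0)" for n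
      by (simp add: d_def basis_vector_def if_distrib cong: if_cong)
    have sum0: "summable (\<lambda>n. (norm (c n - d n))\<^sup>2)"
      by (rule summable_comparison_test'[OF sc]) (auto simp: dn)
    have "(\<Sum>n. (norm (c n - d n))\<^sup>2) = (\<Sum>n. (norm (c (n + N) - d (n + N)))\<^sup>2)"
      by (subst suminf_split_initial_segment[OF sum0, of N]) (simp add: dn)
    also have "\<dots> < \<epsilon>\<^sup>2" using N by (simp add: dn)
    finally have "ell2_norm (\<lambda>n. c n - d n) < sqrt (\<epsilon>\<^sup>2)"
      unfolding ell2_norm_def by (rule real_sqrt_less_mono)
    then have "ell2_norm (\<lambda>n. c n - d n) < \<epsilon>" using e by simp
    moreover have "d \<in> ell2_closure (cspan S)" unfolding d_def
      by (intro ell2_closure_sum assms)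
    ultimately show "\<exists>d\<in>ell2_closure (cspan S). ell2_norm (\<lambda>n. c n - d n) < \<epsilon>" by blast
  qed
qed

lemma not_dense_if_orthogonal:
  assumes x: "x \<in> ell2" "x k \<noteq> 0" and S: "S \<subseteq> ell2" "\<And>d. d \<in> S \<Longrightarrow> ell2_inner x d = 0"
  shows "\<not> dense_in ell2 S"
proof
  assume "dense_in ell2 S"
  have pos: "ell2_norm x > 0" using norm_le_ell2_norm[OF x(1), of k] x(2)
    by (metis less_le_trans zero_less_norm_iff)
  then obtain d where d: "d \<in> S" "ell2_norm (\<lambda>n. x n - d n) < ell2_norm x"
    using \<open>dense_in ell2 S\<close> x(1) by (auto simp: dense_in_def)
  have d2: "d \<in> ell2" using d S by auto
  have "complex_of_real ((ell2_norm x)\<^sup>2) = (\<Sum>n. x n * cnj (x n))"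
    using x(1) unfolding ell2_norm_sq[OF x(1)]
    by (subst suminf_of_real) (auto simp: ell2_def complex_norm_square[symmetric] simp del: of_real_power)
  also have "\<dots> = (\<Sum>n. x n * cnj (x n)) - (\<Sum>n. x n * cnj (d n))"
    using S(2)[OF d(1)] by (simp add: ell2_inner_def)
  also have "\<dots> = (\<Sum>n. x n * cnj (x n - d n))"
  proof (subst suminf_diff)
    show "summable (\<lambda>n. x n * cnj (x n))" "summable (\<lambda>n. x n * cnj (d n))"
      using ell2_summable_mult[of x "\<lambda>n. cnj (x n)"] ell2_summable_mult[of x "\<lambda>n. cnj (d n)"] x d2
      by (auto simp: ell2_def intro: summable_norm_cancel)
  qed (simp add: algebra_simps)
  finally have "(ell2_norm x)\<^sup>2 = norm (\<Sum>n. x n * cnj (x n - d n))"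
    by (metis norm_of_real abs_power2)
  also have "\<dots> \<le> ell2_norm x * ell2_norm (\<lambda>n. cnj (x n - d n))"
    using ell2_diff[OF x(1) d2] x by (intro ell2_cauchy_schwarz) (auto simp: ell2_def simp flip: complex_cnj_diff)
  also have "ell2_norm (\<lambda>n. cnj (x n - d n)) = ell2_norm (\<lambda>n. x n - d n)"
    by (simp add: ell2_norm_def flip: complex_cnj_diff)
  finally have "ell2_norm x * ell2_norm x \<le> ell2_norm x * ell2_norm (\<lambda>n. x n - d n)"
    by (simp add: power2_eq_square)
  with pos d show False by simp
qed

subsection \<open>Orthogonality and spans\<close>

lemma ell2_orthogonal_add_scale:
  assumes "ell2_orthogonal c d" "ell2_orthogonal c e"
  shows "ell2_orthogonal c (\<lambda>n. d n + t * e n)"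
proof -
  have "summable (\<lambda>n. c n * cnj (d n))" "summable (\<lambda>n. c n * cnj (e n))"
    using assms by (auto intro!: summable_norm_cancel[OF ell2_summable_mult] simp: ell2_orthogonal_def ell2_def)
  then have "(\<lambda>n. c n * cnj (d n) + cnj t * (c n * cnj (e n))) sums (ell2_inner c d + cnj t * ell2_inner c e)"
    unfolding ell2_inner_def by (intro sums_add sums_mult summable_sums)
  then have "(\<lambda>n. c n * cnj (d n + t * e n)) sums (ell2_inner c d + cnj t * ell2_inner c e)"
    by (simp add: algebra_simps)
  then show ?thesis
    using assms by (simp add: ell2_orthogonal_def ell2_add ell2_scale ell2_inner_def sums_iff)
qed

lemma ell2_orthogonal_cspan:
  assumes "\<And>d. d \<in> S \<Longrightarrow> ell2_orthogonal c d" "c \<in> ell2" "d \<in> cspan S"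
  shows "ell2_orthogonal c d"
proof -
  have *: "ell2_orthogonal c (\<lambda>n. \<Sum>g\<in>T. t g * g n)" if "finite T" "T \<subseteq> S" for T t
    using that
  proof (induction T rule: finite_induct)
    case empty
    then show ?case using assms(2) by (simp add: ell2_orthogonal_def ell2_zero_vector ell2_inner_def)
  next
    case (insert g T)
    then have "ell2_orthogonal c (\<lambda>n. (\<Sum>g\<in>T. t g * g n) + t g * g n)"
      by (intro ell2_orthogonal_add_scale) (auto intro: assms(1))
    then show ?case using insert by (simp add: add.commute)
  qed
  obtain T t where "finite T" "T \<subseteq> S" "d = (\<lambda>n. \<Sum>g\<in>T. t g * g n)"
    using assms(3) unfolding cspan_def by (elim CollectE exE conjE)
  then show ?thesis using *[of T t] by simp
qed

section \<open>Jacobi matrices and their second order recurrence\<close>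

locale jacobi_matrix =
  fixes a b :: "nat \<Rightarrow> real"
  assumes b_pos: "b n > 0"
begin

text \<open>
  The inhomogeneity \<open>\<tau>\<close> enters only the first equation. With \<open>\<tau> = 0\<close> the solutions are the multiples of
  the orthonormal polynomials, and with \<open>\<tau> = 1\<close> the polynomials of the second kind occur; treating
  both at once covers the different Nevanlinna functions by a single Casoratian formula.
\<close>

definition recurrence :: "'a::real_normed_field \<Rightarrow> 'a \<Rightarrow> (nat \<Rightarrow> 'a) \<Rightarrow> bool" where
  "recurrence z \<tau> y \<longleftrightarrow>
     of_real (b 0) * y 1 = (z - of_real (a 0)) * y 0 + \<tau> \<and>
     (\<forall>n. of_real (b (Suc n)) * y (Suc (Suc n)) =
        (z - of_real (a (Suc n))) * y (Suc n) - of_real (b n) * y n)"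

fun solution :: "'a::real_normed_field \<Rightarrow> 'a \<Rightarrow> 'a \<Rightarrow> nat \<Rightarrow> 'a" where
  "solution z \<tau> c 0 = c"
| "solution z \<tau> c (Suc 0) = ((z - of_real (a 0)) * c + \<tau>) / of_real (b 0)"
| "solution z \<tau> c (Suc (Suc n)) =
     ((z - of_real (a (Suc n))) * solution z \<tau> c (Suc n) - of_real (b n) * solution z \<tau> c n)
       / of_real (b (Suc n))"

definition P :: "'a::real_normed_field \<Rightarrow> nat \<Rightarrow> 'a" where "P z = solution z 0 1"

definition Q :: "'a::real_normed_field \<Rightarrow> nat \<Rightarrow> 'a" where "Q z = solution z 1 0"

lemma b_nz [simp]: "b n \<noteq> 0" using b_pos[of n] by simp

lemma recurrence_solution: "recurrence z \<tau> (solution z \<tau> c)"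
  by (simp add: recurrence_def)

lemma recurrence_P: "recurrence z 0 (P z)" and recurrence_Q: "recurrence z 1 (Q z)"
  unfolding P_def Q_def by (rule recurrence_solution)+

lemma P_0 [simp]: "P z 0 = 1" and Q_0 [simp]: "Q z 0 = 0"
  by (simp_all add: P_def Q_def)

lemma recurrence_unique:
  assumes "recurrence z \<tau> x" "recurrence z \<tau> y" "x 0 = y 0"
  shows "x = y"
proof
  fix n
  have "x n = y n \<and> x (Suc n) = y (Suc n)"
  proof (induction n)
    case 0
    have "of_real (b 0) * x 1 = of_real (b 0) * y 1" using assms by (simp add: recurrence_def)
    then show ?case using assms(3) by simp
  next
    case (Suc n)
    have "of_real (b (Suc n)) * x (Suc (Suc n)) = of_real (b (Suc n)) * y (Suc (Suc n))"
      using assms Suc by (simp add: recurrence_def)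
    then show ?case using Suc by simp
  qed
  then show "x n = y n" ..
qed

lemma P_of_real: "P (of_real x) n = of_real (P x n)"
  and Q_of_real: "Q (of_real x) n = of_real (Q x n)"
proof -
  have "solution (of_real x) (of_real t) (of_real c) n = of_real (solution x t c n)" for t c
    by (induction x t c n rule: solution.induct) auto
  from this[of 0 1] this[of 1 0]
  show "P (of_real x) n = of_real (P x n)" "Q (of_real x) n = of_real (Q x n)"
    by (simp_all add: P_def Q_def)
qed

lemma isCont_P: "isCont (\<lambda>x::real. P x n) x"
proof -
  have "isCont (\<lambda>x::real. solution x t c n) x" for t c
    by (induction x t c n rule: solution.induct) (auto intro!: continuous_intros)
  then show ?thesis unfolding P_def .
qed

lemma P_cnj: "P (cnj z) n = cnj (P z n)"
proof -
  have "solution (cnj z) (cnj t) (cnj c) n = cnj (solution z t c n)" for t c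
    by (induction z t c n rule: solution.induct) auto
  from this[of 0 1] show ?thesis by (simp add: P_def)
qed

definition jacobi_entry :: "nat \<Rightarrow> nat \<Rightarrow> real" where
  "jacobi_entry m k = (if k = Suc m then b m else if k = m then a m else if m = Suc k then b k else 0)"

lemma jacobi_entry_row:
  assumes "recurrence z \<tau> y"
  shows "(\<Sum>k\<le>Suc m. of_real (jacobi_entry m k) * y k) = z * y m + (if m = 0 then \<tau> else 0)"
proof (cases m)
  case 0
  then show ?thesis using assms by (simp add: jacobi_entry_def recurrence_def algebra_simps)
next
  case (Suc l)
  have "(\<Sum>k<l. of_real (jacobi_entry m k) * y k) = 0"
    by (rule sum.neutral) (auto simp: jacobi_entry_def Suc)
  then have "(\<Sum>k\<le>Suc m. of_real (jacobi_entry m k) * y k) =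
      of_real (b l) * y l + of_real (a m) * y m + of_real (b m) * y (Suc m)"
    by (simp add: Suc jacobi_entry_def flip: lessThan_Suc_atMost)
  then show ?thesis using assms by (simp add: Suc recurrence_def algebra_simps)
qed

subsection \<open>The Casoratian\<close>

definition casoratian :: "(nat \<Rightarrow> 'a::real_normed_field) \<Rightarrow> (nat \<Rightarrow> 'a) \<Rightarrow> nat \<Rightarrow> 'a" where
  "casoratian x y n = of_real (b n) * (x (Suc n) * y n - x n * y (Suc n))"

text \<open>
  The Christoffel--Darboux formula for arbitrary solutions. With \<open>P\<close> and \<open>Q\<close> inserted, its right-hand
  sides are the partial sums of the Nevanlinna functions.
\<close>

lemma casoratian_eq:
  assumes x: "recurrence z \<tau> x" and y: "recurrence w \<sigma> y"
  shows "casoratian x y n = \<tau> * y 0 - \<sigma> * x 0 + (z - w) * (\<Sum>k\<le>n. x k * y k)"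
proof (induction n)
  case 0
  have "casoratian x y 0 = (of_real (b 0) * x 1) * y 0 - x 0 * (of_real (b 0) * y 1)"
    by (simp add: casoratian_def algebra_simps)
  also have "\<dots> = \<tau> * y 0 - \<sigma> * x 0 + (z - w) * (x 0 * y 0)"
  proof -
    have "of_real (b 0) * x 1 = (z - of_real (a 0)) * x 0 + \<tau>"
      "of_real (b 0) * y 1 = (w - of_real (a 0)) * y 0 + \<sigma>"
      using x y by (simp_all add: recurrence_def)
    then show ?thesis by (simp only:) (simp add: algebra_simps)
  qed
  finally show ?case by simp
next
  case (Suc n)
  have "casoratian x y (Suc n) =
      (of_real (b (Suc n)) * x (Suc (Suc n))) * y (Suc n) - x (Suc n) * (of_real (b (Suc n)) * y (Suc (Suc n)))"
    by (simp add: casoratian_def algebra_simps)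
  also have "\<dots> = casoratian x y n + (z - w) * (x (Suc n) * y (Suc n))"
  proof -
    have "of_real (b (Suc n)) * x (Suc (Suc n)) =
        (z - of_real (a (Suc n))) * x (Suc n) - of_real (b n) * x n"
      "of_real (b (Suc n)) * y (Suc (Suc n)) =
        (w - of_real (a (Suc n))) * y (Suc n) - of_real (b n) * y n"
      using x y by (simp_all add: recurrence_def)
    then show ?thesis by (simp only:) (simp add: casoratian_def algebra_simps)
  qed
  finally show ?case using Suc by (simp add: algebra_simps)
qed

lemma casoratian_PP: "casoratian (P u) (P v) n = (u - v) * (\<Sum>k\<le>n. P u k * P v k)"
  and casoratian_PQ: "casoratian (P u) (Q v) n = - 1 + (u - v) * (\<Sum>k\<le>n. P u k * Q v k)"
  and casoratian_QP: "casoratian (Q u) (P v) n = 1 + (u - v) * (\<Sum>k\<le>n. Q u k * P v k)"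
  by (simp_all add: casoratian_eq[OF recurrence_P recurrence_P]
      casoratian_eq[OF recurrence_P recurrence_Q] casoratian_eq[OF recurrence_Q recurrence_P])

lemma casoratian_swap: "casoratian y x n = - casoratian x y n"
  by (simp add: casoratian_def algebra_simps)

text \<open>
  The Casoratians are \<open>2 \<times> 2\<close> minors, so they satisfy the three-term Pluecker relation; the minor of
  \<open>P v\<close> and \<open>Q v\<close> is \<open>- 1\<close> by the previous formula.
\<close>

lemma casoratian_pluecker:
  "casoratian (P u) (P w) n = casoratian (P u) (P v) n * casoratian (Q v) (P w) n
     - casoratian (P u) (Q v) n * casoratian (P v) (P w) n"
proof -
  have "casoratian (P u) (P w) n * casoratian (P v) (Q v) n
      - casoratian (P u) (P v) n * casoratian (P w) (Q v) n
      + casoratian (P u) (Q v) n * casoratian (P w) (P v) n = 0"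
    by (simp add: casoratian_def algebra_simps)
  moreover have "casoratian (P v) (Q v) n = -1" by (simp add: casoratian_PQ)
  ultimately show ?thesis
    by (simp add: casoratian_swap[of "P w"] algebra_simps)
qed

text \<open>
  The kernel \<open>casoratian (P x) (P v) n\<close> has full degree \<open>n + 1\<close> in \<open>x\<close> only if \<open>P v n \<noteq> 0\<close>. This is true for
  infinitely many \<open>n\<close>, which suffices for a passage to the limit.
\<close>

lemma P_not_both_zero: "P v n \<noteq> 0 \<or> P v (Suc n) \<noteq> 0"
  using casoratian_PQ[of v v n] by (auto simp: casoratian_def)

subsection \<open>Zeros of the finite Christoffel--Darboux kernels\<close>

fun polyP :: "nat \<Rightarrow> complex poly" where
  "polyP 0 = 1"
| "polyP (Suc 0) = smult (1 / of_real (b 0)) [:- of_real (a 0), 1:]"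
| "polyP (Suc (Suc n)) = smult (1 / of_real (b (Suc n)))
     ([:- of_real (a (Suc n)), 1:] * polyP (Suc n) - smult (of_real (b n)) (polyP n))"

lemma poly_polyP: "poly (polyP n) z = P z n"
  unfolding P_def by (induction n rule: polyP.induct) (auto simp: algebra_simps diff_divide_distrib add_divide_distrib)

lemma degree_polyP: "degree (polyP n) \<le> n"
  and lead_coeff_polyP: "coeff (polyP n) n \<noteq> 0"
proof (induction n rule: polyP.induct)
  case (3 n)
  { case 1
    have "degree ([:- of_real (a (Suc n)), 1:] * polyP (Suc n)) \<le> Suc (Suc n)"
      by (rule order_trans[OF degree_mult_le]) (use 3 in simp)
    then show ?case using 3(3) by (auto intro!: order_trans[OF degree_smult_le] degree_diff_le) }
  { case 2
    have "coeff (polyP (Suc n)) (Suc (Suc n)) = 0" "coeff (polyP n) (Suc (Suc n)) = 0"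
      using 3(1,3) by (auto intro!: coeff_eq_0)
    then show ?case using 3(2) by simp }
qed auto

definition kernel_poly :: "complex \<Rightarrow> nat \<Rightarrow> complex poly" where
  "kernel_poly v n = (\<Sum>k\<le>n. smult (P v k) (polyP k))"

lemma poly_kernel_poly: "poly (kernel_poly v n) u = (\<Sum>k\<le>n. P u k * P v k)"
  by (simp add: kernel_poly_def poly_sum poly_polyP mult.commute)

lemma degree_kernel_poly:
  assumes "P v n \<noteq> 0" shows "degree (kernel_poly v n) = n"
proof (rule antisym)
  show "degree (kernel_poly v n) \<le> n" unfolding kernel_poly_def
    by (intro degree_sum_le) (auto intro!: order_trans[OF degree_smult_le] order_trans[OF degree_polyP])
  have "coeff (kernel_poly v n) n = (\<Sum>k\<le>n. P v k * coeff (polyP k) n)"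
    by (simp add: kernel_poly_def coeff_sum)
  also have "\<dots> = (\<Sum>k\<in>{n}. P v k * coeff (polyP k) n)"
  proof (rule sum.mono_neutral_right)
    show "\<forall>k\<in>{..n} - {n}. P v k * coeff (polyP k) n = 0"
      by (auto intro!: coeff_eq_0 le_less_trans[OF degree_polyP])
  qed auto
  finally have "coeff (kernel_poly v n) n \<noteq> 0" using assms lead_coeff_polyP by simp
  then show "n \<le> degree (kernel_poly v n)" by (rule le_degree)
qed

definition nodes :: "real \<Rightarrow> nat \<Rightarrow> real set" where
  "nodes v n = {x. casoratian (P x) (P v) n = 0}"

lemma casoratian_of_real:
  "casoratian (P (of_real x)) (P (of_real y)) n = of_real (casoratian (P x) (P y) n)"
  by (simp add: casoratian_def P_of_real)

text \<open>
  If \<open>u\<close> is a zero then so is \<open>cnj u\<close>, and the Pluecker relation gives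
  \<open>(u - cnj u) * (\<Sum>k\<le>n. (norm (P u k))\<^sup>2) = 0\<close>.
\<close>

lemma zero_is_real_finite:
  fixes u :: complex
  assumes "casoratian (P u) (P (of_real v)) n = 0"
  shows "u \<in> \<real>"
proof -
  have "casoratian (P (of_real v)) (P (cnj u)) n = - cnj (casoratian (P u) (P (of_real v)) n)"
    by (simp add: casoratian_swap[of "P (of_real v)"])
       (simp add: casoratian_def P_cnj P_of_real)
  then have "casoratian (P u) (P (cnj u)) n = 0"
    by (subst casoratian_pluecker[where v="of_real v"]) (simp add: assms)
  moreover have "(\<Sum>k\<le>n. P u k * P (cnj u) k) = of_real (\<Sum>k\<le>n. (norm (P u k))\<^sup>2)"
    by (simp add: P_cnj complex_norm_square[symmetric])
  moreover have "(\<Sum>k\<le>n. (norm (P u k))\<^sup>2) \<ge> (\<Sum>k\<in>{0}. (norm (P u k))\<^sup>2)"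
    by (rule sum_mono2) auto
  ultimately have "u = cnj u"
    by (auto simp: casoratian_PP simp del: of_real_sum of_real_power)
  then show ?thesis by (simp add: Reals_cnj_iff)
qed

lemma nodes_orthogonal:
  assumes "x \<in> nodes v n" "y \<in> nodes v n" "x \<noteq> y"
  shows "(\<Sum>k\<le>n. P x k * P y k) = 0"
proof -
  have "casoratian (P v) (P y) n = 0"
    using assms by (simp add: casoratian_swap[of "P v"] nodes_def)
  then have "casoratian (P x) (P y) n = 0"
    using assms by (subst casoratian_pluecker[where v=v]) (simp add: nodes_def)
  then show ?thesis using assms(3) by (simp add: casoratian_PP)
qed

lemma sum_P_sq_ge_1: "(\<Sum>k\<le>n. (P (x::real) k)\<^sup>2) \<ge> 1"
proof -
  have "(\<Sum>k\<le>n. (P x k)\<^sup>2) \<ge> (\<Sum>k\<in>{0}. (P x k)\<^sup>2)" by (rule sum_mono2) auto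
  then show ?thesis by simp
qed

lemma nodes_card:
  assumes "P v n \<noteq> 0"
  shows "finite (nodes v n)" "card (nodes v n) = Suc n"
proof -
  define w where "w = complex_of_real v"
  define D where "D = [:-w, 1:] * kernel_poly w n"
  have Pw: "P w n \<noteq> 0" using assms by (simp add: w_def P_of_real)
  have D_eq: "poly D u = casoratian (P u) (P w) n" for u
    by (simp add: D_def poly_kernel_poly casoratian_PP algebra_simps)
  have ker_nz: "kernel_poly w n \<noteq> 0"
  proof
    assume "kernel_poly w n = 0"
    then have "(\<Sum>k\<le>n. P w k * P w k) = 0" using poly_kernel_poly[of w n w] by simp
    then have "(\<Sum>k\<le>n. (P v k)\<^sup>2) = 0"
      unfolding w_def P_of_real by (simp add: power2_eq_square flip: of_real_mult of_real_sum)
    then show False using sum_P_sq_ge_1[of v n] by simp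
  qed
  have degD: "degree D = Suc n"
    unfolding D_def using ker_nz by (subst degree_mult_eq) (auto simp: degree_kernel_poly[OF Pw])
  have Dnz: "D \<noteq> 0" using degD by auto
  have real: "u \<in> \<real>" if "poly D u = 0" for u
    using that zero_is_real_finite[of u v n] by (simp add: D_eq w_def)
  \<comment> \<open>A double zero would annihilate the diagonal kernel value, which is a sum of squares.\<close>
  have simple: "poly (pderiv D) u \<noteq> 0" if u: "poly D u = 0" for u
  proof
    assume d: "poly (pderiv D) u = 0"
    from real[OF u] obtain x where x: "u = of_real x" by (auto elim: Reals_cases)
    define c where "c = casoratian (Q w) (P u) n"
    have "casoratian (P w) (P u) n = 0"
      using u by (simp add: D_eq casoratian_swap[of "P w"])
    then have "casoratian (P z) (P u) n = c * poly D z" for z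
      by (subst casoratian_pluecker[where v=w]) (simp add: c_def D_eq)
    then have "poly ([:-u, 1:] * kernel_poly u n) z = poly (smult c D) z" for z
      by (simp add: poly_kernel_poly casoratian_PP left_diff_distrib)
    then have "[:-u, 1:] * kernel_poly u n = smult c D" by (intro poly_ext)
    then have "poly (pderiv ([:-u, 1:] * kernel_poly u n)) u = 0"
      by (simp add: pderiv_smult d)
    then have "(\<Sum>k\<le>n. P u k * P u k) = 0"
      by (simp only: pderiv_mult) (simp add: pderiv_pCons poly_kernel_poly)
    then have "(\<Sum>k\<le>n. (P x k)\<^sup>2) = 0"
      unfolding x P_of_real by (simp add: power2_eq_square flip: of_real_mult of_real_sum)
    then show False using sum_P_sq_ge_1[of x n] by simp
  qed
  have "rsquarefree D" using simple by (auto simp: rsquarefree_roots)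
  then have "D = smult (lead_coeff D) (\<Prod>z | poly D z = 0. [:- z, 1:])"
    by (simp add: complex_poly_decompose_rsquarefree)
  then have "degree D = degree (\<Prod>z | poly D z = 0. [:- z, 1:])"
    using Dnz by (metis degree_smult_eq leading_coeff_0_iff)
  also have "\<dots> = card {z. poly D z = 0}"
    by (subst degree_prod_sum_eq) auto
  finally have card: "card {z. poly D z = 0} = Suc n" using degD by simp
  have eq: "{z. poly D z = 0} = of_real ` nodes v n"
  proof (intro set_eqI iffI)
    fix z assume z: "z \<in> {z. poly D z = 0}"
    then obtain x where x: "z = of_real x" using real by (auto elim: Reals_cases)
    then show "z \<in> of_real ` nodes v n"
      using z by (auto simp: D_eq nodes_def w_def casoratian_of_real)
  next
    fix z :: complex assume "z \<in> of_real ` nodes v n"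
    then show "z \<in> {z. poly D z = 0}" by (auto simp: D_eq nodes_def w_def casoratian_of_real)
  qed
  have "finite (complex_of_real ` nodes v n)" unfolding eq[symmetric] by (rule poly_roots_finite[OF Dnz])
  then show "finite (nodes v n)" by (rule finite_imageD) (simp add: inj_on_def)
  show "card (nodes v n) = Suc n"
    using card unfolding eq by (subst (asm) card_image) (auto simp: inj_on_def)
qed

end

subsection \<open>Gauss quadrature at the nodes\<close>

text \<open>
  Summed over \<open>k\<close>, the Bessel defects of the \<open>n + 1\<close> unit vectors give \<open>(n + 1) - card X = 0\<close>. As each
  defect is a sum of squares, all of them vanish.
\<close>

lemma orthonormal_rows_imp_columns:
  fixes V :: "'i \<Rightarrow> nat \<Rightarrow> real"
  assumes X: "finite X" "card X = Suc n"
    and orth: "\<And>x y. x \<in> X \<Longrightarrow> y \<in> X \<Longrightarrow> (\<Sum>k\<le>n. V x k * V y k) = (if x = y then 1 else 0)"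
    and kl: "k \<le> n" "l \<le> n"
  shows "(\<Sum>x\<in>X. V x k * V x l) = (if k = l then 1 else 0)"
proof -
  define E where "E k l = (if k = l then 1 else 0) - (\<Sum>x\<in>X. V x k * V x l)" for k l
  have defect: "(\<Sum>l\<le>n. (E k l)\<^sup>2) = 1 - (\<Sum>x\<in>X. (V x k)\<^sup>2)" if "k \<le> n" for k
  proof -
    have "(\<Sum>l\<le>n. (E k l)\<^sup>2) = (\<Sum>l\<le>n. (if l = k then 1 - 2 * (\<Sum>x\<in>X. V x k * V x l) else 0)
        + (\<Sum>x\<in>X. \<Sum>y\<in>X. V x k * V y k * (V x l * V y l)))"
      by (intro sum.cong) (auto simp: E_def power2_eq_square algebra_simps sum_product)
    also have "\<dots> = 1 - 2 * (\<Sum>x\<in>X. (V x k)\<^sup>2) + (\<Sum>l\<le>n. \<Sum>x\<in>X. \<Sum>y\<in>X. V x k * V y k * (V x l * V y l))"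
      using that by (simp add: sum.distrib sum.delta power2_eq_square)
    also have "(\<Sum>l\<le>n. \<Sum>x\<in>X. \<Sum>y\<in>X. V x k * V y k * (V x l * V y l)) =
        (\<Sum>x\<in>X. \<Sum>l\<le>n. \<Sum>y\<in>X. V x k * V y k * (V x l * V y l))"
      by (rule sum.swap)
    also have "\<dots> = (\<Sum>x\<in>X. \<Sum>y\<in>X. V x k * V y k * (\<Sum>l\<le>n. V x l * V y l))"
      unfolding sum_distrib_left by (intro sum.cong refl sum.swap)
    also have "\<dots> = (\<Sum>x\<in>X. \<Sum>y\<in>X. if x = y then V x k * V y k else 0)"
      by (intro sum.cong refl) (simp add: orth)
    also have "\<dots> = (\<Sum>x\<in>X. (V x k)\<^sup>2)" using X by (simp add: sum.delta power2_eq_square)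
    finally show ?thesis by simp
  qed
  have "(\<Sum>k\<le>n. \<Sum>l\<le>n. (E k l)\<^sup>2) = (\<Sum>k\<le>n. 1 - (\<Sum>x\<in>X. (V x k)\<^sup>2))"
    by (intro sum.cong refl defect) auto
  also have "\<dots> = of_nat (Suc n) - (\<Sum>k\<le>n. \<Sum>x\<in>X. (V x k)\<^sup>2)" by (simp add: sum_subtractf)
  also have "(\<Sum>k\<le>n. \<Sum>x\<in>X. (V x k)\<^sup>2) = (\<Sum>x\<in>X. \<Sum>k\<le>n. V x k * V x k)"
    unfolding power2_eq_square by (rule sum.swap)
  also have "\<dots> = of_nat (Suc n)" using X by (simp add: orth)
  finally have "(\<Sum>k\<le>n. \<Sum>l\<le>n. (E k l)\<^sup>2) = 0" by simp
  then have "(\<Sum>l\<le>n. (E k l)\<^sup>2) = 0"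
    using kl by (subst (asm) sum_nonneg_eq_0_iff) (auto intro!: sum_nonneg)
  then have "(E k l)\<^sup>2 = 0"
    using kl by (subst (asm) sum_nonneg_eq_0_iff) auto
  then show ?thesis by (simp add: E_def)
qed

context jacobi_matrix
begin

text \<open>
  Gauss quadrature with weights \<open>1 / (\<Sum>j\<le>n. (P x j)\<^sup>2)\<close>, in the form of a finite Parseval identity: the
  vectors \<open>(P x 0, \<dots>, P x n)\<close>, where \<open>x\<close> runs through the nodes, are \<open>n + 1\<close> orthogonal vectors in a space of
  dimension \<open>n + 1\<close>.
\<close>

lemma quadrature:
  assumes "P v n \<noteq> 0" "k \<le> n" "l \<le> n"
  shows "(\<Sum>x\<in>nodes v n. P x k * P x l / (\<Sum>j\<le>n. (P x j)\<^sup>2)) = (if k = l then 1 else 0)"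
proof -
  define N where "N x = (\<Sum>j\<le>n. (P x j)\<^sup>2)" for x :: real
  have N: "N x > 0" for x using sum_P_sq_ge_1[of x n] by (simp add: N_def)
  have N': "sqrt (N x) * sqrt (N x) = N x" for x using N[of x] by simp
  have "(\<Sum>x\<in>nodes v n. P x k / sqrt (N x) * (P x l / sqrt (N x))) = (if k = l then 1 else 0)"
  proof (rule orthonormal_rows_imp_columns[OF nodes_card[OF assms(1)] _ assms(2,3)])
    fix x y assume xy: "x \<in> nodes v n" "y \<in> nodes v n"
    have "(\<Sum>k\<le>n. P x k / sqrt (N x) * (P y k / sqrt (N y))) =
        (\<Sum>k\<le>n. P x k * P y k) / (sqrt (N x) * sqrt (N y))"
      by (simp add: sum_divide_distrib)
    also have "\<dots> = (if x = y then 1 else 0)"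
    proof (cases "x = y")
      case True
      then show ?thesis using N[of y] unfolding N' by (simp add: N_def power2_eq_square)
    qed (simp add: nodes_orthogonal[OF xy])
    finally show "(\<Sum>k\<le>n. P x k / sqrt (N x) * (P y k / sqrt (N y))) = (if x = y then 1 else 0)" .
  qed
  then show ?thesis by (simp add: abs_of_pos[OF N] N_def[symmetric])
qed

definition row_norm_sq :: "nat \<Rightarrow> real" where
  "row_norm_sq m = (\<Sum>k\<le>Suc m. (jacobi_entry m k)\<^sup>2)"

text \<open>
  That the value does not depend on \<open>n\<close> is the tightness that prevents mass from escaping to infinity
  when \<open>n\<close> grows.
\<close>

lemma quadrature_second_moment:
  assumes "P v n \<noteq> 0" "Suc m \<le> n"
  shows "(\<Sum>x\<in>nodes v n. x\<^sup>2 * (P x m)\<^sup>2 / (\<Sum>j\<le>n. (P x j)\<^sup>2)) = row_norm_sq m"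
proof -
  define N where "N x = (\<Sum>j\<le>n. (P x j)\<^sup>2)" for x :: real
  have row: "x * P x m = (\<Sum>k\<le>Suc m. jacobi_entry m k * P x k)" for x :: real
    using jacobi_entry_row[OF recurrence_P, of m x] by (simp split: if_splits)
  have "(\<Sum>x\<in>nodes v n. x\<^sup>2 * (P x m)\<^sup>2 / N x) =
      (\<Sum>x\<in>nodes v n. \<Sum>k\<le>Suc m. \<Sum>l\<le>Suc m. jacobi_entry m k * jacobi_entry m l * (P x k * P x l / N x))"
  proof (rule sum.cong[OF refl])
    fix x
    have "x\<^sup>2 * (P x m)\<^sup>2 / N x = (\<Sum>k\<le>Suc m. jacobi_entry m k * P x k) * (\<Sum>l\<le>Suc m. jacobi_entry m l * P x l) / N x"
      unfolding row[symmetric] by (simp add: power2_eq_square)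
    then show "x\<^sup>2 * (P x m)\<^sup>2 / N x =
        (\<Sum>k\<le>Suc m. \<Sum>l\<le>Suc m. jacobi_entry m k * jacobi_entry m l * (P x k * P x l / N x))"
      unfolding sum_product sum_divide_distrib by (simp only: times_divide_eq_right mult.assoc mult.left_commute mult.commute)
  qed
  also have "\<dots> = (\<Sum>k\<le>Suc m. \<Sum>l\<le>Suc m. \<Sum>x\<in>nodes v n. jacobi_entry m k * jacobi_entry m l * (P x k * P x l / N x))"
    by (subst sum.swap, intro sum.cong refl, rule sum.swap)
  also have "\<dots> = (\<Sum>k\<le>Suc m. \<Sum>l\<le>Suc m. jacobi_entry m k * jacobi_entry m l * (if k = l then 1 else 0))"
    using assms unfolding N_def by (intro sum.cong refl, subst sum_distrib_left[symmetric], subst quadrature) auto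
  also have "\<dots> = (\<Sum>k\<le>Suc m. \<Sum>l\<le>Suc m. if k = l then jacobi_entry m k * jacobi_entry m l else 0)"
    by (intro sum.cong refl) simp
  also have "\<dots> = row_norm_sq m"
    unfolding row_norm_sq_def by (intro sum.cong refl) (simp add: power2_eq_square del: sum.atMost_Suc)
  finally show ?thesis by (simp add: N_def)
qed

end

section \<open>The limit circle case\<close>

text \<open>
  The single point \<open>z0\<close> is enough: variation of constants propagates square summability to every
  solution at every point.
\<close>

locale limit_circle = jacobi_matrix +
  fixes z0 :: complex
  assumes P_z0: "P z0 \<in> ell2" and Q_z0: "Q z0 \<in> ell2"
begin

definition majorant :: "nat \<Rightarrow> real" where
  "majorant n = norm (P z0 n) + norm (Q z0 n)"

lemma majorant_nonneg: "0 \<le> majorant n" by (simp add: majorant_def)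

lemma summable_majorant_sq: "summable (\<lambda>n. (majorant n)\<^sup>2)"
proof (rule summable_comparison_test')
  show "summable (\<lambda>n. 2 * (norm (P z0 n))\<^sup>2 + 2 * (norm (Q z0 n))\<^sup>2)"
    using P_z0 Q_z0 by (intro summable_add summable_mult) (auto simp: ell2_def)
  show "norm ((majorant n)\<^sup>2) \<le> 2 * (norm (P z0 n))\<^sup>2 + 2 * (norm (Q z0 n))\<^sup>2" for n
    using sum_squares_bound[of "norm (P z0 n)" "norm (Q z0 n)"]
    by (simp add: majorant_def power2_sum)
qed

text \<open>
  Variation of constants. The solution \<open>y\<close> at \<open>z\<close> is \<open>\<alpha> * P z0 + \<beta> * Q z0\<close> with coefficients that are
  Casoratians of \<open>y\<close>, hence a constant plus \<open>z - z0\<close> times a sum over the earlier values of \<open>y\<close>. A discrete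
  Gronwall argument turns this into a bound that is locally uniform in \<open>z\<close>.
\<close>

lemma solution_bound:
  assumes y: "recurrence z \<tau> y"
  shows "norm (y n) \<le> majorant n *
    ((norm (y 0) + norm \<tau>) * exp (norm (z - z0) * (\<Sum>k. (majorant k)\<^sup>2)))"
proof -
  define S where "S n = norm (y 0) + norm \<tau> + norm (z - z0) * (\<Sum>k<n. norm (y k) * majorant k)" for n
  have y_le: "norm (y n) \<le> majorant n * S n" for n
  proof (cases n)
    case 0
    then show ?thesis by (simp add: majorant_def S_def)
  next
    case (Suc l)
    define \<alpha> where "\<alpha> = y 0 - (z - z0) * (\<Sum>k\<le>l. y k * Q z0 k)"
    define \<beta> where "\<beta> = \<tau> + (z - z0) * (\<Sum>k\<le>l. y k * P z0 k)"
    have al: "\<alpha> = - casoratian y (Q z0) l" and be: "\<beta> = casoratian y (P z0) l"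
      by (simp_all add: \<alpha>_def \<beta>_def casoratian_eq[OF y recurrence_Q] casoratian_eq[OF y recurrence_P])
    have "casoratian (P z0) (Q z0) l = -1" by (simp add: casoratian_PQ)
    moreover have "casoratian (P z0) (Q z0) l * y (Suc l) =
        casoratian y (Q z0) l * P z0 (Suc l) - casoratian y (P z0) l * Q z0 (Suc l)"
      by (simp add: casoratian_def algebra_simps)
    ultimately have eq: "y (Suc l) = \<alpha> * P z0 (Suc l) + \<beta> * Q z0 (Suc l)"
      by (simp add: al be algebra_simps)
    have "norm (\<Sum>k\<le>l. y k * Q z0 k) \<le> (\<Sum>k\<le>l. norm (y k) * majorant k)"
      by (intro sum_norm_le) (auto simp: norm_mult majorant_def intro!: mult_left_mono)
    then have "norm (z - z0) * norm (\<Sum>k\<le>l. y k * Q z0 k) \<le>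
        norm (z - z0) * (\<Sum>k\<le>l. norm (y k) * majorant k)" by (rule mult_left_mono) simp
    moreover have "norm \<alpha> \<le> norm (y 0) + norm (z - z0) * norm (\<Sum>k\<le>l. y k * Q z0 k)"
      unfolding \<alpha>_def norm_mult[symmetric] by (rule norm_triangle_ineq4)
    ultimately have "norm \<alpha> \<le> S n"
      using norm_ge_zero[of \<tau>] unfolding S_def Suc lessThan_Suc_atMost by linarith
    have "norm (\<Sum>k\<le>l. y k * P z0 k) \<le> (\<Sum>k\<le>l. norm (y k) * majorant k)"
      by (intro sum_norm_le) (auto simp: norm_mult majorant_def intro!: mult_left_mono)
    then have "norm (z - z0) * norm (\<Sum>k\<le>l. y k * P z0 k) \<le>
        norm (z - z0) * (\<Sum>k\<le>l. norm (y k) * majorant k)" by (rule mult_left_mono) simp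
    moreover have "norm \<beta> \<le> norm \<tau> + norm (z - z0) * norm (\<Sum>k\<le>l. y k * P z0 k)"
      unfolding \<beta>_def norm_mult[symmetric] by (rule norm_triangle_ineq)
    ultimately have "norm \<beta> \<le> S n"
      using norm_ge_zero[of "y 0"] unfolding S_def Suc lessThan_Suc_atMost by linarith
    have "norm (y n) \<le> norm \<alpha> * norm (P z0 n) + norm \<beta> * norm (Q z0 n)"
      unfolding Suc eq norm_mult[symmetric] by (rule norm_triangle_ineq)
    also have "\<dots> \<le> S n * norm (P z0 n) + S n * norm (Q z0 n)"
      using \<open>norm \<alpha> \<le> S n\<close> \<open>norm \<beta> \<le> S n\<close> by (intro add_mono mult_right_mono) auto
    finally show ?thesis by (simp add: majorant_def algebra_simps)
  qed
  have S0: "0 \<le> S n" for n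
    by (auto simp: S_def majorant_nonneg intro!: add_nonneg_nonneg mult_nonneg_nonneg sum_nonneg)
  have "S n \<le> (norm (y 0) + norm \<tau>) * exp (norm (z - z0) * (\<Sum>k<n. (majorant k)\<^sup>2))" for n
  proof (induction n)
    case (Suc n)
    have "norm (z - z0) * (norm (y n) * majorant n) \<le> norm (z - z0) * (majorant n * S n * majorant n)"
      by (intro mult_left_mono mult_right_mono y_le majorant_nonneg) auto
    then have "S (Suc n) \<le> S n * (1 + norm (z - z0) * (majorant n)\<^sup>2)"
      by (simp add: S_def algebra_simps power2_eq_square)
    also have "\<dots> \<le> S n * exp (norm (z - z0) * (majorant n)\<^sup>2)"
      by (intro mult_left_mono S0 exp_ge_add_one_self)
    also have "\<dots> \<le> (norm (y 0) + norm \<tau>) * exp (norm (z - z0) * (\<Sum>k<n. (majorant k)\<^sup>2)) *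
        exp (norm (z - z0) * (majorant n)\<^sup>2)"
      by (intro mult_right_mono Suc) auto
    finally show ?case by (simp add: exp_add algebra_simps)
  qed (simp add: S_def)
  also have "(norm (y 0) + norm \<tau>) * exp (norm (z - z0) * (\<Sum>k<n. (majorant k)\<^sup>2)) \<le>
      (norm (y 0) + norm \<tau>) * exp (norm (z - z0) * (\<Sum>k. (majorant k)\<^sup>2))"
    by (intro mult_left_mono iffD2[OF exp_le_cancel_iff] sum_le_suminf summable_majorant_sq) auto
  finally show ?thesis
    using y_le[of n] majorant_nonneg[of n] by (meson mult_left_mono order_trans)
qed

lemma recurrence_ell2:
  assumes "recurrence z \<tau> y" shows "y \<in> ell2"
proof -
  define K where "K = (norm (y 0) + norm \<tau>) * exp (norm (z - z0) * (\<Sum>k. (majorant k)\<^sup>2))"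
  have "summable (\<lambda>n. (norm (y n))\<^sup>2)"
  proof (rule summable_comparison_test')
    show "summable (\<lambda>n. (majorant n)\<^sup>2 * K\<^sup>2)" by (intro summable_mult2 summable_majorant_sq)
    show "norm ((norm (y n))\<^sup>2) \<le> (majorant n)\<^sup>2 * K\<^sup>2" for n
      using power_mono[OF solution_bound[OF assms, of n] norm_ge_zero, of 2]
      by (simp add: K_def power_mult_distrib)
  qed
  then show ?thesis by (simp add: ell2_def)
qed

lemma P_ell2: "P z \<in> ell2" and Q_ell2: "Q z \<in> ell2"
  by (rule recurrence_ell2[OF recurrence_P] recurrence_ell2[OF recurrence_Q])+

lemma P_real_bound:
  fixes x :: real
  assumes "\<bar>x\<bar> \<le> \<rho>"
  shows "\<bar>P x n\<bar> \<le> majorant n * exp ((\<rho> + norm z0) * (\<Sum>k. (majorant k)\<^sup>2))"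
proof -
  have "norm (complex_of_real x - z0) \<le> \<rho> + norm z0"
    using norm_triangle_ineq4[of "complex_of_real x" z0] assms by simp
  then have "norm (complex_of_real x - z0) * (\<Sum>k. (majorant k)\<^sup>2) \<le> (\<rho> + norm z0) * (\<Sum>k. (majorant k)\<^sup>2)"
    by (intro mult_right_mono suminf_nonneg summable_majorant_sq) auto
  then have "majorant n * exp (norm (complex_of_real x - z0) * (\<Sum>k. (majorant k)\<^sup>2)) \<le>
      majorant n * exp ((\<rho> + norm z0) * (\<Sum>k. (majorant k)\<^sup>2))"
    by (intro mult_left_mono majorant_nonneg) simp
  moreover have "\<bar>P x n\<bar> \<le> majorant n * exp (norm (complex_of_real x - z0) * (\<Sum>k. (majorant k)\<^sup>2))"
    using solution_bound[OF recurrence_P, of "complex_of_real x" n] by (simp add: P_of_real)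
  ultimately show ?thesis by linarith
qed

lemma summable_PP: "summable (\<lambda>k. P (u::complex) k * P v k)"
  and summable_PQ: "summable (\<lambda>k. P (u::complex) k * Q v k)"
  and summable_QP: "summable (\<lambda>k. Q (u::complex) k * P v k)"
  using P_ell2 Q_ell2
  by (auto intro!: summable_norm_cancel[OF ell2_summable_mult] simp: ell2_def)

subsection \<open>The Nevanlinna functions\<close>

definition fB :: "complex \<Rightarrow> complex \<Rightarrow> complex" where
  "fB u v = - 1 + (u - v) * (\<Sum>k. P u k * Q v k)"

definition fC :: "complex \<Rightarrow> complex \<Rightarrow> complex" where
  "fC u v = 1 + (u - v) * (\<Sum>k. Q u k * P v k)"

definition fD :: "complex \<Rightarrow> complex \<Rightarrow> complex" where
  "fD u v = (u - v) * (\<Sum>k. P u k * P v k)"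

lemma casoratian_PP_lim: "casoratian (P u) (P v) \<longlonglongrightarrow> fD u v"
  and casoratian_PQ_lim: "casoratian (P u) (Q v) \<longlonglongrightarrow> fB u v"
  and casoratian_QP_lim: "casoratian (Q u) (P v) \<longlonglongrightarrow> fC u v"
  unfolding casoratian_PP[abs_def] casoratian_PQ[abs_def] casoratian_QP[abs_def] fB_def fC_def fD_def
  by (intro tendsto_intros summable_LIMSEQ' summable_PP summable_PQ summable_QP)+

lemma fD_pluecker: "fD u w = fD u v * fC v w - fB u v * fD v w"
proof (rule LIMSEQ_unique[OF casoratian_PP_lim])
  have "casoratian (P u) (P w) = (\<lambda>n. casoratian (P u) (P v) n * casoratian (Q v) (P w) n
     - casoratian (P u) (Q v) n * casoratian (P v) (P w) n)"
    by (intro ext casoratian_pluecker)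
  then show "casoratian (P u) (P w) \<longlonglongrightarrow> fD u v * fC v w - fB u v * fD v w"
    by (simp only:) (intro tendsto_intros casoratian_PP_lim casoratian_PQ_lim casoratian_QP_lim)
qed

lemma fD_swap: "fD v u = - fD u v"
  by (simp add: fD_def mult.commute[of "P v _"] algebra_simps)

lemma fD_self [simp]: "fD v v = 0" and fB_self [simp]: "fB v v = - 1"
  by (simp_all add: fD_def fB_def)

text \<open>
  The reason for all orthogonality statements: \<open>fD v w\<close> vanishes together with \<open>fD w v\<close>, so both terms of
  the Pluecker relation contain a factor 0.
\<close>

lemma fD_zeros: "fD u v = 0 \<Longrightarrow> fD w v = 0 \<Longrightarrow> fD u w = 0"
  by (simp add: fD_pluecker[of u w v] fD_swap[of v w])

lemma fD_cnj: "fD (cnj u) (cnj v) = cnj (fD u v)"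
proof -
  have "(\<Sum>k. cnj (P u k * P v k)) = cnj (\<Sum>k. P u k * P v k)"
    using summable_sums[OF summable_PP[of u v]] by (intro sums_unique[symmetric]) (simp add: sums_cnj del: complex_cnj_mult)
  then show ?thesis by (simp add: fD_def P_cnj)
qed

lemma P_norm_sq_ge_1: "(\<Sum>k. (norm (P (u::complex) k))\<^sup>2) \<ge> 1"
proof -
  have "(\<Sum>k\<in>{0}. (norm (P u k))\<^sup>2) \<le> (\<Sum>k. (norm (P u k))\<^sup>2)"
    using P_ell2[of u] by (intro sum_le_suminf) (auto simp: ell2_def)
  then show ?thesis by simp
qed

lemma fD_zero_real:
  assumes "fD u v = 0" "v \<in> \<real>" shows "u \<in> \<real>"
proof -
  have "fD (cnj u) v = 0" using fD_cnj[of u v] assms by (simp add: Reals_cnj_iff)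
  then have "fD u (cnj u) = 0" by (rule fD_zeros[OF assms(1)])
  moreover have "(\<Sum>k. P u k * P (cnj u) k) = of_real (\<Sum>k. (norm (P u k))\<^sup>2)"
    using P_ell2[of u] by (subst suminf_of_real)
      (auto simp: ell2_def P_cnj complex_norm_square[symmetric] simp del: of_real_power)
  ultimately have "u = cnj u" using P_norm_sq_ge_1[of u]
    by (auto simp: fD_def)
  then show ?thesis by (simp add: Reals_cnj_iff)
qed

lemma inner_P:
  assumes "w \<in> \<real>" shows "ell2_inner x (P w) = (\<Sum>k. x k * P w k)"
proof -
  have "cnj (P w k) = P w k" for k using assms P_cnj[of w k] by (simp add: Reals_cnj_iff)
  then show ?thesis by (simp add: ell2_inner_def)
qed

lemma inner_PP:
  assumes "u \<noteq> w" "w \<in> \<real>" shows "ell2_inner (P u) (P w) = fD u w / (u - w)"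
  using assms by (simp add: inner_P fD_def)

lemma P_orthogonal:
  assumes "fD u v = 0" "fD w v = 0" "u \<noteq> w" "v \<in> \<real>"
  shows "ell2_orthogonal (P u) (P w)"
  using fD_zero_real[OF assms(2,4)] fD_zeros[OF assms(1,2)]
  by (simp add: ell2_orthogonal_def P_ell2 inner_PP[OF assms(3)])

text \<open>
  Adding the multiple \<open>fB u v\<close> of \<open>P v\<close> moves \<open>P u\<close> into the domain of the closure of the Jacobi operator,
  an operator that is smaller than its self-adjoint extension with eigenvectors \<open>P u\<close>, \<open>fD u v = 0\<close>.
\<close>

definition family :: "complex \<Rightarrow> complex \<Rightarrow> nat \<Rightarrow> complex" where
  "family v u = (\<lambda>n. P u n + fB u v * P v n)"

lemma family_ell2: "family v u \<in> ell2"
  unfolding family_def by (intro ell2_add ell2_scale P_ell2)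

text \<open>
  Both \<open>u\<close> and \<open>v\<close> are zeros of \<open>fD _ v\<close> different from \<open>u1\<close>.
\<close>

lemma family_orthogonal:
  assumes "fD u1 v = 0" "u1 \<noteq> v" "v \<in> \<real>" "fD u v = 0" "u \<noteq> u1"
  shows "ell2_orthogonal (P u1) (family v u)"
  unfolding family_def using assms
  by (intro ell2_orthogonal_add_scale P_orthogonal[where v=v]) auto

lemma not_dense_if_orthogonal_to_P:
  assumes "\<And>d. d \<in> S \<Longrightarrow> ell2_orthogonal (P u1) d"
  shows "\<not> dense_in ell2 (cspan S)"
proof (rule not_dense_if_orthogonal[where x="P u1" and k=0])
  show "cspan S \<subseteq> ell2" "\<And>d. d \<in> cspan S \<Longrightarrow> ell2_inner (P u1) d = 0"
    using ell2_orthogonal_cspan[OF assms P_ell2] by (auto simp: ell2_orthogonal_def)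
qed (auto simp: P_ell2)

end

section \<open>Completeness of the eigenvectors\<close>

lemma real_cauchy_schwarz:
  fixes f g :: "nat \<Rightarrow> real"
  assumes "summable (\<lambda>n. (f n)\<^sup>2)" "summable (\<lambda>n. (g n)\<^sup>2)"
  shows "\<bar>\<Sum>n. f n * g n\<bar> \<le> sqrt (\<Sum>n. (f n)\<^sup>2) * sqrt (\<Sum>n. (g n)\<^sup>2)"
    and "summable (\<lambda>n. f n * g n)"
proof -
  show s: "summable (\<lambda>n. f n * g n)"
    using assms by (intro summable_norm_cancel[OF ell2_summable_mult]) auto
  have "norm (\<Sum>n. complex_of_real (f n) * complex_of_real (g n)) \<le>
      ell2_norm (\<lambda>n. of_real (f n)) * ell2_norm (\<lambda>n. of_real (g n))"
    using assms by (intro ell2_cauchy_schwarz) (auto simp: ell2_def)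
  also have "(\<Sum>n. complex_of_real (f n) * complex_of_real (g n)) = of_real (\<Sum>n. f n * g n)"
    using s by (subst suminf_of_real) auto
  finally show "\<bar>\<Sum>n. f n * g n\<bar> \<le> sqrt (\<Sum>n. (f n)\<^sup>2) * sqrt (\<Sum>n. (g n)\<^sup>2)"
    by (simp add: ell2_norm_def)
qed

lemma bounded_sequences_subseq:
  fixes g :: "nat \<Rightarrow> nat \<Rightarrow> real"
  assumes "\<And>i j. i < K \<Longrightarrow> \<bar>g j i\<bar> \<le> \<rho>"
  shows "\<exists>r L. strict_mono (r :: nat \<Rightarrow> nat) \<and> (\<forall>i<K. (\<lambda>j. g (r j) i) \<longlonglongrightarrow> L i)"
  using assms
proof (induction K)
  case 0
  then show ?case by (intro exI[of _ id]) (auto simp: strict_mono_def)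
next
  case (Suc K)
  then obtain r L where r: "strict_mono (r :: nat \<Rightarrow> nat)" "\<forall>i<K. (\<lambda>j. g (r j) i) \<longlonglongrightarrow> L i"
    by (metis less_SucI)
  have "bounded (range (\<lambda>j. g (r j) K))"
    using Suc.prems[of K] by (intro boundedI[of _ \<rho>]) auto
  then obtain l s where s: "strict_mono (s :: nat \<Rightarrow> nat)" "((\<lambda>j. g (r j) K) \<circ> s) \<longlonglongrightarrow> l"
    using bounded_imp_convergent_subsequence by blast
  have "\<forall>i<Suc K. (\<lambda>j. g ((r \<circ> s) j) i) \<longlonglongrightarrow> (L(K := l)) i"
    using s(2) r(2) LIMSEQ_subseq_LIMSEQ[OF _ s(1)] by (auto simp: less_Suc_eq o_def)
  then show ?case using strict_mono_o[OF r(1) s(1)] by blast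
qed

context limit_circle
begin

lemma
  fixes x y :: real
  shows summable_P_sq: "summable (\<lambda>k. (P x k)\<^sup>2)" and summable_Q_sq: "summable (\<lambda>k. (Q x k)\<^sup>2)"
    and summable_P_P: "summable (\<lambda>k. P x k * P y k)" and summable_P_Q: "summable (\<lambda>k. P x k * Q y k)"
proof -
  show 1: "summable (\<lambda>k. (P x k)\<^sup>2)" for x :: real
    using P_ell2[of "of_real x"] by (simp add: ell2_def P_of_real)
  show 2: "summable (\<lambda>k. (Q x k)\<^sup>2)" for x :: real
    using Q_ell2[of "of_real x"] by (simp add: ell2_def Q_of_real)
  show "summable (\<lambda>k. P x k * P y k)" "summable (\<lambda>k. P x k * Q y k)"
    by (rule real_cauchy_schwarz(2)[OF 1 1] real_cauchy_schwarz(2)[OF 1 2])+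
qed

definition N :: "real \<Rightarrow> real" where "N x = (\<Sum>k. (P x k)\<^sup>2)"

lemma N_ge_1: "N x \<ge> 1"
proof -
  have "(\<Sum>k\<in>{0}. (P x k)\<^sup>2) \<le> N x"
    unfolding N_def by (intro sum_le_suminf summable_P_sq) auto
  then show ?thesis by simp
qed

lemma N_pos: "N x > 0" and N_nz [simp]: "N x \<noteq> 0" using N_ge_1[of x] by auto

lemma N_bounded: "\<exists>G>0. \<forall>x. \<bar>x\<bar> \<le> \<rho> \<longrightarrow> N x \<le> G"
proof -
  define K where "K = exp ((\<rho> + norm z0) * (\<Sum>k. (majorant k)\<^sup>2))"
  have *: "N x \<le> (\<Sum>k. (majorant k)\<^sup>2 * K\<^sup>2)" if "\<bar>x\<bar> \<le> \<rho>" for x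
    unfolding N_def
  proof (intro suminf_le summable_P_sq summable_mult2 summable_majorant_sq)
    show "(P x k)\<^sup>2 \<le> (majorant k)\<^sup>2 * K\<^sup>2" for k
      using power_mono[OF P_real_bound[OF that, of k], of 2] by (simp add: K_def power_mult_distrib)
  qed
  then have "\<forall>x. \<bar>x\<bar> \<le> \<rho> \<longrightarrow> N x \<le> max 1 (\<Sum>k. (majorant k)\<^sup>2 * K\<^sup>2)"
    by (auto intro: le_max_iff_disj[THEN iffD2])
  then show ?thesis by (intro exI[of _ "max 1 (\<Sum>k. (majorant k)\<^sup>2 * K\<^sup>2)"]) auto
qed

definition zeros :: "real \<Rightarrow> real set" where
  "zeros v = {x. (x - v) * (\<Sum>k. P x k * P v k) = 0}"

lemma fD_of_real: "fD (of_real x) (of_real y) = of_real ((x - y) * (\<Sum>k. P x k * P y k))"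
  by (simp add: fD_def P_of_real suminf_of_real[OF summable_P_P])

lemma fB_of_real: "fB (of_real x) (of_real y) = of_real (- 1 + (x - y) * (\<Sum>k. P x k * Q y k))"
  by (simp add: fB_def P_of_real Q_of_real suminf_of_real[OF summable_P_Q])

lemma zeros_iff: "x \<in> zeros v \<longleftrightarrow> fD (of_real x) (of_real v) = 0"
  by (simp only: fD_of_real zeros_def of_real_eq_0_iff mem_Collect_eq)

lemma v_in_zeros: "v \<in> zeros v" by (simp add: zeros_def)

lemma zeros_orthogonal:
  assumes "x \<in> zeros v" "y \<in> zeros v" "x \<noteq> y"
  shows "(\<Sum>k. P x k * P y k) = 0"
  using fD_zeros[of "of_real x" "of_real v" "of_real y"] assms
  by (simp only: zeros_iff fD_of_real of_real_eq_0_iff) simp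

text \<open>
  The majorant for \<open>P\<close> on bounded sets makes dominated convergence for series (Tannery) applicable while
  the arguments and the upper limit of summation move at the same time.
\<close>

lemma kernel_tendsto:
  fixes xs ys :: "nat \<Rightarrow> real"
  assumes "xs \<longlonglongrightarrow> x" "ys \<longlonglongrightarrow> y" "\<And>j. \<bar>xs j\<bar> \<le> \<rho>" "\<And>j. \<bar>ys j\<bar> \<le> \<rho>"
    and n: "filterlim n at_top sequentially"
  shows "(\<lambda>j. \<Sum>k\<le>n j. P (xs j) k * P (ys j) k) \<longlonglongrightarrow> (\<Sum>k. P x k * P y k)"
proof -
  define K where "K = exp ((\<rho> + norm z0) * (\<Sum>k. (majorant k)\<^sup>2))"
  define A where "A k j = (if k \<le> n j then P (xs j) k * P (ys j) k else 0)" for k j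
  have "((\<lambda>j. suminf (\<lambda>k. A k j)) \<longlonglongrightarrow> (\<Sum>k. P x k * P y k))"
  proof (rule tannerys_theorem[THEN conjunct2, THEN conjunct2])
    fix k
    have "(\<lambda>j. P (xs j) k * P (ys j) k) \<longlonglongrightarrow> P x k * P y k"
      by (intro tendsto_mult isCont_tendsto_compose[OF isCont_P] assms)
    moreover have "\<forall>\<^sub>F j in sequentially. P (xs j) k * P (ys j) k = A k j"
      using n[unfolded filterlim_at_top, rule_format, of k] by eventually_elim (simp add: A_def)
    ultimately show "(\<lambda>j. A k j) \<longlonglongrightarrow> P x k * P y k" by (rule Lim_transform_eventually)
  next
    have "norm (A k j) \<le> (majorant k * K)\<^sup>2" for k j
    proof -
      have "\<bar>P (xs j) k\<bar> * \<bar>P (ys j) k\<bar> \<le> (majorant k * K) * (majorant k * K)"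
        unfolding K_def by (intro mult_mono P_real_bound assms mult_nonneg_nonneg majorant_nonneg) auto
      then show ?thesis by (auto simp: A_def abs_mult power2_eq_square)
    qed
    then show "\<forall>\<^sub>F (k, j) in at_top \<times>\<^sub>F sequentially. norm (A k j) \<le> (majorant k * K)\<^sup>2"
      by (intro always_eventually) auto
    show "summable (\<lambda>k. (majorant k * K)\<^sup>2)"
      unfolding power_mult_distrib by (intro summable_mult2 summable_majorant_sq)
  qed simp
  moreover have "suminf (\<lambda>k. A k j) = (\<Sum>k\<le>n j. P (xs j) k * P (ys j) k)" for j
    by (subst suminf_finite[of "{..n j}"]) (auto simp: A_def)
  ultimately show ?thesis by simp
qed

subsection \<open>Finite orthogonal sums\<close>

lemma combination_norm_sq:
  assumes "finite F" "F \<subseteq> zeros v"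
  shows "(\<lambda>n. (\<Sum>x\<in>F. t x * P x n)\<^sup>2) sums (\<Sum>x\<in>F. (t x)\<^sup>2 * N x)"
proof -
  have "(\<lambda>n. \<Sum>x\<in>F. \<Sum>y\<in>F. t x * t y * (P x n * P y n)) sums
      (\<Sum>x\<in>F. \<Sum>y\<in>F. t x * t y * (\<Sum>n. P x n * P y n))"
    by (intro sums_sum sums_mult summable_sums summable_P_P)
  also have "(\<lambda>n. \<Sum>x\<in>F. \<Sum>y\<in>F. t x * t y * (P x n * P y n)) = (\<lambda>n. (\<Sum>x\<in>F. t x * P x n)\<^sup>2)"
    by (simp add: power2_eq_square sum_product algebra_simps)
  also have "(\<Sum>x\<in>F. \<Sum>y\<in>F. t x * t y * (\<Sum>n. P x n * P y n)) =
      (\<Sum>x\<in>F. \<Sum>y\<in>F. if x = y then t x * t y * N x else 0)"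
    using assms zeros_orthogonal[of _ v] by (intro sum.cong refl) (auto simp: N_def power2_eq_square subset_iff)
  also have "\<dots> = (\<Sum>x\<in>F. (t x)\<^sup>2 * N x)" using assms(1) by (simp add: power2_eq_square)
  finally show ?thesis .
qed

text \<open>
  The \<open>n\<close>-th coordinate of the orthogonal projection of the \<open>m\<close>-th unit vector to the span of the \<open>P x\<close>,
  \<open>x \<in> F\<close>, when \<open>F\<close> consists of zeros of \<open>fD _ v\<close>.
\<close>

definition proj :: "real set \<Rightarrow> nat \<Rightarrow> nat \<Rightarrow> real" where
  "proj F m n = (\<Sum>x\<in>F. P x m / N x * P x n)"

lemma proj_defect:
  assumes F: "finite F" "F \<subseteq> zeros v"
  shows "(\<lambda>n. (proj F m n - basis_vector m n)\<^sup>2) sums (1 - (\<Sum>x\<in>F. (P x m)\<^sup>2 / N x))"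
proof -
  have "(\<lambda>n. (proj F m n)\<^sup>2) sums (\<Sum>x\<in>F. (P x m / N x)\<^sup>2 * N x)"
    unfolding proj_def by (rule combination_norm_sq[OF F])
  also have "(\<Sum>x\<in>F. (P x m / N x)\<^sup>2 * N x) = (\<Sum>x\<in>F. (P x m)\<^sup>2 / N x)"
    by (simp add: power2_eq_square)
  finally have 1: "(\<lambda>n. (proj F m n)\<^sup>2) sums (\<Sum>x\<in>F. (P x m)\<^sup>2 / N x)" .
  have "(\<lambda>n. if n = m then 1 - 2 * proj F m n else 0) sums (1 - 2 * proj F m m)"
    by (rule sums_single)
  from sums_add[OF 1 this]
  have "(\<lambda>n. (proj F m n)\<^sup>2 + (if n = m then 1 - 2 * proj F m n else 0)) sums
      ((\<Sum>x\<in>F. (P x m)\<^sup>2 / N x) + (1 - 2 * proj F m m))" .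
  also have "(\<lambda>n. (proj F m n)\<^sup>2 + (if n = m then 1 - 2 * proj F m n else 0)) =
      (\<lambda>n. (proj F m n - basis_vector m n)\<^sup>2)"
    by (auto simp: basis_vector_def power2_eq_square algebra_simps)
  also have "proj F m m = (\<Sum>x\<in>F. (P x m)\<^sup>2 / N x)"
    by (simp add: proj_def power2_eq_square)
  finally show ?thesis by simp
qed

lemma bessel:
  assumes "finite F" "F \<subseteq> zeros v" shows "(\<Sum>x\<in>F. (P x m)\<^sup>2 / N x) \<le> 1"
proof -
  have "0 \<le> 1 - (\<Sum>x\<in>F. (P x m)\<^sup>2 / N x)"
    using proj_defect[OF assms, of m] by (rule sums_le[OF _ sums_zero, rotated]) simp
  then show ?thesis by simp
qed

definition zeros_upto :: "real \<Rightarrow> real \<Rightarrow> real set" where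
  "zeros_upto v \<rho> = {x \<in> zeros v. \<bar>x\<bar> \<le> \<rho>}"

text \<open>
  Bessel's inequality for the unit vector \<open>0\<close> bounds the sum of the \<open>1 / N x\<close>, and \<open>N\<close> is bounded on
  bounded intervals.
\<close>

lemma finite_zeros_upto: "finite (zeros_upto v \<rho>)"
proof -
  obtain G where G: "G > 0" "\<forall>x. \<bar>x\<bar> \<le> \<rho> \<longrightarrow> N x \<le> G" using N_bounded by blast
  show ?thesis
  proof (rule finite_if_finite_subsets_card_bdd[THEN conjunct1])
    fix F assume F: "F \<subseteq> zeros_upto v \<rho>" "finite F"
    have "of_nat (card F) / G = (\<Sum>x\<in>F. 1 / G)" by simp
    also have "\<dots> \<le> (\<Sum>x\<in>F. (P x 0)\<^sup>2 / N x)"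
      using F G N_pos by (intro sum_mono) (auto simp: zeros_upto_def intro!: divide_left_mono)
    also have "\<dots> \<le> 1" using F by (intro bessel) (auto simp: zeros_upto_def)
    finally have "of_nat (card F) \<le> G" using G by (simp add: divide_le_eq)
    then show "card F \<le> nat \<lfloor>G\<rfloor>" by (simp add: le_nat_floor)
  qed
qed

lemma zeros_upto_subset: "zeros_upto v \<rho> \<subseteq> zeros v" by (auto simp: zeros_upto_def)

subsection \<open>Passage to the limit in the quadrature formula\<close>

lemma quadrature_tail:
  assumes "P v n \<noteq> 0" "Suc m \<le> n" "\<rho> > 0"
  shows "(\<Sum>x\<in>{x \<in> nodes v n. \<bar>x\<bar> \<le> \<rho>}. (P x m)\<^sup>2 / (\<Sum>j\<le>n. (P x j)\<^sup>2)) \<ge> 1 - row_norm_sq m / \<rho>\<^sup>2"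
proof -
  define W where "W x = (P x m)\<^sup>2 / (\<Sum>j\<le>n. (P x j)\<^sup>2)" for x :: real
  have W0: "W x \<ge> 0" for x unfolding W_def by (intro divide_nonneg_nonneg sum_nonneg) auto
  note fin = nodes_card(1)[OF assms(1)]
  have "1 = (\<Sum>x\<in>nodes v n. W x)"
    using quadrature[OF assms(1), of m m] assms(2) by (simp add: W_def power2_eq_square)
  also have "\<dots> = (\<Sum>x\<in>{x \<in> nodes v n. \<bar>x\<bar> \<le> \<rho>}. W x) + (\<Sum>x\<in>{x \<in> nodes v n. \<not> \<bar>x\<bar> \<le> \<rho>}. W x)"
    by (subst sum.union_disjoint[symmetric]) (use fin in \<open>auto intro!: sum.cong\<close>)
  also have "(\<Sum>x\<in>{x \<in> nodes v n. \<not> \<bar>x\<bar> \<le> \<rho>}. W x) \<le> (\<Sum>x\<in>nodes v n. x\<^sup>2 * W x / \<rho>\<^sup>2)"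
  proof (rule order_trans[OF sum_mono sum_mono2])
    fix x assume "x \<in> {x \<in> nodes v n. \<not> \<bar>x\<bar> \<le> \<rho>}"
    then have "\<rho>\<^sup>2 \<le> x\<^sup>2" using assms(3) power_mono[of \<rho> "\<bar>x\<bar>" 2] by simp
    then have "\<rho>\<^sup>2 * W x \<le> x\<^sup>2 * W x" by (rule mult_right_mono[OF _ W0])
    then show "W x \<le> x\<^sup>2 * W x / \<rho>\<^sup>2" using assms(3) by (simp add: le_divide_eq mult.commute)
  qed (use fin W0 in auto)
  also have "(\<Sum>x\<in>nodes v n. x\<^sup>2 * W x / \<rho>\<^sup>2) = row_norm_sq m / \<rho>\<^sup>2"
    using quadrature_second_moment[OF assms(1,2)]
    unfolding sum_divide_distrib[symmetric] by (simp add: W_def)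
  finally show ?thesis by (simp add: W_def)
qed

text \<open>
  The analytic core. For the infinitely many \<open>n\<close> with \<open>P v n \<noteq> 0\<close> the nodes in \<open>[-\<rho>, \<rho>]\<close> carry almost all of the
  mass, uniformly in \<open>n\<close>. Their number is bounded, so along a subsequence it is constant and the nodes
  converge. By uniform convergence of the kernels the limits are distinct zeros of \<open>fD _ v\<close>, and the
  weights converge to \<open>1 / N x\<close>. This gives completeness of the eigenvectors without spectral theory
  and without locating all zeros.
\<close>

lemma parseval_lower_bound:
  assumes "\<rho> > 0"
  shows "(\<Sum>x\<in>zeros_upto v \<rho>. (P x m)\<^sup>2 / N x) \<ge> 1 - row_norm_sq m / \<rho>\<^sup>2"
proof -
  define X where "X n = {x \<in> nodes v n. \<bar>x\<bar> \<le> \<rho>}" for n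
  obtain G where G: "G > 0" "\<forall>x. \<bar>x\<bar> \<le> \<rho> \<longrightarrow> N x \<le> G" using N_bounded by blast
  define J where "J = {n. P v n \<noteq> 0 \<and> Suc m \<le> n}"
  have "infinite J"
    unfolding infinite_nat_iff_unbounded_le
  proof
    fix l
    show "\<exists>n\<ge>l. n \<in> J"
      using P_not_both_zero[of v "max l (Suc m)"] unfolding J_def
      by (metis (mono_tags) le_Suc_eq max.cobounded1 max.cobounded2 mem_Collect_eq)
  qed
  have card_X: "card (X n) \<le> nat \<lfloor>G\<rfloor>" if "n \<in> J" for n
  proof -
    have P: "P v n \<noteq> 0" using that by (simp add: J_def)
    have "of_nat (card (X n)) / G = (\<Sum>x\<in>X n. 1 / G)" by simp
    also have "\<dots> \<le> (\<Sum>x\<in>X n. P x 0 * P x 0 / (\<Sum>j\<le>n. (P x j)\<^sup>2))"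
    proof (rule sum_mono)
      fix x assume "x \<in> X n"
      then have "N x \<le> G" using G by (simp add: X_def)
      moreover have "(\<Sum>j\<le>n. (P x j)\<^sup>2) \<le> N x"
        unfolding N_def by (intro sum_le_suminf summable_P_sq) auto
      ultimately show "1 / G \<le> P x 0 * P x 0 / (\<Sum>j\<le>n. (P x j)\<^sup>2)"
        using sum_P_sq_ge_1[of x n] G by (simp add: frac_le)
    qed
    also have "\<dots> \<le> (\<Sum>x\<in>nodes v n. P x 0 * P x 0 / (\<Sum>j\<le>n. (P x j)\<^sup>2))"
      by (intro sum_mono2 nodes_card(1)[OF P]) (auto simp: X_def sum_nonneg)
    also have "\<dots> = 1" using quadrature[OF P, of 0 0] by simp
    finally have "of_nat (card (X n)) \<le> G" using G by (simp add: divide_le_eq)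
    then show ?thesis by (simp add: le_nat_floor)
  qed
  have "finite ((\<lambda>n. card (X n)) ` J)"
    by (rule finite_subset[of _ "{..nat \<lfloor>G\<rfloor>}"]) (use card_X in auto)
  from pigeonhole_infinite[OF \<open>infinite J\<close> this] obtain n0 where
    "infinite {n \<in> J. card (X n) = card (X n0)}" by blast
  from infinite_enumerate[OF this] obtain h :: "nat \<Rightarrow> nat" where
    h: "strict_mono h" "\<forall>j. h j \<in> J \<and> card (X (h j)) = card (X n0)" by auto
  define K where "K = card (X n0)"
  have fin: "finite (X (h j))" for j
    using h(2) nodes_card(1)[of v "h j"] by (auto simp: X_def J_def)
  have "\<exists>g. bij_betw g {..<K} (X (h j))" for j
    using ex_bij_betw_nat_finite[OF fin[of j]] h(2) by (simp add: K_def lessThan_atLeast0)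
  then obtain g where g: "\<And>j. bij_betw (g j) {..<K} (X (h j))" by metis
  have gX: "g j i \<in> X (h j)" if "i < K" for j i
    using bij_betwE[OF g[of j]] that by auto
  have "\<bar>g j i\<bar> \<le> \<rho>" if "i < K" for i j using gX[OF that] by (simp add: X_def)
  from bounded_sequences_subseq[of K g \<rho>, OF this] obtain r L where
    r: "strict_mono (r :: nat \<Rightarrow> nat)" "\<And>i. i < K \<Longrightarrow> (\<lambda>j. g (r j) i) \<longlonglongrightarrow> L i" by auto
  have lim_n: "filterlim (\<lambda>j. h (r j)) at_top sequentially"
    using filterlim_subseq[OF strict_mono_o[OF h(1) r(1)]] by (simp add: o_def)
  have gb: "\<bar>g (r j) i\<bar> \<le> max \<rho> \<bar>v\<bar>" if "i < K" for i j
    using gX[OF that, of "r j"] by (auto simp: X_def intro: max.coboundedI1)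
  have L_bound: "\<bar>L i\<bar> \<le> \<rho>" if "i < K" for i
    by (rule LIMSEQ_le_const2[OF tendsto_rabs[OF r(2)[OF that]]])
       (use gX[OF that] in \<open>auto simp: X_def\<close>)
  have L_zero: "L i \<in> zeros v" if "i < K" for i
  proof -
    have "(\<lambda>j. \<Sum>k\<le>h (r j). P (g (r j) i) k * P v k) \<longlonglongrightarrow> (\<Sum>k. P (L i) k * P v k)"
      by (rule kernel_tendsto[OF r(2)[OF that] tendsto_const gb[OF that] _ lim_n]) simp
    then have "(\<lambda>j. (g (r j) i - v) * (\<Sum>k\<le>h (r j). P (g (r j) i) k * P v k)) \<longlonglongrightarrow>
        (L i - v) * (\<Sum>k. P (L i) k * P v k)"
      by (intro tendsto_mult tendsto_diff r(2) that) auto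
    moreover have "(g (r j) i - v) * (\<Sum>k\<le>h (r j). P (g (r j) i) k * P v k) = 0" for j
      using gX[OF that, of "r j"] by (simp add: X_def nodes_def casoratian_PP)
    ultimately show ?thesis by (simp add: zeros_def LIMSEQ_const_iff)
  qed
  \<comment> \<open>Two nodes cannot merge in the limit, because their kernel value is 0 and not close to \<open>N\<close>.\<close>
  have L_inj: "inj_on L {..<K}"
  proof (rule inj_onI, rule ccontr)
    fix i i' assume i: "i \<in> {..<K}" "i' \<in> {..<K}" "L i = L i'" "i \<noteq> i'"
    have "(\<lambda>j. \<Sum>k\<le>h (r j). P (g (r j) i) k * P (g (r j) i') k) \<longlonglongrightarrow> (\<Sum>k. P (L i) k * P (L i') k)"
      using i by (intro kernel_tendsto[OF r(2) r(2) gb gb lim_n]) auto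
    moreover have "(\<Sum>k\<le>h (r j). P (g (r j) i) k * P (g (r j) i') k) = 0" for j
    proof (rule nodes_orthogonal)
      show "g (r j) i \<in> nodes v (h (r j))" "g (r j) i' \<in> nodes v (h (r j))"
        using gX[of i "r j"] gX[of i' "r j"] i by (auto simp: X_def)
      show "g (r j) i \<noteq> g (r j) i'"
        using bij_betw_imp_inj_on[OF g[of "r j"]] i by (auto dest: inj_onD)
    qed
    ultimately have "(\<Sum>k. P (L i) k * P (L i') k) = 0" by (simp add: LIMSEQ_const_iff)
    then have "N (L i) = 0" using i(3) by (simp add: N_def power2_eq_square)
    then show False by simp
  qed
  have "(\<lambda>j. \<Sum>i<K. (P (g (r j) i) m)\<^sup>2 / (\<Sum>k\<le>h (r j). (P (g (r j) i) k)\<^sup>2)) \<longlonglongrightarrow>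
      (\<Sum>i<K. (P (L i) m)\<^sup>2 / N (L i))"
  proof (intro tendsto_sum tendsto_divide)
    fix i assume "i \<in> {..<K}"
    then have i: "i < K" by simp
    show "(\<lambda>j. (P (g (r j) i) m)\<^sup>2) \<longlonglongrightarrow> (P (L i) m)\<^sup>2"
      by (intro tendsto_power isCont_tendsto_compose[OF isCont_P r(2)[OF i]])
    show "(\<lambda>j. \<Sum>k\<le>h (r j). (P (g (r j) i) k)\<^sup>2) \<longlonglongrightarrow> N (L i)"
      using kernel_tendsto[OF r(2)[OF i] r(2)[OF i] gb[OF i] gb[OF i] lim_n]
      by (simp add: N_def power2_eq_square)
  qed simp
  then have "1 - row_norm_sq m / \<rho>\<^sup>2 \<le> (\<Sum>i<K. (P (L i) m)\<^sup>2 / N (L i))"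
  proof (rule LIMSEQ_le_const, intro exI[of _ 0] allI impI)
    fix j
    have "(\<Sum>i<K. (P (g (r j) i) m)\<^sup>2 / (\<Sum>k\<le>h (r j). (P (g (r j) i) k)\<^sup>2)) =
        (\<Sum>x\<in>X (h (r j)). (P x m)\<^sup>2 / (\<Sum>k\<le>h (r j). (P x k)\<^sup>2))"
      by (rule sum.reindex_bij_betw[OF g])
    moreover have "P v (h (r j)) \<noteq> 0" "Suc m \<le> h (r j)" using h(2) by (auto simp: J_def)
    ultimately show "1 - row_norm_sq m / \<rho>\<^sup>2 \<le>
        (\<Sum>i<K. (P (g (r j) i) m)\<^sup>2 / (\<Sum>k\<le>h (r j). (P (g (r j) i) k)\<^sup>2))"
      using quadrature_tail[of v "h (r j)" m \<rho>] assms by (simp add: X_def)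
  qed
  also have "(\<Sum>i<K. (P (L i) m)\<^sup>2 / N (L i)) = (\<Sum>x\<in>L ` {..<K}. (P x m)\<^sup>2 / N x)"
    by (simp add: sum.reindex[OF L_inj])
  also have "\<dots> \<le> (\<Sum>x\<in>zeros_upto v \<rho>. (P x m)\<^sup>2 / N x)"
    using L_zero L_bound by (intro sum_mono2 finite_zeros_upto)
      (auto simp: zeros_upto_def intro!: divide_nonneg_nonneg less_imp_le[OF N_pos])
  finally show ?thesis .
qed

lemma proj_tendsto:
  "(\<lambda>j. \<Sum>n. (proj (zeros_upto v (real j)) m n - basis_vector m n)\<^sup>2) \<longlonglongrightarrow> 0"
proof (rule tendsto_sandwich)
  have eq: "(\<Sum>n. (proj (zeros_upto v (real j)) m n - basis_vector m n)\<^sup>2) =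
      1 - (\<Sum>x\<in>zeros_upto v (real j). (P x m)\<^sup>2 / N x)" for j
    by (rule sums_unique[symmetric, OF proj_defect[OF finite_zeros_upto zeros_upto_subset]])
  show "\<forall>\<^sub>F j in sequentially. 0 \<le> (\<Sum>n. (proj (zeros_upto v (real j)) m n - basis_vector m n)\<^sup>2)"
    unfolding eq using bessel[OF finite_zeros_upto zeros_upto_subset] by simp
  show "\<forall>\<^sub>F j in sequentially. (\<Sum>n. (proj (zeros_upto v (real j)) m n - basis_vector m n)\<^sup>2) \<le>
      row_norm_sq m / (real j)\<^sup>2"
    using eventually_gt_at_top[of 0] unfolding eq
    by eventually_elim (use parseval_lower_bound in \<open>simp add: algebra_simps\<close>)
  show "(\<lambda>j. row_norm_sq m / (real j)\<^sup>2) \<longlonglongrightarrow> 0"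
    by (rule tendsto_divide_0[OF tendsto_const])
       (intro filterlim_at_top_imp_at_infinity filterlim_pow_at_top filterlim_real_sequentially, simp)
qed simp_all

end

context limit_circle
begin

section \<open>Density of the modified eigenvectors\<close>

text \<open>
  The real restriction of \<open>fB _ v\<close>.
\<close>

definition weight :: "real \<Rightarrow> real \<Rightarrow> real" where
  "weight v x = - 1 + (x - v) * (\<Sum>k. P x k * Q v k)"

lemma fB_weight: "fB (of_real x) (of_real v) = of_real (weight v x)"
  by (simp add: fB_of_real weight_def)

lemma weight_self [simp]: "weight v v = - 1" by (simp add: weight_def)

lemma proj_coordinate_tendsto:
  "(\<lambda>j. proj (zeros_upto v (real j)) m n) \<longlonglongrightarrow> basis_vector m n"
proof -
  have "(\<lambda>j. (proj (zeros_upto v (real j)) m n - basis_vector m n)\<^sup>2) \<longlonglongrightarrow> 0"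
  proof (rule tendsto_sandwich[OF _ _ tendsto_const proj_tendsto])
    have "(\<Sum>n\<in>{n}. (proj F m n - basis_vector m n)\<^sup>2) \<le> (\<Sum>n. (proj F m n - basis_vector m n)\<^sup>2)"
      if "finite F" "F \<subseteq> zeros v" for F
      using sums_summable[OF proj_defect[OF that]] by (intro sum_le_suminf) auto
    then show "\<forall>\<^sub>F j in sequentially. (proj (zeros_upto v (real j)) m n - basis_vector m n)\<^sup>2 \<le>
        (\<Sum>n. (proj (zeros_upto v (real j)) m n - basis_vector m n)\<^sup>2)"
      using finite_zeros_upto zeros_upto_subset by (intro always_eventually) simp
  qed simp
  then have "(\<lambda>j. sqrt ((proj (zeros_upto v (real j)) m n - basis_vector m n)\<^sup>2)) \<longlonglongrightarrow> sqrt 0"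
    by (rule tendsto_real_sqrt)
  then have "(\<lambda>j. proj (zeros_upto v (real j)) m n - basis_vector m n) \<longlonglongrightarrow> 0"
    by (simp add: tendsto_rabs_zero_iff)
  then show ?thesis by (rule LIM_zero_cancel)
qed

lemma proj_Q_tendsto:
  "(\<lambda>j. \<Sum>k. proj (zeros_upto v (real j)) l k * Q v k) \<longlonglongrightarrow> Q v l"
proof -
  define p where "p j k = proj (zeros_upto v (real j)) l k" for j k
  have s: "summable (\<lambda>k. (p j k - basis_vector l k)\<^sup>2)" for j
    unfolding p_def by (rule sums_summable[OF proj_defect[OF finite_zeros_upto zeros_upto_subset]])
  have bQ: "(\<lambda>k. basis_vector l k * Q v k) sums Q v l"
    using sums_single[of l "\<lambda>k. Q v k"] by (simp add: basis_vector_def if_distrib[of "\<lambda>x. x * _"] cong: if_cong)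
  have eq: "(\<Sum>k. p j k * Q v k) - Q v l = (\<Sum>k. (p j k - basis_vector l k) * Q v k)" for j
  proof -
    note S = summable_sums[OF real_cauchy_schwarz(2)[OF s[of j] summable_Q_sq[of v]]]
    have "(\<lambda>k. p j k * Q v k) sums ((\<Sum>k. (p j k - basis_vector l k) * Q v k) + Q v l)"
      using sums_add[OF S bQ] by (simp add: algebra_simps)
    then show ?thesis by (simp add: sums_iff)
  qed
  have "(\<lambda>j. (\<Sum>k. p j k * Q v k) - Q v l) \<longlonglongrightarrow> 0"
  proof (rule tendsto_rabs_zero_cancel, rule tendsto_sandwich[OF _ _ tendsto_const])
    show "\<forall>\<^sub>F j in sequentially. \<bar>(\<Sum>k. p j k * Q v k) - Q v l\<bar> \<le>
        sqrt (\<Sum>k. (p j k - basis_vector l k)\<^sup>2) * sqrt (\<Sum>k. (Q v k)\<^sup>2)"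
      unfolding eq by (intro always_eventually allI real_cauchy_schwarz(1) s summable_Q_sq)
    have "(\<lambda>j. sqrt (\<Sum>k. (p j k - basis_vector l k)\<^sup>2) * sqrt (\<Sum>k. (Q v k)\<^sup>2)) \<longlonglongrightarrow>
        sqrt 0 * sqrt (\<Sum>k. (Q v k)\<^sup>2)"
      unfolding p_def by (intro tendsto_mult tendsto_const tendsto_real_sqrt proj_tendsto)
    then show "(\<lambda>j. sqrt (\<Sum>k. (p j k - basis_vector l k)\<^sup>2) * sqrt (\<Sum>k. (Q v k)\<^sup>2)) \<longlonglongrightarrow> 0"
      by simp
  qed simp
  then show ?thesis unfolding p_def by (rule LIM_zero_cancel)
qed

text \<open>
  Formally the \<open>n\<close>-th coordinate is the sum over all zeros \<open>x\<close> of \<open>weight v x * P x n / N x\<close>. Write \<open>T\<close> for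
  the Jacobi operator, so that \<open>(x - v) * P x n\<close> is the inner product of \<open>(T - v) e\<^sub>n\<close> and \<open>P x\<close>. By
  completeness the sum equals \<open>- \<langle>e\<^sub>0, e\<^sub>n\<rangle> + \<langle>(T - v) e\<^sub>n, Q v\<rangle>\<close>, and this is 0 by the recurrence for \<open>Q v\<close>.
\<close>

lemma weighted_combination_tendsto_0:
  "(\<lambda>j. \<Sum>x\<in>zeros_upto v (real j). weight v x / N x * P x n) \<longlonglongrightarrow> 0"
proof -
  define Z where "Z j = zeros_upto v (real j)" for j
  define T where "T j l = (\<Sum>k. proj (Z j) l k * Q v k)" for j l
  have T_eq: "T j l = (\<Sum>x\<in>Z j. P x l / N x * (\<Sum>k. P x k * Q v k))" for j l
  proof -
    have "(\<lambda>k. \<Sum>x\<in>Z j. P x l / N x * (P x k * Q v k)) sums (\<Sum>x\<in>Z j. P x l / N x * (\<Sum>k. P x k * Q v k))"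
      by (intro sums_sum sums_mult summable_sums summable_P_Q)
    then have "(\<lambda>k. proj (Z j) l k * Q v k) sums (\<Sum>x\<in>Z j. P x l / N x * (\<Sum>k. P x k * Q v k))"
      by (simp add: proj_def sum_distrib_right mult.assoc)
    then show ?thesis by (simp add: T_def sums_iff)
  qed
  have eq: "(\<Sum>x\<in>Z j. weight v x / N x * P x n) =
      - proj (Z j) 0 n + (\<Sum>l\<le>Suc n. jacobi_entry n l * T j l) - v * T j n" for j
  proof -
    have "weight v x / N x * P x n = - (P x 0 / N x * P x n)
        + (\<Sum>l\<le>Suc n. jacobi_entry n l * (P x l / N x * (\<Sum>k. P x k * Q v k)))
        - v * (P x n / N x * (\<Sum>k. P x k * Q v k))" for x
    proof -
      have "(\<Sum>l\<le>Suc n. jacobi_entry n l * (P x l / N x * (\<Sum>k. P x k * Q v k))) =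
          (\<Sum>l\<le>Suc n. jacobi_entry n l * P x l) * ((\<Sum>k. P x k * Q v k) / N x)"
        unfolding sum_distrib_right by (intro sum.cong) auto
      also have "(\<Sum>l\<le>Suc n. jacobi_entry n l * P x l) = x * P x n"
        using jacobi_entry_row[OF recurrence_P, of n x] by (simp split: if_splits)
      finally show ?thesis by (simp add: weight_def field_simps)
    qed
    then have "(\<Sum>x\<in>Z j. weight v x / N x * P x n) =
        (\<Sum>x\<in>Z j. - (P x 0 / N x * P x n)
        + (\<Sum>l\<le>Suc n. jacobi_entry n l * (P x l / N x * (\<Sum>k. P x k * Q v k)))
        - v * (P x n / N x * (\<Sum>k. P x k * Q v k)))" by (simp only:)
    also have "\<dots> = - proj (Z j) 0 n +
        (\<Sum>l\<le>Suc n. jacobi_entry n l * T j l) - v * T j n"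
      unfolding proj_def T_eq sum_distrib_left
      by (simp only: sum.distrib sum_subtractf sum_negf) (subst sum.swap, rule refl)
    finally show ?thesis .
  qed
  have "(\<lambda>j. - proj (Z j) 0 n + (\<Sum>l\<le>Suc n. jacobi_entry n l * T j l) - v * T j n) \<longlonglongrightarrow>
      - basis_vector 0 n + (\<Sum>l\<le>Suc n. jacobi_entry n l * Q v l) - v * Q v n"
    unfolding T_def Z_def
    by (intro tendsto_intros proj_coordinate_tendsto proj_Q_tendsto)
  also have "- basis_vector 0 n + (\<Sum>l\<le>Suc n. jacobi_entry n l * Q v l) - v * Q v n = 0"
    using jacobi_entry_row[OF recurrence_Q, of n v] by (simp add: basis_vector_def split: if_splits)
  finally have "(\<lambda>j. \<Sum>x\<in>Z j. weight v x / N x * P x n) \<longlonglongrightarrow> 0" unfolding eq .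
  then show ?thesis unfolding Z_def .
qed

text \<open>
  If the sums were bounded, the vectors \<open>d j\<close> in the proof would be bounded with coordinates tending to 0,
  so they would tend to 0 weakly. Their inner product with \<open>P v\<close> is however \<open>weight v v = - 1\<close>, because \<open>P v\<close>
  is orthogonal to the other \<open>P x\<close>.
\<close>

lemma weighted_sum_unbounded:
  "\<exists>j. \<bar>v\<bar> \<le> real j \<and> (\<Sum>x\<in>zeros_upto v (real j). (weight v x)\<^sup>2 / N x) > K"
proof (rule ccontr)
  assume "\<nexists>j. \<bar>v\<bar> \<le> real j \<and> (\<Sum>x\<in>zeros_upto v (real j). (weight v x)\<^sup>2 / N x) > K"
  then have K: "(\<Sum>x\<in>zeros_upto v (real j). (weight v x)\<^sup>2 / N x) \<le> max 1 K" if "\<bar>v\<bar> \<le> real j" for j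
    using that by (force simp: not_less le_max_iff_disj)
  define K1 where "K1 = max 1 K"
  have K1: "K1 > 0" by (simp add: K1_def)
  define d where "d j n = (\<Sum>x\<in>zeros_upto v (real j). weight v x / N x * P x n)" for j n
  have d0: "(\<lambda>j. d j n) \<longlonglongrightarrow> 0" for n
    unfolding d_def by (rule weighted_combination_tendsto_0)
  have d_norm: "(\<lambda>n. (d j n)\<^sup>2) sums (\<Sum>x\<in>zeros_upto v (real j). (weight v x)\<^sup>2 / N x)" for j
    using combination_norm_sq[OF finite_zeros_upto zeros_upto_subset, of "\<lambda>x. weight v x / N x" v "real j"]
    by (simp add: d_def power_divide power2_eq_square)
  have d_inner: "(\<lambda>n. d j n * P v n) sums (-1)" if "\<bar>v\<bar> \<le> real j" for j
  proof -
    have v: "v \<in> zeros_upto v (real j)" using that by (simp add: zeros_upto_def v_in_zeros)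
    have "(\<lambda>n. \<Sum>x\<in>zeros_upto v (real j). weight v x / N x * (P x n * P v n)) sums
        (\<Sum>x\<in>zeros_upto v (real j). weight v x / N x * (\<Sum>n. P x n * P v n))"
      by (intro sums_sum sums_mult summable_sums summable_P_P)
    also have "(\<lambda>n. \<Sum>x\<in>zeros_upto v (real j). weight v x / N x * (P x n * P v n)) = (\<lambda>n. d j n * P v n)"
      by (simp add: d_def sum_distrib_right mult.assoc)
    also have "(\<Sum>x\<in>zeros_upto v (real j). weight v x / N x * (\<Sum>n. P x n * P v n)) =
        (\<Sum>x\<in>{v}. weight v x / N x * (\<Sum>n. P x n * P v n))"
      using v zeros_orthogonal[of _ v v] v_in_zeros
      by (intro sum.mono_neutral_right finite_zeros_upto) (auto simp: zeros_upto_def)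
    also have "\<dots> = - 1" by (simp add: N_def[unfolded power2_eq_square, symmetric])
    finally show ?thesis .
  qed
  have "eventually (\<lambda>M. norm (\<Sum>n. (P v (n + M))\<^sup>2) < 1 / (4 * K1)) sequentially"
    using suminf_exist_split[OF _ summable_P_sq[of v], of "1 / (4 * K1)"] K1
    unfolding eventually_sequentially by auto
  then obtain M where "norm (\<Sum>n. (P v (n + M))\<^sup>2) < 1 / (4 * K1)"
    using eventually_happens'[OF sequentially_bot] by blast
  then have M: "(\<Sum>n. (P v (n + M))\<^sup>2) < 1 / (4 * K1)" by simp
  have "(\<lambda>j. \<Sum>n<M. d j n * P v n) \<longlonglongrightarrow> (\<Sum>n<M. 0 * P v n)"
    by (intro tendsto_sum tendsto_mult d0 tendsto_const)
  then have "\<forall>\<^sub>F j in sequentially. \<bar>\<Sum>n<M. d j n * P v n\<bar> < 1 / 2"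
    by (auto simp: tendsto_iff dist_real_def dest: spec[of _ "1 / 2"])
  moreover have "\<forall>\<^sub>F j in sequentially. \<bar>v\<bar> \<le> real j"
    using filterlim_real_sequentially unfolding filterlim_at_top by blast
  ultimately have "\<forall>\<^sub>F j in sequentially. \<bar>\<Sum>n<M. d j n * P v n\<bar> < 1 / 2 \<and> \<bar>v\<bar> \<le> real j"
    by (rule eventually_conj)
  then obtain j where j: "\<bar>\<Sum>n<M. d j n * P v n\<bar> < 1 / 2" "\<bar>v\<bar> \<le> real j"
    by (auto simp: eventually_sequentially)
  have sd: "summable (\<lambda>n. (d j n)\<^sup>2)" using d_norm by (rule sums_summable)
  have "(\<Sum>n. (d j (n + M))\<^sup>2) \<le> (\<Sum>n. (d j n)\<^sup>2)"
    using suminf_split_initial_segment[OF sd, of M] sum_nonneg[of "{..<M}" "\<lambda>n. (d j n)\<^sup>2"] by simp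
  also have "\<dots> \<le> K1" using K[OF j(2)] sums_unique[OF d_norm, of j] by (simp add: K1_def)
  finally have dK: "(\<Sum>n. (d j (n + M))\<^sup>2) \<le> K1" .
  have "\<bar>\<Sum>n. d j (n + M) * P v (n + M)\<bar> \<le> sqrt (\<Sum>n. (d j (n + M))\<^sup>2) * sqrt (\<Sum>n. (P v (n + M))\<^sup>2)"
    by (intro real_cauchy_schwarz summable_ignore_initial_segment[OF sd]
        summable_ignore_initial_segment[OF summable_P_sq])
  also have "\<dots> \<le> sqrt K1 * sqrt (1 / (4 * K1))"
    using dK M K1 by (intro mult_mono real_sqrt_le_mono) (auto intro!: suminf_nonneg
        summable_ignore_initial_segment[OF summable_P_sq])
  also have "\<dots> = sqrt (1 / 4)" using K1 by (simp flip: real_sqrt_mult)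
  also have "\<dots> = 1 / 2" by (rule real_sqrt_unique) (auto simp: power2_eq_square)
  finally have "\<bar>\<Sum>n. d j (n + M) * P v (n + M)\<bar> \<le> 1 / 2" .
  moreover have "(\<Sum>n. d j n * P v n) = (\<Sum>n. d j (n + M) * P v (n + M)) + (\<Sum>n<M. d j n * P v n)"
    by (rule suminf_split_initial_segment[OF sums_summable[OF d_inner[OF j(2)]]])
  moreover have "(\<Sum>n. d j n * P v n) = -1" using d_inner[OF j(2)] by (simp add: sums_iff)
  ultimately show False using j(1) by linarith
qed

definition index_set :: "complex \<Rightarrow> complex set" where
  "index_set v = {u. u \<in> \<real> \<and> fD u v = 0 \<and> u \<noteq> v}"

lemma family_in_closure:
  assumes "x \<in> zeros v" "x \<noteq> v"
  shows "family (of_real v) (of_real x) \<in> ell2_closure (cspan (family (of_real v) ` index_set (of_real v)))"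
  using assms
  by (intro ell2_closure_superset cspan_superset family_ell2 imageI) (auto simp: index_set_def zeros_iff)

text \<open>
  A combination of the \<open>family v x\<close> with \<open>(\<Sum>x\<in>F. t x * weight v x) = 1\<close> is \<open>P v\<close> plus a combination of the
  orthogonal vectors \<open>P x\<close>. The least possible norm of the latter is the inverse square root of the sum of
  \<open>(weight v x)\<^sup>2 / N x\<close> over \<open>F\<close>, which is arbitrarily small as these sums are unbounded.
\<close>

lemma P_v_in_closure:
  "P (of_real v) \<in> ell2_closure (cspan (family (of_real v) ` index_set (of_real v)))"
proof (rule ell2_closure_closed[OF P_ell2])
  fix \<epsilon> :: real assume e: "\<epsilon> > 0"
  obtain j where j: "\<bar>v\<bar> \<le> real j"
    "(\<Sum>x\<in>zeros_upto v (real j). (weight v x)\<^sup>2 / N x) > 1 / \<epsilon>\<^sup>2 + 1 / N v"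
    using weighted_sum_unbounded by blast
  define F where "F = zeros_upto v (real j) - {v}"
  have F: "finite F" "F \<subseteq> zeros v" "v \<notin> F"
    using finite_zeros_upto[of v "real j"] by (auto simp: F_def zeros_upto_def)
  define S where "S = (\<Sum>x\<in>F. (weight v x)\<^sup>2 / N x)"
  have "(\<Sum>x\<in>zeros_upto v (real j). (weight v x)\<^sup>2 / N x) = 1 / N v + S"
    unfolding S_def F_def using j(1) finite_zeros_upto[of v "real j"]
    by (subst sum.remove[of _ v]) (auto simp: zeros_upto_def v_in_zeros)
  then have S: "S > 1 / \<epsilon>\<^sup>2" using j(2) by simp
  then have S0: "S > 0" using e by (meson less_trans zero_less_divide_1_iff zero_less_power)
  \<comment> \<open>The coefficients minimise the norm of \<open>\<Sum>x\<in>F. t x * P x n\<close> subject to \<open>(\<Sum>x\<in>F. t x * weight v x) = 1\<close>.\<close>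
  define t where "t x = weight v x / N x / S" for x
  define d where "d = (\<lambda>n. \<Sum>x\<in>F. of_real (t x) * family (of_real v) (of_real x) n)"
  have tw: "(\<Sum>x\<in>F. t x * weight v x) = 1"
  proof -
    have "(\<Sum>x\<in>F. t x * weight v x) = S / S"
      unfolding S_def sum_divide_distrib by (simp add: t_def S_def power2_eq_square)
    then show ?thesis using S0 by simp
  qed
  have diff: "P (of_real v) n - d n = - of_real (\<Sum>x\<in>F. t x * P x n)" for n
  proof -
    have "d n = of_real ((\<Sum>x\<in>F. t x * P x n) + (\<Sum>x\<in>F. t x * weight v x) * P v n)"
      by (simp add: d_def family_def fB_weight P_of_real sum_distrib_right sum.distrib distrib_left mult.assoc)
    then show ?thesis by (simp add: tw P_of_real)
  qed
  have "(\<lambda>n. (\<Sum>x\<in>F. t x * P x n)\<^sup>2) sums (\<Sum>x\<in>F. (t x)\<^sup>2 * N x)"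
    by (rule combination_norm_sq[OF F(1,2)])
  also have "(\<Sum>x\<in>F. (t x)\<^sup>2 * N x) = (\<Sum>x\<in>F. (weight v x)\<^sup>2 / N x) / S\<^sup>2"
    unfolding sum_divide_distrib by (intro sum.cong) (auto simp: t_def power2_eq_square)
  also have "\<dots> = 1 / S" unfolding S_def[symmetric] using S0 by (simp add: power2_eq_square)
  finally have "ell2_norm (\<lambda>n. P (of_real v) n - d n) = sqrt (1 / S)"
    unfolding ell2_norm_def diff by (simp add: sums_iff flip: of_real_mult of_real_sum)
  also have "\<dots> < sqrt (\<epsilon>\<^sup>2)"
    using S S0 e by (intro real_sqrt_less_mono) (simp add: field_simps)
  also have "\<dots> = \<epsilon>" using e by simp
  finally have "ell2_norm (\<lambda>n. P (of_real v) n - d n) < \<epsilon>" .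
  moreover have "d \<in> ell2_closure (cspan (family (of_real v) ` index_set (of_real v)))"
    unfolding d_def using F by (intro ell2_closure_sum family_in_closure) auto
  ultimately show "\<exists>d\<in>ell2_closure (cspan (family (of_real v) ` index_set (of_real v))).
      ell2_norm (\<lambda>n. P (of_real v) n - d n) < \<epsilon>" by blast
qed

lemma P_in_closure:
  assumes "x \<in> zeros v"
  shows "P (of_real x) \<in> ell2_closure (cspan (family (of_real v) ` index_set (of_real v)))"
proof (cases "x = v")
  case False
  have "(\<lambda>n. family (of_real v) (of_real x) n + (- fB (of_real x) (of_real v)) * P (of_real v) n)
      \<in> ell2_closure (cspan (family (of_real v) ` index_set (of_real v)))"
    by (intro ell2_closure_add ell2_closure_scale family_in_closure assms False P_v_in_closure)
  then show ?thesis by (simp add: family_def)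
qed (simp add: P_v_in_closure)

lemma family_dense: "dense_in ell2 (cspan (family (of_real v) ` index_set (of_real v)))"
proof (rule dense_if_basis_in_closure, rule ell2_closure_closed[OF basis_vector_ell2])
  fix m and \<epsilon> :: real assume e: "\<epsilon> > 0"
  have "(\<lambda>j. sqrt (\<Sum>n. (proj (zeros_upto v (real j)) m n - basis_vector m n)\<^sup>2)) \<longlonglongrightarrow> sqrt 0"
    by (rule tendsto_real_sqrt[OF proj_tendsto])
  then have "\<forall>\<^sub>F j in sequentially. sqrt (\<Sum>n. (proj (zeros_upto v (real j)) m n - basis_vector m n)\<^sup>2) < \<epsilon>"
    using e by (intro order_tendstoD) simp_all
  then obtain j where j: "sqrt (\<Sum>n. (proj (zeros_upto v (real j)) m n - basis_vector m n)\<^sup>2) < \<epsilon>"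
    by (auto simp: eventually_sequentially)
  define d where "d = (\<lambda>n. \<Sum>x\<in>zeros_upto v (real j). of_real (P x m / N x) * P (of_real x) n :: complex)"
  have "basis_vector m n - d n = - of_real (proj (zeros_upto v (real j)) m n - basis_vector m n)" for n
    by (simp add: d_def proj_def P_of_real basis_vector_def)
  then have "ell2_norm (\<lambda>n. basis_vector m n - d n) < \<epsilon>"
    unfolding ell2_norm_def using j by (simp only: norm_minus_cancel norm_of_real power2_abs)
  moreover have "d \<in> ell2_closure (cspan (family (of_real v) ` index_set (of_real v)))"
    unfolding d_def by (intro ell2_closure_sum P_in_closure) (use zeros_upto_subset in blast)
  ultimately show "\<exists>d\<in>ell2_closure (cspan (family (of_real v) ` index_set (of_real v))).
      ell2_norm (\<lambda>n. basis_vector m n - d n) < \<epsilon>" by blast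
qed

lemma family_optimal:
  assumes "v \<in> \<real>"
  shows "optimal_for_density_in ell2 (index_set v) (family v)"
  unfolding optimal_for_density_in_def
proof (intro conjI ballI)
  obtain w where w: "v = of_real w" using assms by (auto elim: Reals_cases)
  show "dense_in ell2 (cspan (family v ` index_set v))" unfolding w by (rule family_dense)
  show "family v u \<in> ell2" for u by (rule family_ell2)
  fix u1 assume u1: "u1 \<in> index_set v"
  show "\<not> dense_in ell2 (cspan (family v ` (index_set v - {u1})))"
    by (rule not_dense_if_orthogonal_to_P[of _ u1])
       (use u1 assms in \<open>auto simp: index_set_def intro: family_orthogonal\<close>)
qed

end

section \<open>The polynomials of the second kind\<close>

lemma ell2_Suc: "(\<lambda>k. c (Suc k)) \<in> ell2 \<longleftrightarrow> c \<in> ell2"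
  using summable_Suc_iff[of "\<lambda>n. (norm (c n))\<^sup>2"] by (simp add: ell2_def)

lemma ell2_norm_Suc:
  assumes "c 0 = 0" "c \<in> ell2" shows "ell2_norm (\<lambda>k. c (Suc k)) = ell2_norm c"
  using assms suminf_split_head[of "\<lambda>n. (norm (c n))\<^sup>2"] by (simp add: ell2_def ell2_norm_def)

lemma dense_in_ell2_zero_iff:
  fixes \<kappa> :: complex
  assumes "\<kappa> \<noteq> 0" "\<And>i. i \<in> I \<Longrightarrow> f i 0 = 0" "\<And>i k. i \<in> I \<Longrightarrow> g i k = \<kappa> * f i (Suc k)"
  shows "dense_in ell2_zero (cspan (f ` I)) \<longleftrightarrow> dense_in ell2 (cspan (g ` I))"
proof
  assume dense: "dense_in ell2_zero (cspan (f ` I))"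
  show "dense_in ell2 (cspan (g ` I))"
    unfolding dense_in_def
  proof (intro ballI allI impI)
    fix c \<epsilon> assume c: "c \<in> ell2" and e: "(\<epsilon>::real) > 0"
    define c' where "c' n = (case n of 0 \<Rightarrow> 0 | Suc k \<Rightarrow> c k)" for n
    have c': "(\<lambda>k. c' (Suc k)) = c" "c' 0 = 0" by (auto simp: c'_def)
    then have "c' \<in> ell2_zero" using ell2_Suc[of c'] c by (simp add: ell2_zero_def)
    then obtain d where d: "d \<in> cspan (f ` I)" "d \<in> ell2_zero" "ell2_norm (\<lambda>n. c' n - d n) < \<epsilon>"
      using dense e by (auto simp: dense_in_def)
    then obtain F t where F: "finite F" "F \<subseteq> I" "d = (\<lambda>n. \<Sum>i\<in>F. t i * f i n)"
      unfolding cspan_image by (elim CollectE exE conjE)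
    have d': "(\<lambda>k. d (Suc k)) \<in> ell2" using d(2) ell2_Suc[of d] by (simp add: ell2_zero_def)
    have "(\<lambda>k. d (Suc k)) = (\<lambda>k. \<Sum>i\<in>F. t i / \<kappa> * g i k)"
      unfolding F(3) using assms(1,3) F(2) by (auto intro!: sum.cong simp: subset_iff)
    then have "(\<lambda>k. d (Suc k)) \<in> cspan (g ` I)"
      unfolding cspan_image using F(1,2) by (intro CollectI exI[of _ F] exI[of _ "\<lambda>i. t i / \<kappa>"] conjI)
    moreover have "ell2_norm (\<lambda>k. c k - d (Suc k)) < \<epsilon>"
    proof -
      have "(\<lambda>n. c' n - d n) \<in> ell2" "c' 0 - d 0 = 0"
        using d(2) \<open>c' \<in> ell2_zero\<close> by (auto simp: ell2_zero_def intro: ell2_diff)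
      from ell2_norm_Suc[OF this(2,1)] show ?thesis using d(3) by (simp add: fun_cong[OF c'(1)])
    qed
    ultimately show "\<exists>d\<in>cspan (g ` I) \<inter> ell2. ell2_norm (\<lambda>n. c n - d n) < \<epsilon>"
      using d' by (intro bexI[of _ "\<lambda>k. d (Suc k)"]) auto
  qed
next
  assume dense: "dense_in ell2 (cspan (g ` I))"
  show "dense_in ell2_zero (cspan (f ` I))"
    unfolding dense_in_def
  proof (intro ballI allI impI)
    fix c \<epsilon> assume c: "c \<in> ell2_zero" and e: "(\<epsilon>::real) > 0"
    have "(\<lambda>k. c (Suc k)) \<in> ell2"
      using c ell2_Suc[of c] by (simp add: ell2_zero_def)
    then obtain d where d: "d \<in> cspan (g ` I)" "d \<in> ell2" "ell2_norm (\<lambda>k. c (Suc k) - d k) < \<epsilon>"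
      using dense[unfolded dense_in_def, rule_format, of "\<lambda>k. c (Suc k)", OF _ e] by auto
    then obtain F t where F: "finite F" "F \<subseteq> I" "d = (\<lambda>n. \<Sum>i\<in>F. t i * g i n)"
      unfolding cspan_image by (elim CollectE exE conjE)
    define d' where "d' = (\<lambda>n. \<Sum>i\<in>F. (t i * \<kappa>) * f i n)"
    have d'_Suc: "(\<lambda>k. d' (Suc k)) = d"
      unfolding F(3) d'_def using assms(3) F(2) by (auto intro!: sum.cong simp: subset_iff)
    have d'_0: "d' 0 = 0"
      unfolding d'_def using assms(2) F(2) by (intro sum.neutral) auto
    have d'2: "d' \<in> ell2_zero" using d'_Suc d'_0 d(2) ell2_Suc[of d'] by (simp add: ell2_zero_def)
    have "d' \<in> cspan (f ` I)"
      unfolding cspan_image d'_def using F(1,2)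
      by (intro CollectI exI[of _ F] exI[of _ "\<lambda>i. t i * \<kappa>"] conjI refl)
    moreover have "ell2_norm (\<lambda>n. c n - d' n) < \<epsilon>"
    proof -
      have "(\<lambda>n. c n - d' n) \<in> ell2" "c 0 - d' 0 = 0"
        using c d'2 by (auto simp: ell2_zero_def intro: ell2_diff)
      from ell2_norm_Suc[OF this(2,1)] show ?thesis using d(3) by (simp add: fun_cong[OF d'_Suc])
    qed
    ultimately show "\<exists>d\<in>cspan (f ` I) \<inter> ell2_zero. ell2_norm (\<lambda>n. c n - d n) < \<epsilon>"
      using d'2 by blast
  qed
qed

context limit_circle
begin

definition fA :: "complex \<Rightarrow> complex \<Rightarrow> complex" where
  "fA u v = (u - v) * (\<Sum>k. Q u k * Q v k)"

text \<open>
  Deleting the first row and column of the Jacobi matrix leaves a Jacobi matrix whose orthonormal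
  polynomials are the \<open>b 0 * Q z (Suc n)\<close>. Its kernel \<open>fD\<close> is a multiple of \<open>fA\<close>, and at the zeros of \<open>fA\<close> its
  function \<open>fB\<close> is \<open>- fC\<close>. The family considered here is thus, up to the factor \<open>b 0\<close> and the shift, the
  family of eigenvectors already treated.
\<close>

lemma second_kind_optimal:
  assumes "v \<in> \<real>"
  shows "optimal_for_density_in ell2_zero {u. u \<in> \<real> \<and> fA u v = 0 \<and> u \<noteq> v}
    (\<lambda>u n. Q u n - fC u v * Q v n)"
proof -
  interpret S: jacobi_matrix "\<lambda>n. a (Suc n)" "\<lambda>n. b (Suc n)"
    by unfold_locales (rule b_pos)
  have SP: "S.P z = (\<lambda>n. of_real (b 0) * Q z (Suc n))" for z :: complex
  proof (rule S.recurrence_unique[OF S.recurrence_P])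
    show "S.recurrence z 0 (\<lambda>n. of_real (b 0) * Q z (Suc n))"
    proof -
      have rec: "of_real (b (Suc n)) * Q z (Suc (Suc n)) =
          (z - of_real (a (Suc n))) * Q z (Suc n) - of_real (b n) * Q z n" for n
        using recurrence_Q[of z] by (simp add: recurrence_def)
      have "of_real (b (Suc n)) * (of_real (b 0) * Q z (Suc (Suc n))) =
          (z - of_real (a (Suc n))) * (of_real (b 0) * Q z (Suc n)) - of_real (b n) * (of_real (b 0) * Q z n)" for n
        using arg_cong[OF rec[of n], of "\<lambda>t. of_real (b 0) * t"] by (simp add: algebra_simps)
      from this[of 0] this[of "Suc _"] show ?thesis by (simp add: S.recurrence_def)
    qed
    show "S.P z 0 = of_real (b 0) * Q z (Suc 0)" by (simp add: Q_def)
  qed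
  have SQ: "S.Q z = (\<lambda>n. (- P z (Suc n) + (z - of_real (a 0)) * Q z (Suc n)) / of_real (b 0))" for z :: complex
  proof (rule S.recurrence_unique[OF S.recurrence_Q])
    show "S.recurrence z 1 (\<lambda>n. (- P z (Suc n) + (z - of_real (a 0)) * Q z (Suc n)) / of_real (b 0))"
    proof -
      define w where "w n = - P z n + (z - of_real (a 0)) * Q z n" for n
      have P: "of_real (b (Suc n)) * P z (Suc (Suc n)) =
          (z - of_real (a (Suc n))) * P z (Suc n) - of_real (b n) * P z n"
        and Q: "of_real (b (Suc n)) * Q z (Suc (Suc n)) =
          (z - of_real (a (Suc n))) * Q z (Suc n) - of_real (b n) * Q z n" for n
        using recurrence_P[of z] recurrence_Q[of z] by (simp_all add: recurrence_def)
      have rec: "of_real (b (Suc n)) * w (Suc (Suc n)) =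
          (z - of_real (a (Suc n))) * w (Suc n) - of_real (b n) * w n" for n
      proof -
        have "of_real (b (Suc n)) * w (Suc (Suc n)) = - (of_real (b (Suc n)) * P z (Suc (Suc n)))
            + (z - of_real (a 0)) * (of_real (b (Suc n)) * Q z (Suc (Suc n)))"
          by (simp add: w_def algebra_simps)
        then show ?thesis unfolding P Q by (simp add: w_def algebra_simps)
      qed
      have "of_real (b (Suc n)) * (w (Suc (Suc n)) / of_real (b 0)) =
          (z - of_real (a (Suc n))) * (w (Suc n) / of_real (b 0)) - of_real (b n) * (w n / of_real (b 0))" for n
        using arg_cong[OF rec[of n], of "\<lambda>t. t / of_real (b 0)"] by (simp add: diff_divide_distrib)
      from this[of 0] this[of "Suc _"] have "S.recurrence z 1 (\<lambda>n. w (Suc n) / of_real (b 0))"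
        by (simp add: S.recurrence_def) (simp add: w_def)
      then show ?thesis by (simp only: w_def)
    qed
    show "S.Q z 0 = (- P z (Suc 0) + (z - of_real (a 0)) * Q z (Suc 0)) / of_real (b 0)"
      by (simp add: Q_def P_def)
  qed
  interpret S: limit_circle "\<lambda>n. a (Suc n)" "\<lambda>n. b (Suc n)" z0
  proof
    have "(\<lambda>n. Q z0 (Suc n)) \<in> ell2" "(\<lambda>n. P z0 (Suc n)) \<in> ell2"
      using Q_ell2[of z0] P_ell2[of z0] by (simp_all add: ell2_Suc)
    then show "S.P z0 \<in> ell2" "S.Q z0 \<in> ell2"
      using ell2_scale[OF ell2_add[OF ell2_scale[of "\<lambda>n. P z0 (Suc n)" "- 1"]
          ell2_scale[of "\<lambda>n. Q z0 (Suc n)" "z0 - of_real (a 0)"]], of "1 / of_real (b 0)"]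
      by (simp_all add: SP SQ ell2_scale)
  qed
  have QQ: "summable (\<lambda>k. Q (u::complex) k * Q v k)" for u
    using Q_ell2 by (auto intro!: summable_norm_cancel[OF ell2_summable_mult] simp: ell2_def)
  have sum_QQ: "(\<lambda>k. Q u (Suc k) * Q v (Suc k)) sums (\<Sum>k. Q u k * Q v k)" for u
    using summable_sums[OF QQ[of u]] sums_Suc_iff[of "\<lambda>k. Q u k * Q v k"] by simp
  have sum_QP: "(\<lambda>k. Q u (Suc k) * P v (Suc k)) sums (\<Sum>k. Q u k * P v k)" for u
    using summable_sums[OF summable_QP[of u v]] sums_Suc_iff[of "\<lambda>k. Q u k * P v k"] by simp
  have SD: "S.fD u v = of_real (b 0)^2 * fA u v" for u
  proof -
    have "(\<lambda>k. S.P u k * S.P v k) sums (of_real (b 0)^2 * (\<Sum>k. Q u k * Q v k))"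
      using sums_mult[OF sum_QQ[of u], of "of_real (b 0)^2"] by (simp add: SP power2_eq_square algebra_simps)
    then show ?thesis by (simp add: S.fD_def fA_def sums_iff)
  qed
  have SB: "S.fB u v = - fC u v + (v - of_real (a 0)) * fA u v" for u
  proof -
    have "(\<lambda>k. - (Q u (Suc k) * P v (Suc k)) + (v - of_real (a 0)) * (Q u (Suc k) * Q v (Suc k))) sums
        (- (\<Sum>k. Q u k * P v k) + (v - of_real (a 0)) * (\<Sum>k. Q u k * Q v k))"
      by (intro sums_add sums_minus sums_mult sum_QQ sum_QP)
    also have "(\<lambda>k. - (Q u (Suc k) * P v (Suc k)) + (v - of_real (a 0)) * (Q u (Suc k) * Q v (Suc k))) =
        (\<lambda>k. S.P u k * S.Q v k)"
      by (rule ext) (simp add: SP SQ field_simps)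
    finally have "(\<Sum>k. S.P u k * S.Q v k) =
        - (\<Sum>k. Q u k * P v k) + (v - of_real (a 0)) * (\<Sum>k. Q u k * Q v k)"
      by (simp add: sums_iff)
    then show ?thesis unfolding S.fB_def fA_def fC_def by (simp only:) (simp add: algebra_simps)
  qed
  define f where "f = (\<lambda>u n. Q u n - fC u v * Q v n)"
  define I where "I = {u. u \<in> \<real> \<and> fA u v = 0 \<and> u \<noteq> v}"
  have I_eq: "S.index_set v = I" by (simp add: S.index_set_def SD I_def)
  have fam: "S.family v u k = of_real (b 0) * f u (Suc k)" if "u \<in> I" for u k
    using that by (simp add: S.family_def SP SB f_def I_def algebra_simps)
  have dense_iff: "dense_in ell2_zero (cspan (f ` J)) \<longleftrightarrow> dense_in ell2 (cspan (S.family v ` J))"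
    if "J \<subseteq> I" for J
  proof (rule dense_in_ell2_zero_iff[where \<kappa>="of_real (b 0)"])
    show "f u 0 = 0" for u by (simp add: f_def)
    show "S.family v u k = of_real (b 0) * f u (Suc k)" if "u \<in> J" for u k
      using fam that \<open>J \<subseteq> I\<close> by blast
  qed simp
  have "optimal_for_density_in ell2 I (S.family v)"
    using S.family_optimal[OF assms] by (simp add: I_eq)
  moreover have "f u \<in> ell2_zero" for u
    unfolding ell2_zero_def f_def by (auto intro!: ell2_diff ell2_scale Q_ell2)
  ultimately have "optimal_for_density_in ell2_zero I f"
    unfolding optimal_for_density_in_def using dense_iff by auto
  then show ?thesis by (simp add: I_def f_def)
qed

end

section \<open>A measure is determined by its Stieltjes transform\<close>

definition stieltjes :: "real measure \<Rightarrow> complex \<Rightarrow> complex" where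
  "stieltjes M z = (LINT x|M. 1 / (of_real x - z))"

lemma of_real_neq_nonreal: "Im z \<noteq> 0 \<Longrightarrow> of_real x - z \<noteq> 0"
  by (auto simp: complex_eq_iff)

lemma norm_resolvent_le:
  assumes "Im z \<noteq> 0" shows "norm (1 / (of_real x - z)) \<le> 1 / \<bar>Im z\<bar>"
proof -
  have "\<bar>Im z\<bar> \<le> norm (of_real x - z)"
    using abs_Im_le_cmod[of "of_real x - z"] by simp
  then show ?thesis using assms by (simp add: norm_divide frac_le)
qed

lemma (in real_distribution) integrable_resolvent:
  assumes "Im z \<noteq> 0" shows "integrable M (\<lambda>x. 1 / (of_real x - z))"
  by (rule integrable_const_bound[of _ "1 / \<bar>Im z\<bar>"]) (use norm_resolvent_le[OF assms] in auto)

lemma Im_resolvent: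
  assumes "y > 0"
  shows "Im (1 / (of_real t - Complex x y)) = y / ((t - x)\<^sup>2 + y\<^sup>2)"
  using assms by (simp add: Im_divide power2_eq_square)

definition cauchy_char :: "real \<Rightarrow> complex" where
  "cauchy_char r = (LBINT s. iexp (r * s) * of_real (1 / (1 + s\<^sup>2)))"

lemma integrable_cauchy: "integrable lborel (\<lambda>s::real. 1 / (1 + s\<^sup>2))"
  using integrable_inverse_1_plus_square by (simp add: set_integrable_def einterval_def inverse_eq_divide)

lemma integral_cauchy: "(LBINT s::real. 1 / (1 + s\<^sup>2)) = pi"
  using LBINT_inverse_1_plus_square
  by (simp add: interval_lebesgue_integral_def einterval_def set_lebesgue_integral_def inverse_eq_divide)

text \<open>
  The function is \<open>\<lambda>r. pi * exp (- \<bar>r\<bar>)\<close>, but continuity at 0 and the value \<open>pi\<close> there suffice below.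
\<close>

lemma cauchy_char_nz_near_0: "\<exists>y>0. cauchy_char (\<zeta> * y) \<noteq> 0"
proof -
  have "(\<lambda>n. cauchy_char (\<zeta> * (1 / real (Suc n)))) \<longlonglongrightarrow> (LBINT s. of_real (1 / (1 + s\<^sup>2)))"
    unfolding cauchy_char_def
  proof (rule integral_dominated_convergence[where w="\<lambda>s. 1 / (1 + s\<^sup>2)"])
    show "AE s in lborel. (\<lambda>n. iexp (\<zeta> * (1 / real (Suc n)) * s) * complex_of_real (1 / (1 + s\<^sup>2)))
        \<longlonglongrightarrow> complex_of_real (1 / (1 + s\<^sup>2))"
    proof (rule AE_I2)
      fix s :: real
      have "(\<lambda>n. \<zeta> * (1 / real (Suc n)) * s) \<longlonglongrightarrow> \<zeta> * 0 * s"
        by (intro tendsto_mult tendsto_const LIMSEQ_Suc[OF lim_1_over_n[where 'a=real]])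
      then have "(\<lambda>n. iexp (\<zeta> * (1 / real (Suc n)) * s) * complex_of_real (1 / (1 + s\<^sup>2)))
        \<longlonglongrightarrow> iexp (\<zeta> * 0 * s) * complex_of_real (1 / (1 + s\<^sup>2))"
        by (rule tendsto_mult[OF tendsto_exp[OF tendsto_mult[OF tendsto_const tendsto_of_real]] tendsto_const])
      then show "(\<lambda>n. iexp (\<zeta> * (1 / real (Suc n)) * s) * complex_of_real (1 / (1 + s\<^sup>2)))
        \<longlonglongrightarrow> complex_of_real (1 / (1 + s\<^sup>2))" by simp
    qed
    show "AE s in lborel. norm (iexp (\<zeta> * (1 / real (Suc n)) * s) * complex_of_real (1 / (1 + s\<^sup>2)))
        \<le> 1 / (1 + s\<^sup>2)" for n
      by (simp add: norm_mult norm_divide del: of_real_divide) 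
  qed (use integrable_cauchy in auto)
  also have "(LBINT s. complex_of_real (1 / (1 + s\<^sup>2))) = of_real (LBINT s. 1 / (1 + s\<^sup>2))"
    by (rule integral_complex_of_real)
  finally have lim: "(\<lambda>n. cauchy_char (\<zeta> * (1 / real (Suc n)))) \<longlonglongrightarrow> of_real (LBINT s. 1 / (1 + s\<^sup>2))" .
  have "\<exists>n. cauchy_char (\<zeta> * (1 / real (Suc n))) \<noteq> 0"
  proof (rule ccontr)
    assume "\<nexists>n. cauchy_char (\<zeta> * (1 / real (Suc n))) \<noteq> 0"
    then have "(\<lambda>n. cauchy_char (\<zeta> * (1 / real (Suc n)))) = (\<lambda>n. 0)" by blast
    then show False using lim by (simp only: LIMSEQ_const_iff integral_cauchy) simp
  qed
  then show ?thesis by (meson of_nat_0_less_iff zero_less_Suc zero_less_divide_1_iff)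
qed

text \<open>
  The imaginary part of the transform on a horizontal line is the convolution of \<open>M\<close> with a Cauchy
  kernel, and its Fourier transform is a product.
\<close>

lemma (in real_distribution) char_times_cauchy_char:
  assumes y: "y > 0"
  shows "char M \<zeta> * cauchy_char (\<zeta> * y) = (LBINT x. iexp (\<zeta> * x) * of_real (Im (stieltjes M (Complex x y))))"
proof -
  have fin: "sigma_finite_measure M" ..
  interpret pair_sigma_finite M lborel
    unfolding pair_sigma_finite_def using fin sigma_finite_lborel by blast
  define f where "f t x = iexp (\<zeta> * x) * complex_of_real (y / ((t - x)\<^sup>2 + y\<^sup>2))" for t x
  have pos: "(t - x)\<^sup>2 + y\<^sup>2 > 0" for t x using y by (simp add: add_nonneg_pos)
  have norm_f: "norm (f t x) = y / ((t - x)\<^sup>2 + y\<^sup>2)" for t x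
    using y pos[of t x] by (simp add: f_def norm_mult norm_divide del: of_real_divide of_real_add)
  have affine: "f t (t + y * s) = of_real (1 / y) * iexp (\<zeta> * t) * (iexp (\<zeta> * y * s) * of_real (1 / (1 + s\<^sup>2)))" for t s
  proof -
    have "y / ((t - (t + y * s))\<^sup>2 + y\<^sup>2) = 1 / y * (1 / (1 + s\<^sup>2))"
    proof -
      have "(t - (t + y * s))\<^sup>2 + y\<^sup>2 = y * (y * (1 + s\<^sup>2))" by (simp add: power2_eq_square algebra_simps)
      then show ?thesis using y by simp
    qed
    moreover have "iexp (\<zeta> * (t + y * s)) = iexp (\<zeta> * t) * iexp (\<zeta> * y * s)"
      by (simp add: exp_add[symmetric] algebra_simps)
    ultimately show ?thesis unfolding f_def by (simp only: of_real_mult mult_ac)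
  qed
  have int_s: "integrable lborel (\<lambda>s. iexp (r * s) * complex_of_real (1 / (1 + s\<^sup>2)))" for r
  proof (rule Bochner_Integration.integrable_bound[OF integrable_cauchy])
    show "AE s in lborel. norm (iexp (r * s) * complex_of_real (1 / (1 + s\<^sup>2))) \<le> norm (1 / (1 + s\<^sup>2))"
      by (simp add: norm_mult norm_divide del: of_real_divide)
  qed measurable
  have int_f: "integrable lborel (f t)" for t
  proof -
    have "integrable lborel (\<lambda>s. f t (t + y * s))"
      unfolding affine by (intro integrable_mult_right int_s)
    then show ?thesis using y by (subst (asm) lborel_integrable_real_affine_iff) auto
  qed
  have inner: "(LBINT x. f t x) = iexp (\<zeta> * t) * cauchy_char (\<zeta> * y)" for t
  proof -
    have "(LBINT x. f t x) = \<bar>y\<bar> *\<^sub>R (LBINT s. f t (t + y * s))"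
      using y by (intro lborel_integral_real_affine) simp
    also have "\<dots> = iexp (\<zeta> * t) * cauchy_char (\<zeta> * y)"
      unfolding affine cauchy_char_def integral_mult_right_zero using y by (simp add: scaleR_conv_of_real)
    finally show ?thesis .
  qed
  have norm_int: "(LBINT x. norm (f t x)) = (LBINT s. 1 / (1 + s\<^sup>2))" for t
  proof -
    have "(LBINT x. norm (f t x)) = \<bar>y\<bar> *\<^sub>R (LBINT s. norm (f t (t + y * s)))"
      using y by (intro lborel_integral_real_affine) simp
    also have "(\<lambda>s. norm (f t (t + y * s))) = (\<lambda>s. 1 / y * (1 / (1 + s\<^sup>2)))"
      unfolding affine using y by (auto simp: norm_mult norm_divide simp del: of_real_divide)
    finally show ?thesis using y unfolding integral_mult_right_zero by simp
  qed
  have meas: "case_prod f \<in> borel_measurable (M \<Otimes>\<^sub>M lborel)"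
    unfolding f_def by measurable
  have "integrable (M \<Otimes>\<^sub>M lborel) (case_prod f)"
    by (rule Fubini_integrable[OF meas]) (auto simp: norm_int int_f)
  from Fubini_integral[OF this]
  have swap: "(LBINT x. (LINT t|M. f t x)) = (LINT t|M. (LBINT x. f t x))" .
  have outer: "(LINT t|M. f t x) = iexp (\<zeta> * x) * of_real (Im (stieltjes M (Complex x y)))" for x
  proof -
    have "Im (stieltjes M (Complex x y)) = (LINT t|M. y / ((t - x)\<^sup>2 + y\<^sup>2))"
      unfolding stieltjes_def
      using y by (subst integral_Im[symmetric]) (auto simp: Im_resolvent intro!: integrable_resolvent)
    then show ?thesis
      unfolding f_def integral_mult_right_zero integral_complex_of_real by simp
  qed
  have "(LINT t|M. (LBINT x. f t x)) = char M \<zeta> * cauchy_char (\<zeta> * y)"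
    unfolding inner char_def by simp
  then show ?thesis unfolding outer[symmetric] swap by simp
qed

text \<open>
  One height \<open>y\<close> with a nonzero factor \<open>cauchy_char (\<zeta> * y)\<close> determines the characteristic function at \<open>\<zeta>\<close>.
\<close>

lemma stieltjes_unique:
  assumes "real_distribution M" "real_distribution N"
    and eq: "\<And>z. Im z > 0 \<Longrightarrow> stieltjes M z = stieltjes N z"
  shows "M = N"
proof (rule Levy_uniqueness[OF assms(1,2)], rule ext)
  fix \<zeta>
  obtain y where y: "y > 0" "cauchy_char (\<zeta> * y) \<noteq> 0" using cauchy_char_nz_near_0 by blast
  have "char M \<zeta> * cauchy_char (\<zeta> * y) = char N \<zeta> * cauchy_char (\<zeta> * y)"
    unfolding real_distribution.char_times_cauchy_char[OF assms(1) y(1)]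
      real_distribution.char_times_cauchy_char[OF assms(2) y(1)]
    using y(1) by (simp add: eq)
  then show "char M \<zeta> = char N \<zeta>" using y(2) by simp
qed

section \<open>Complex evaluation of real polynomials\<close>

definition ceval :: "real poly \<Rightarrow> complex \<Rightarrow> complex" where
  "ceval f z = poly (map_poly of_real f) z"

lemma ceval_0 [simp]: "ceval 0 z = 0" by (simp add: ceval_def)

lemma ceval_pCons [simp]: "ceval (pCons c f) z = of_real c + z * ceval f z"
  by (simp add: ceval_def map_poly_pCons)

lemma ceval_add [simp]: "ceval (f + g) z = ceval f z + ceval g z"
proof -
  have "map_poly complex_of_real (f + g) = map_poly of_real f + map_poly of_real g"
    by (rule poly_eqI) (simp add: coeff_map_poly)
  then show ?thesis by (simp add: ceval_def)
qed

lemma ceval_smult [simp]: "ceval (smult c f) z = of_real c * ceval f z"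
  by (simp add: ceval_def map_poly_smult)

lemma ceval_of_real [simp]: "ceval f (of_real x) = of_real (poly f x)"
  by (induction f) auto

definition diff_quotient :: "real poly \<Rightarrow> complex \<Rightarrow> real \<Rightarrow> complex" where
  "diff_quotient f z x = (if z = of_real x then poly (pderiv (map_poly of_real f)) z
     else (ceval f z - of_real (poly f x)) / (z - of_real x))"

lemma diff_quotient_0 [simp]: "diff_quotient 0 z x = 0"
  by (simp add: diff_quotient_def)

lemma diff_quotient_pCons:
  "diff_quotient (pCons c f) z x = z * diff_quotient f z x + of_real (poly f x)"
proof (cases "z = of_real x")
  case True
  then have "poly (map_poly of_real f) z = of_real (poly f x)" using ceval_of_real[of f x] by (simp add: ceval_def)
  then show ?thesis using True by (simp add: diff_quotient_def map_poly_pCons pderiv_pCons)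
next
  case False
  then show ?thesis by (simp add: diff_quotient_def field_simps)
qed

lemma diff_quotient_add:
  "diff_quotient (f + g) z x = diff_quotient f z x + diff_quotient g z x"
proof -
  have "map_poly complex_of_real (f + g) = map_poly of_real f + map_poly of_real g"
    by (rule poly_eqI) (simp add: coeff_map_poly)
  then show ?thesis by (simp add: diff_quotient_def pderiv_add add_divide_distrib[symmetric] diff_divide_distrib[symmetric] algebra_simps)
qed

lemma diff_quotient_smult: "diff_quotient (smult c f) z x = of_real c * diff_quotient f z x"
  by (simp add: diff_quotient_def map_poly_smult pderiv_smult algebra_simps)

section \<open>Orthonormal polynomials and Jacobi matrices\<close>

locale orthonormal_system = real_distribution M for M +
  fixes p :: "nat \<Rightarrow> real poly"
  assumes integrable_power: "integrable M (\<lambda>x. x ^ n)"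
    and degree_p: "degree (p n) = n" and lead_p: "lead_coeff (p n) > 0"
    and orthonormal: "(LINT x|M. poly (p n) x * poly (p m) x) = (if n = m then 1 else 0)"
begin

lemma integrable_poly: "integrable M (\<lambda>x. poly f x)"
  unfolding poly_altdef by (intro Bochner_Integration.integrable_sum integrable_mult_right integrable_power)

lemma integrable_poly_mult: "integrable M (\<lambda>x. poly f x * poly g x)"
  using integrable_poly[of "f * g"] by simp

lemma coeff_p: "coeff (p n) n > 0" using lead_p[of n] by (simp add: degree_p)

lemma p_0: "p 0 = 1"
proof -
  obtain c where c: "p 0 = [:c:]" using degree_p[of 0] by (rule degree_eq_zeroE)
  have "c * c = 1" using orthonormal[of 0 0] prob_space by (simp add: c)
  moreover have "c > 0" using coeff_p[of 0] by (simp add: c)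
  ultimately have "c = 1" by (metis abs_of_pos abs_1 abs_square_eq_1 power2_eq_square)
  then show ?thesis by (simp add: c one_pCons)
qed

lemma expansion_exists: "degree f \<le> n \<Longrightarrow> \<exists>c. f = (\<Sum>k\<le>n. smult (c k) (p k))"
proof (induction n arbitrary: f)
  case 0
  then obtain d where "f = [:d:]" by (metis degree_eq_zeroE le_zero_eq)
  then show ?case by (intro exI[of _ "\<lambda>_. d"]) (simp add: p_0)
next
  case (Suc n)
  define d where "d = coeff f (Suc n) / coeff (p (Suc n)) (Suc n)"
  define g where "g = f - smult d (p (Suc n))"
  have "coeff g i = 0" if "i > n" for i
  proof (cases "i = Suc n")
    case True
    then show ?thesis using coeff_p[of "Suc n"] by (simp add: g_def d_def)
  next
    case False
    then have "i > Suc n" using that by simp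
    then show ?thesis using Suc.prems by (simp add: g_def coeff_eq_0 degree_p)
  qed
  then have "degree g \<le> n" by (intro degree_le) auto
  then obtain c where c: "g = (\<Sum>k\<le>n. smult (c k) (p k))" using Suc.IH by blast
  have "(\<Sum>k\<le>n. smult ((c(Suc n := d)) k) (p k)) = g"
    unfolding c by (intro sum.cong) auto
  then have "f = (\<Sum>k\<le>Suc n. smult ((c(Suc n := d)) k) (p k))" by (simp add: g_def)
  then show ?case by blast
qed

lemma expansion:
  assumes "degree f \<le> n"
  shows "f = (\<Sum>k\<le>n. smult (LINT x|M. poly f x * poly (p k) x) (p k))"
proof -
  obtain c where c: "f = (\<Sum>k\<le>n. smult (c k) (p k))" using expansion_exists[OF assms] by blast
  have "(LINT x|M. poly f x * poly (p k) x) = c k" if "k \<le> n" for k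
  proof -
    have "(LINT x|M. poly f x * poly (p k) x) = (LINT x|M. (\<Sum>j\<le>n. c j * (poly (p j) x * poly (p k) x)))"
      by (simp add: c poly_sum sum_distrib_right mult.assoc)
    also have "\<dots> = (\<Sum>j\<le>n. c j * (LINT x|M. poly (p j) x * poly (p k) x))"
      by (subst Bochner_Integration.integral_sum) (auto intro!: integrable_mult_right integrable_poly_mult)
    also have "\<dots> = c k" using that by (simp add: orthonormal if_distrib cong: if_cong)
    finally show ?thesis .
  qed
  then have "(\<Sum>k\<le>n. smult (LINT x|M. poly f x * poly (p k) x) (p k)) = (\<Sum>k\<le>n. smult (c k) (p k))"
    by (intro sum.cong) auto
  then show ?thesis using c by simp
qed

lemma orthogonal_lower_degree:
  assumes "degree f < n" shows "(LINT x|M. poly f x * poly (p n) x) = 0"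
proof -
  obtain c where c: "f = (\<Sum>k\<le>n - 1. smult (c k) (p k))"
    using expansion_exists[of f "n - 1"] assms by (metis Suc_pred' less_Suc_eq_le not_less_zero neq0_conv)
  have "(LINT x|M. poly f x * poly (p n) x) = (LINT x|M. (\<Sum>j\<le>n - 1. c j * (poly (p j) x * poly (p n) x)))"
    by (simp add: c poly_sum sum_distrib_right mult.assoc)
  also have "\<dots> = (\<Sum>j\<le>n - 1. c j * (LINT x|M. poly (p j) x * poly (p n) x))"
    by (subst Bochner_Integration.integral_sum) (auto intro!: integrable_mult_right integrable_poly_mult)
  also have "\<dots> = 0" using assms by (intro sum.neutral) (auto simp: orthonormal)
  finally show ?thesis .
qed

text \<open>
  The diagonal and off-diagonal entries of the Jacobi matrix, the matrix of multiplication by the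
  variable in the basis \<open>p\<close>.
\<close>

definition diag :: "nat \<Rightarrow> real" where
  "diag n = (LINT x|M. x * poly (p n) x * poly (p n) x)"

definition offdiag :: "nat \<Rightarrow> real" where
  "offdiag n = (LINT x|M. x * poly (p n) x * poly (p (Suc n)) x)"

lemma three_term:
  "pCons 0 (p n) = smult (offdiag n) (p (Suc n)) + smult (diag n) (p n)
     + (if n = 0 then 0 else smult (offdiag (n - 1)) (p (n - 1)))"
proof -
  define c where "c k = (LINT x|M. x * poly (p n) x * poly (p k) x)" for k
  have e: "pCons 0 (p n) = (\<Sum>k\<le>Suc n. smult (c k) (p k))"
    using expansion[of "pCons 0 (p n)" "Suc n"] degree_pCons_le[of 0 "p n"] by (simp add: degree_p c_def)
  have low: "c k = 0" if "Suc k < n" for k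
  proof -
    have "degree (pCons 0 (p k)) < n"
      using degree_pCons_le[of 0 "p k"] that by (simp add: degree_p)
    from orthogonal_lower_degree[OF this] show ?thesis by (simp add: c_def mult_ac)
  qed
  show ?thesis
  proof (cases n)
    case 0
    then show ?thesis using e by (simp add: c_def diag_def offdiag_def)
  next
    case (Suc m)
    have "(\<Sum>k<m. smult (c k) (p k)) = 0" using low by (intro sum.neutral) (auto simp: Suc)
    then have "pCons 0 (p n) = smult (c m) (p m) + smult (c n) (p n) + smult (c (Suc n)) (p (Suc n))"
      unfolding e by (simp add: Suc flip: lessThan_Suc_atMost)
    moreover have "c m = offdiag m" by (simp add: c_def offdiag_def Suc mult_ac)
    ultimately show ?thesis by (simp add: Suc c_def diag_def offdiag_def add_ac)
  qed
qed

lemma offdiag_pos: "offdiag n > 0"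
proof -
  have "coeff (pCons 0 (p n)) (Suc n) = offdiag n * coeff (p (Suc n)) (Suc n)"
    by (subst three_term) (auto simp: coeff_eq_0 degree_p)
  then have "offdiag n * coeff (p (Suc n)) (Suc n) > 0" using coeff_p[of n] by simp
  then show ?thesis using coeff_p[of "Suc n"] by (simp add: zero_less_mult_iff)
qed

end

sublocale orthonormal_system \<subseteq> jacobi_matrix diag offdiag
  by unfold_locales (rule offdiag_pos)

context orthonormal_system
begin

lemma pvec_ceval: "pvec p z n = ceval (p n) z"
  by (simp add: pvec_def ceval_def)

lemma pvec_eq_P: "pvec p z = P z"
proof (rule recurrence_unique[OF _ recurrence_P])
  have step: "z * ceval (p n) z = of_real (offdiag n) * ceval (p (Suc n)) z + of_real (diag n) * ceval (p n) z
      + (if n = 0 then 0 else of_real (offdiag (n - 1)) * ceval (p (n - 1)) z)" for n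
    using arg_cong[OF three_term[of n], of "\<lambda>f. ceval f z"] by (simp split: if_splits)
  show "recurrence z 0 (pvec p z)"
    unfolding recurrence_def pvec_ceval using step[of 0] step[of "Suc _"] by (simp add: algebra_simps)
qed (simp add: pvec_ceval p_0 one_pCons)

lemma integrable_diff_quotient:
  assumes "orthonormal_system N p" shows "integrable N (diff_quotient f z)"
proof -
  interpret N: orthonormal_system N p by (rule assms)
  show ?thesis
  proof (induction f)
    case 0
    have "diff_quotient 0 z = (\<lambda>_. 0)" by (rule ext) simp
    then show ?case by simp
  next
    case (pCons c f)
    have "integrable N (\<lambda>x. z * diff_quotient f z x + complex_of_real (poly f x))"
      by (intro Bochner_Integration.integrable_add integrable_mult_right pCons.IH integrable_of_real N.integrable_poly)
    then show ?case by (simp add: diff_quotient_pCons[abs_def])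
  qed
qed

text \<open>
  Passing from \<open>f\<close> to \<open>x * f\<close> multiplies the difference quotient by \<open>z\<close> and adds \<open>f x\<close>, so integration of the
  three-term identity gives the recurrence; the added term contributes the integral of \<open>p n\<close>, which is
  1 for \<open>n = 0\<close> and 0 otherwise. The measure \<open>N\<close> may differ from \<open>M\<close>: all solutions of a moment problem
  share the polynomials \<open>p\<close> and hence the polynomials of the second kind.
\<close>

lemma qvec_eq_Q:
  assumes "orthonormal_system N p" shows "qvec N p z = Q z"
proof (rule recurrence_unique[OF _ recurrence_Q])
  interpret N: orthonormal_system N p by (rule assms)
  define q where "q f = (LINT x|N. diff_quotient f z x)" for f
  note int = integrable_diff_quotient[OF assms]
  have q: "qvec N p z n = q (p n)" for n
    unfolding qvec_def q_def diff_quotient_def pvec_ceval ceval_of_real by (rule refl)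
  have q_add: "q (f + g) = q f + q g" for f g
    unfolding q_def diff_quotient_add by (intro Bochner_Integration.integral_add int)
  have q_smult: "q (smult c f) = of_real c * q f" for c f
    unfolding q_def diff_quotient_smult by simp
  have q_0: "q 0 = 0" by (simp add: q_def)
  have q_pCons: "q (pCons 0 f) = z * q f + of_real (LINT x|N. poly f x)" for f
    unfolding q_def diff_quotient_pCons using int N.integrable_poly
    by (subst Bochner_Integration.integral_add) (auto intro!: integrable_mult_right integrable_of_real)
  have L: "(LINT x|N. poly (p n) x) = (if n = 0 then 1 else 0)" for n
    using N.orthonormal[of n 0] by (simp add: N.p_0)
  have step: "z * q (p n) + (if n = 0 then 1 else 0) =
      of_real (offdiag n) * q (p (Suc n)) + of_real (diag n) * q (p n)
      + (if n = 0 then 0 else of_real (offdiag (n - 1)) * q (p (n - 1)))" for n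
    using arg_cong[OF three_term[of n], of q]
    by (simp add: q_pCons L q_add q_smult q_0 split: if_splits)
  have q1: "q (p 0) = 0"
    by (simp add: q_def p_0 one_pCons diff_quotient_pCons)
  show "recurrence z 1 (qvec N p z)"
    unfolding recurrence_def q using step[of 0] step[of "Suc _"] q1 by (simp add: algebra_simps)
  show "qvec N p z 0 = Q z 0" by (simp add: q q1)
qed

lemma bessel_bounded:
  assumes [measurable]: "f \<in> borel_measurable borel" and B: "\<And>x. \<bar>f x\<bar> \<le> B"
  shows "(\<Sum>k\<le>n. (LINT x|M. f x * poly (p k) x)\<^sup>2) \<le> B\<^sup>2"
    and "integrable M (\<lambda>x. f x * poly g x)"
proof -
  have meas: "f \<in> borel_measurable M" by measurable
  show int_f: "integrable M (\<lambda>x. f x * poly g x)" for g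
  proof (rule Bochner_Integration.integrable_bound)
    show "integrable M (\<lambda>x. B * poly g x)" by (intro integrable_mult_right integrable_poly)
    show "AE x in M. norm (f x * poly g x) \<le> norm (B * poly g x)"
      by (intro AE_I2) (auto simp: abs_mult intro!: mult_right_mono order_trans[OF B abs_ge_self])
    show "(\<lambda>x. f x * poly g x) \<in> borel_measurable M"
      using meas borel_measurable_integrable[OF integrable_poly[of g]] by (rule borel_measurable_times)
  qed
  have int_f2: "integrable M (\<lambda>x. (f x)\<^sup>2)"
    by (rule integrable_const_bound[of _ "B\<^sup>2"])
       (use B meas in \<open>auto simp: abs_le_square_iff[symmetric] intro: order_trans[OF _ abs_ge_self]\<close>)
  define c where "c k = (LINT x|M. f x * poly (p k) x)" for k
  define g where "g = (\<Sum>k\<le>n. smult (c k) (p k))"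
  have g1: "(LINT x|M. f x * poly g x) = (\<Sum>k\<le>n. (c k)\<^sup>2)"
  proof -
    have "(LINT x|M. f x * poly g x) = (LINT x|M. (\<Sum>k\<le>n. c k * (f x * poly (p k) x)))"
      by (simp add: g_def poly_sum sum_distrib_left mult_ac)
    also have "\<dots> = (\<Sum>k\<le>n. c k * (LINT x|M. f x * poly (p k) x))"
      by (subst Bochner_Integration.integral_sum) (auto intro!: integrable_mult_right int_f)
    finally show ?thesis by (simp add: c_def power2_eq_square)
  qed
  have g2: "(LINT x|M. poly g x * poly g x) = (\<Sum>k\<le>n. (c k)\<^sup>2)"
  proof -
    have "(LINT x|M. poly g x * poly g x) = (LINT x|M. (\<Sum>k\<le>n. c k * (poly g x * poly (p k) x)))"
      by (subst (2) g_def) (simp add: poly_sum sum_distrib_left mult_ac)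
    also have "\<dots> = (\<Sum>k\<le>n. c k * (LINT x|M. poly g x * poly (p k) x))"
      by (subst Bochner_Integration.integral_sum) (auto intro!: integrable_mult_right integrable_poly_mult)
    also have "\<dots> = (\<Sum>k\<le>n. c k * c k)"
    proof (intro sum.cong refl)
      fix k assume k: "k \<in> {..n}"
      have "(LINT x|M. poly g x * poly (p k) x) = (LINT x|M. (\<Sum>j\<le>n. c j * (poly (p j) x * poly (p k) x)))"
        by (simp add: g_def poly_sum sum_distrib_right mult.assoc)
      also have "\<dots> = (\<Sum>j\<le>n. c j * (LINT x|M. poly (p j) x * poly (p k) x))"
        by (subst Bochner_Integration.integral_sum) (auto intro!: integrable_mult_right integrable_poly_mult)
      also have "\<dots> = c k" using k by (simp add: orthonormal if_distrib cong: if_cong)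
      finally show "c k * (LINT x|M. poly g x * poly (p k) x) = c k * c k" by simp
    qed
    finally show ?thesis by (simp add: power2_eq_square)
  qed
  have "0 \<le> (LINT x|M. (f x - poly g x)\<^sup>2)" by (rule Bochner_Integration.integral_nonneg) simp
  also have "\<dots> = (LINT x|M. (f x)\<^sup>2 - 2 * (f x * poly g x) + poly g x * poly g x)"
    by (simp add: power2_eq_square algebra_simps)
  also have "\<dots> = (LINT x|M. (f x)\<^sup>2) - 2 * (LINT x|M. f x * poly g x) + (LINT x|M. poly g x * poly g x)"
    using int_f[of g] int_f2 integrable_poly_mult[of g g] by simp
  finally have "(\<Sum>k\<le>n. (c k)\<^sup>2) \<le> (LINT x|M. (f x)\<^sup>2)" unfolding g1 g2 by simp
  also have "\<dots> \<le> (LINT x|M. B\<^sup>2)"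
    using B by (intro Bochner_Integration.integral_mono int_f2)
      (auto simp: abs_le_square_iff[symmetric] intro: order_trans[OF _ abs_ge_self])
  also have "\<dots> = B\<^sup>2" using prob_space by simp
  finally show "(\<Sum>k\<le>n. (LINT x|M. f x * poly (p k) x)\<^sup>2) \<le> B\<^sup>2" by (simp add: c_def)
qed

end

text \<open>
  These are the Fourier coefficients of the bounded function \<open>\<lambda>x. 1 / (x - z)\<close> with respect to \<open>p\<close> in \<open>L\<^sup>2(N)\<close>,
  and Bessel's inequality applies.
\<close>

lemma (in orthonormal_system) resolvent_coefficients_ell2:
  assumes N: "orthonormal_system N p" and z: "Im z \<noteq> 0"
  shows "(\<lambda>n. stieltjes N z * P z n + Q z n) \<in> ell2"
proof -
  interpret N: orthonormal_system N p by (rule N)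
  define r where "r x = 1 / (complex_of_real x - z)" for x
  define B where "B = 1 / \<bar>Im z\<bar>"
  have rB: "norm (r x) \<le> B" for x unfolding r_def B_def by (rule norm_resolvent_le[OF z])
  have [measurable]: "(\<lambda>x. Re (r x)) \<in> borel_measurable borel" "(\<lambda>x. Im (r x)) \<in> borel_measurable borel"
    unfolding r_def by measurable
  have ReB: "\<bar>Re (r x)\<bar> \<le> B" and ImB: "\<bar>Im (r x)\<bar> \<le> B" for x
    using rB[of x] abs_Re_le_cmod[of "r x"] abs_Im_le_cmod[of "r x"] by linarith+
  note re = N.bessel_bounded[of "\<lambda>x. Re (r x)" B, OF _ ReB, simplified]
  note im = N.bessel_bounded[of "\<lambda>x. Im (r x)" B, OF _ ImB, simplified]
  define c where "c k = (LINT x|N. r x * of_real (poly (p k) x))" for k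
  have c_eq: "c k = Complex (LINT x|N. Re (r x) * poly (p k) x) (LINT x|N. Im (r x) * poly (p k) x)" for k
  proof -
    have "integrable N (\<lambda>x. r x * of_real (poly (p k) x))"
    proof (rule Bochner_Integration.integrable_bound)
      show "integrable N (\<lambda>x. B * poly (p k) x)" by (intro integrable_mult_right N.integrable_poly)
      show "(\<lambda>x. r x * of_real (poly (p k) x)) \<in> borel_measurable N"
        using N.integrable_resolvent[OF z] N.integrable_poly[of "p k"]
        unfolding r_def[symmetric] by (auto intro!: borel_measurable_times borel_measurable_of_real)
      show "AE x in N. norm (r x * of_real (poly (p k) x)) \<le> norm (B * poly (p k) x)"
        by (intro AE_I2) (auto simp: norm_mult abs_mult intro!: mult_right_mono order_trans[OF rB abs_ge_self])
    qed
    then show ?thesis by (simp add: c_def complex_eq_iff flip: integral_Re integral_Im)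
  qed
  have bound: "(\<Sum>k\<le>n. (norm (c k))\<^sup>2) \<le> 2 * B\<^sup>2" for n
    using re(1)[of n] im(1)[of n] by (simp add: c_eq cmod_power2 sum.distrib)
  have "summable (\<lambda>k. (norm (c k))\<^sup>2)"
    by (rule bounded_imp_summable[of _ "2 * B\<^sup>2"]) (use bound in auto)
  then have "c \<in> ell2" by (simp add: ell2_def)
  moreover have "c = (\<lambda>n. stieltjes N z * P z n + Q z n)"
  proof
    fix n
    have "c n = (LINT x|N. r x * ceval (p n) z + diff_quotient (p n) z x)"
      unfolding c_def
    proof (intro Bochner_Integration.integral_cong refl)
      fix x
      define d where "d = complex_of_real x - z"
      have d: "d \<noteq> 0" "z - of_real x = - d" unfolding d_def by (rule of_real_neq_nonreal[OF z]) simp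
      then have "diff_quotient (p n) z x = (ceval (p n) z - of_real (poly (p n) x)) / (- d)"
        by (auto simp: diff_quotient_def)
      then show "r x * of_real (poly (p n) x) = r x * ceval (p n) z + diff_quotient (p n) z x"
        using d(1) by (simp add: r_def d_def[symmetric] field_simps)
    qed
    also have "\<dots> = (LINT x|N. r x) * ceval (p n) z + (LINT x|N. diff_quotient (p n) z x)"
    proof -
      have "integrable N r" unfolding r_def by (rule N.integrable_resolvent[OF z])
      from Bochner_Integration.integral_add[OF integrable_mult_left[OF this] integrable_diff_quotient[OF N]]
      show ?thesis by simp
    qed
    also have "(LINT x|N. diff_quotient (p n) z x) = qvec N p z n"
      unfolding qvec_def diff_quotient_def pvec_ceval ceval_of_real by (rule refl)
    finally show "c n = stieltjes N z * P z n + Q z n"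
      by (simp add: stieltjes_def r_def qvec_eq_Q[OF N] pvec_eq_P[symmetric] pvec_ceval)
  qed
  ultimately show ?thesis by simp
qed

lemma moment_solution_orthonormal_system:
  assumes "M \<in> moment_solutions s" "s 0 = 1" "orthonormal_polynomials s p"
  shows "orthonormal_system M p"
proof -
  have sets: "sets M = sets borel" and int: "\<And>n. integrable M (\<lambda>x. x ^ n)" and mom: "\<And>n. (LINT x|M. x ^ n) = s n"
    using assms(1) by (auto simp: moment_solutions_def)
  have "integrable M (\<lambda>x. 1::real)" using int[of 0] by simp
  then have fin: "emeasure M (space M) < \<infinity>" by (simp add: integrable_iff_bounded)
  interpret finite_measure M by (rule finite_measureI) (use fin in auto)
  have "measure M (space M) = 1" using mom[of 0] assms(2) by simp
  then have "prob_space M" by (intro prob_spaceI) (simp add: emeasure_eq_measure)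
  then have "real_distribution M"
    unfolding real_distribution_def real_distribution_axioms_def using sets by simp
  then show ?thesis
    unfolding orthonormal_system_def orthonormal_system_axioms_def
    using int assms(1,3) unfolding orthonormal_polynomials_def by blast
qed

text \<open>
  Two different solutions have different Stieltjes transforms at some \<open>z\<close>. The difference of their
  resolvent coefficients is a nonzero multiple of \<open>P z\<close>, so \<open>P z\<close> and then \<open>Q z\<close> are square summable.
\<close>

lemma indeterminate_limit_circle:
  assumes "indeterminate s" "s 0 = 1" "orthonormal_polynomials s p" "M \<in> moment_solutions s"
  shows "\<exists>z. limit_circle (orthonormal_system.diag M p) (orthonormal_system.offdiag M p) z"
proof -
  obtain N N' where N: "N \<in> moment_solutions s" "N' \<in> moment_solutions s" "N \<noteq> N'"
    using assms(1) by (auto simp: indeterminate_def)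
  interpret orthonormal_system M p by (rule moment_solution_orthonormal_system) fact+
  interpret N: orthonormal_system N p by (rule moment_solution_orthonormal_system) fact+
  interpret N': orthonormal_system N' p by (rule moment_solution_orthonormal_system) fact+
  obtain z where z: "Im z > 0" "stieltjes N z \<noteq> stieltjes N' z"
    using stieltjes_unique[OF N.real_distribution_axioms N'.real_distribution_axioms] N(3) by blast
  define w w' where "w = stieltjes N z" and "w' = stieltjes N' z"
  have c: "(\<lambda>n. w * P z n + Q z n) \<in> ell2" "(\<lambda>n. w' * P z n + Q z n) \<in> ell2"
    unfolding w_def w'_def using z(1)
    by (auto intro!: resolvent_coefficients_ell2 N.orthonormal_system_axioms N'.orthonormal_system_axioms)
  have "(\<lambda>n. 1 / (w - w') * ((w * P z n + Q z n) - (w' * P z n + Q z n))) \<in> ell2"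
    by (intro ell2_scale ell2_diff c)
  also have "(\<lambda>n. 1 / (w - w') * ((w * P z n + Q z n) - (w' * P z n + Q z n))) = P z"
    using z(2) by (auto simp: w_def w'_def left_diff_distrib[symmetric])
  finally have P: "P z \<in> ell2" .
  have "(\<lambda>n. (w * P z n + Q z n) - w * P z n) \<in> ell2" by (intro ell2_scale ell2_diff c P)
  then have Q: "Q z \<in> ell2" by simp
  have "limit_circle diag offdiag z" by unfold_locales (rule P Q)+
  then show ?thesis by blast
qed

section \<open>The optimal families of an indeterminate moment problem\<close>

theorem mainTheorem2:
  fixes s :: "nat \<Rightarrow> real" and p :: "nat \<Rightarrow> real poly" and M :: "real measure"
    and v0 :: complex
  assumes "hamburger_moment_sequence s" and "s 0 = 1" and "indeterminate s"
    and "orthonormal_polynomials s p"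
    and "M \<in> moment_solutions s"
    and "v0 \<in> \<real>"
  shows
    "(\<forall>u1 u2. u1 \<noteq> u2 \<and> nevD p u1 v0 = 0 \<and> nevD p u2 v0 = 0 \<longrightarrow>
        ell2_orthogonal (pvec p u1) (pvec p u2) \<and>
        ell2_inner (pvec p u1) (pvec p u2) = nevD p u1 u2 / (u1 - u2) \<and>
        nevD p u1 u2 = nevD p u1 v0 * nevC M p v0 u2 - nevB M p u1 v0 * nevD p v0 u2 \<and>
        nevD p u1 v0 * nevC M p v0 u2 - nevB M p u1 v0 * nevD p v0 u2 = 0)
     \<and>
     (\<forall>u1. u1 \<noteq> v0 \<and> nevD p u1 v0 = 0 \<longrightarrow>
        (\<forall>u. nevD p u v0 = 0 \<and> u \<noteq> u1 \<longrightarrow>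
           ell2_orthogonal (pvec p u1) (\<lambda>n. pvec p u n + nevB M p u v0 * pvec p v0 n)) \<and>
        (\<forall>c\<in>cspan {(\<lambda>n. pvec p u n + nevB M p u v0 * pvec p v0 n) |u.
                     nevD p u v0 = 0 \<and> u \<noteq> u1}. ell2_orthogonal (pvec p u1) c) \<and>
        \<not> dense_in ell2 (cspan {(\<lambda>n. pvec p u n + nevB M p u v0 * pvec p v0 n) |u.
                     nevD p u v0 = 0 \<and> u \<noteq> u1}))
     \<and>
     optimal_for_density_in ell2 {u. u \<in> \<real> \<and> nevD p u v0 = 0 \<and> u \<noteq> v0}
       (\<lambda>u n. pvec p u n + nevB M p u v0 * pvec p v0 n)
     \<and>
     (\<forall>u1\<in>{u. u \<in> \<real> \<and> nevA M p u v0 = 0 \<and> u \<noteq> v0}.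
        \<not> dense_in ell2 (cspan ((\<lambda>u n. qvec M p u n - nevC M p u v0 * qvec M p v0 n) `
             ({u. u \<in> \<real> \<and> nevA M p u v0 = 0 \<and> u \<noteq> v0} - {u1}))))
     \<and>
     optimal_for_density_in ell2_zero {u. u \<in> \<real> \<and> nevA M p u v0 = 0 \<and> u \<noteq> v0}
       (\<lambda>u n. qvec M p u n - nevC M p u v0 * qvec M p v0 n)"
proof -
  interpret orthonormal_system M p by (rule moment_solution_orthonormal_system) fact+
  obtain z0 where "limit_circle diag offdiag z0"
    using indeterminate_limit_circle assms by blast
  then interpret limit_circle diag offdiag z0 .
  have p: "pvec p = P" by (rule ext) (rule pvec_eq_P)
  have q: "qvec M p = Q" by (rule ext) (rule qvec_eq_Q[OF orthonormal_system_axioms])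
  have A: "nevA M p = fA" and B: "nevB M p = fB" and C: "nevC M p = fC" and D: "nevD p = fD"
    by (intro ext, simp add: nevA_def nevB_def nevC_def nevD_def fA_def fB_def fC_def fD_def p q)+
  have fam: "(\<lambda>u n. P u n + fB u v0 * P v0 n) = family v0" by (simp add: family_def[abs_def])
  have fam': "(\<lambda>n. P u n + fB u v0 * P v0 n) = family v0 u" for u by (simp add: family_def)
  have part1: "ell2_orthogonal (P u1) (P u2) \<and>
        ell2_inner (P u1) (P u2) = fD u1 u2 / (u1 - u2) \<and>
        fD u1 u2 = fD u1 v0 * fC v0 u2 - fB u1 v0 * fD v0 u2 \<and>
        fD u1 v0 * fC v0 u2 - fB u1 v0 * fD v0 u2 = 0"
    if "u1 \<noteq> u2" "fD u1 v0 = 0" "fD u2 v0 = 0" for u1 u2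
    using P_orthogonal[OF that(2,3,1) assms(6)] inner_PP[OF that(1) fD_zero_real[OF that(3) assms(6)]]
      fD_zeros[OF that(2,3)] fD_pluecker[of u1 u2 v0] by simp
  have part2: "ell2_orthogonal (P u1) (family v0 u)"
    if "u1 \<noteq> v0" "fD u1 v0 = 0" "fD u v0 = 0" "u \<noteq> u1" for u1 u
    by (rule family_orthogonal) (use that assms(6) in auto)
  have part2': "ell2_orthogonal (P u1) c"
    if "u1 \<noteq> v0" "fD u1 v0 = 0" "c \<in> cspan {family v0 u |u. fD u v0 = 0 \<and> u \<noteq> u1}" for u1 c
    by (rule ell2_orthogonal_cspan[OF _ P_ell2 that(3)]) (use part2 that in auto)
  have part2'': "\<not> dense_in ell2 (cspan {family v0 u |u. fD u v0 = 0 \<and> u \<noteq> u1})"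
    if "u1 \<noteq> v0" "fD u1 v0 = 0" for u1
    by (rule not_dense_if_orthogonal_to_P[of _ u1]) (use part2 that in auto)
  have part3: "\<not> dense_in ell2 (cspan ((\<lambda>u n. Q u n - fC u v0 * Q v0 n) ` J))" for J
  proof (rule not_dense_if_orthogonal[where x="basis_vector 0" and k=0])
    have "d 0 = 0 \<and> d \<in> ell2" if d: "d \<in> cspan ((\<lambda>u n. Q u n - fC u v0 * Q v0 n) ` J)" for d
    proof -
      obtain F t where "finite F" "F \<subseteq> J" "d = (\<lambda>n. \<Sum>u\<in>F. t u * (Q u n - fC u v0 * Q v0 n))"
        using d unfolding cspan_image by (elim CollectE exE conjE)
      then show ?thesis by (auto intro!: ell2_sum ell2_scale ell2_diff Q_ell2)
    qed
    note 0 = this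
    show "cspan ((\<lambda>u n. Q u n - fC u v0 * Q v0 n) ` J) \<subseteq> ell2" using 0 by blast
    show "ell2_inner (basis_vector 0) d = 0" if "d \<in> cspan ((\<lambda>u n. Q u n - fC u v0 * Q v0 n) ` J)" for d
    proof -
      have "(\<lambda>n. basis_vector 0 n * cnj (d n)) = (\<lambda>n. 0)"
        using 0[OF that] by (auto simp: basis_vector_def)
      then show ?thesis by (simp add: ell2_inner_def)
    qed
  qed (auto simp: basis_vector_ell2 basis_vector_def)
  show ?thesis
    unfolding p q A B C D fam fam'
    using part1 part2 part2' part2'' part3 family_optimal[OF assms(6)] second_kind_optimal[OF assms(6)]
    by (simp add: index_set_def)
qed

end
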